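(* Let $n\ge3$. Assume that $K$ is a continuous real-valued function on $\mathbb S^n\setminus\{\mathbf n,\mathbf s\}$ which is rotationally symmetric about the line through $\mathbf n$ and $\mathbf s$. Assume further that there exists $-1<c<1$ such that $K(\theta)>K(\theta')$ if $\theta_{n+1}>\theta'_{n+1}\ge c$, and $K(\theta)>K(\theta')$ if $\theta_{n+1}<\theta'_{n+1}\le c$. Then any solution $v\in C^2(\mathbb S^n\setminus\{\mathbf n,\mathbf s\})$ of $$-\mathcal L_{\mathbb S^n}v=K(\theta)v^{(n+2)/(n-2)}\quad\text{and}\quad v>0\quad\text{on }\mathbb S^n\setminus\{\mathbf n,\mathbf s\}$$ satisfying $\liminf_{\theta\to\mathbf n}v(\theta)>0$ and $\liminf_{\theta\to\mathbf s}v(\theta)>0$ is rotationally symmetric about the line through $\mathbf n$ and $\mathbf s$.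
   Context: $\mathbb S^n\subset\mathbb R^{n+1}$ is the unit sphere with its standard metric, points written $\theta=(\theta_1,\dots,\theta_{n+1})$; $\mathbf n=(0,\dots,0,1)$, $\mathbf s=(0,\dots,0,-1)$; $\mathcal L_{\mathbb S^n}:=\Delta_{\mathbb S^n}-\frac{n(n-2)}4$ with $\Delta_{\mathbb S^n}$ the Laplace–Beltrami operator. *)

theory Defs
  imports "HOL-Analysis.Analysis"
begin

text \<open>
  The space \<open>\<real>\<^sup>n\<^sup>+\<^sup>1\<close> with \<open>n = CARD('n)\<close> is rendered as the Euclidean space \<open>(real ^ 'n) \<times> real\<close>, whose
  product norm is the Euclidean one. A point is \<open>\<theta> = (\<theta>\<^sub>1, \<dots>, \<theta>\<^sub>n, \<theta>\<^sub>n\<^sub>+\<^sub>1)\<close>, so that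
  \<open>\<theta>\<^sub>n\<^sub>+\<^sub>1\<close> is \<open>snd \<theta>\<close> and the unit sphere \<open>sphere 0 1\<close> has dimension \<open>n\<close>.
\<close>

definition north_pole :: "(real ^ 'n::finite) \<times> real"
  where "north_pole = (0, 1)"

definition south_pole :: "(real ^ 'n::finite) \<times> real"
  where "south_pole = (0, -1)"

definition punctured_sphere :: "((real ^ 'n::finite) \<times> real) set"
  where "punctured_sphere = sphere 0 1 - {north_pole, south_pole}"

definition rotationally_symmetric ::
    "((real ^ 'n::finite) \<times> real) set \<Rightarrow> ((real ^ 'n) \<times> real \<Rightarrow> real) \<Rightarrow> bool"
  where "rotationally_symmetric D f \<longleftrightarrow>
    (\<forall>A. rotation_matrix A \<longrightarrow> (\<forall>(x, t) \<in> D. f (A *v x, t) = f (x, t)))"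

definition C2_on_open :: "'a::real_normed_vector set \<Rightarrow> ('a \<Rightarrow> real) \<Rightarrow> bool"
  where "C2_on_open U F \<longleftrightarrow> open U \<and>
    (\<exists>(F' :: 'a \<Rightarrow> 'a \<Rightarrow>\<^sub>L real) (F'' :: 'a \<Rightarrow> 'a \<Rightarrow>\<^sub>L 'a \<Rightarrow>\<^sub>L real).
      (\<forall>x\<in>U. (F has_derivative blinfun_apply (F' x)) (at x)) \<and>
      (\<forall>x\<in>U. (F' has_derivative blinfun_apply (F'' x)) (at x)) \<and>
      continuous_on U F'')"

text \<open>
  For a relatively open subset \<open>S\<close> of a smooth submanifold of a Euclidean space: \<open>f\<close> is of class
  \<open>C\<^sup>2\<close> on \<open>S\<close> if near every point of \<open>S\<close> it is the restriction of an ambient \<open>C\<^sup>2\<close> function.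
\<close>

definition C2_on_submanifold :: "'a::real_normed_vector set \<Rightarrow> ('a \<Rightarrow> real) \<Rightarrow> bool"
  where "C2_on_submanifold S f \<longleftrightarrow>
    (\<forall>p\<in>S. \<exists>U F. p \<in> U \<and> C2_on_open U F \<and> (\<forall>x\<in>U \<inter> S. F x = f x))"

text \<open>
  The Laplace-Beltrami operator of the unit sphere with the metric induced by the ambient inner
  product, as divergence of the gradient. The tangent space at \<open>p\<close> is the orthogonal complement
  of \<open>p\<close>. Derivatives are taken along the sphere (\<open>at p within sphere 0 1\<close>), so they involve no
  values of the function off the sphere, and they are uniquely determined on tangent vectors.
\<close>

definition sphere_grad :: "('a::euclidean_space \<Rightarrow> real) \<Rightarrow> 'a \<Rightarrow> 'a"
  where "sphere_grad f p =
    (THE g. g \<bullet> p = 0 \<and> (f has_derivative (\<lambda>h. g \<bullet> h)) (at p within sphere 0 1))"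

definition tangent_proj :: "'a::euclidean_space \<Rightarrow> 'a \<Rightarrow> 'a"
  where "tangent_proj p h = h - (h \<bullet> p) *\<^sub>R p"

text \<open>
  The Levi-Civita connection of the sphere is the tangential part of the ambient derivative, and
  the divergence of a tangent field \<open>X\<close> is the trace over the tangent space of \<open>h \<mapsto> \<nabla>\<^sub>h X\<close>. With
  \<open>P\<close> the tangential projection at \<open>p\<close>, this is the trace of \<open>P \<circ> DX \<circ> P\<close> on the ambient
  space, computed below in the standard basis; \<open>P\<close> is self-adjoint.
\<close>

definition sphere_div :: "('a::euclidean_space \<Rightarrow> 'a) \<Rightarrow> 'a \<Rightarrow> real"
  where "sphere_div X p =
    (\<Sum>b\<in>Basis. frechet_derivative X (at p within sphere 0 1) (tangent_proj p b) \<bullet> tangent_proj p b)"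

definition sphere_laplacian :: "('a::euclidean_space \<Rightarrow> real) \<Rightarrow> 'a \<Rightarrow> real"
  where "sphere_laplacian f p = sphere_div (sphere_grad f) p"

definition conformal_laplacian ::
    "((real ^ 'n::finite) \<times> real \<Rightarrow> real) \<Rightarrow> (real ^ 'n) \<times> real \<Rightarrow> real"
  where "conformal_laplacian f \<theta> =
    sphere_laplacian f \<theta> - real CARD('n) * (real CARD('n) - 2) / 4 * f \<theta>"

end

theory Submission
  imports Defs
begin

text \<open>
  The proof moves conformal reflections of the sphere. A point \<open>a\<close> outside the unit sphere is the
  centre of an inversion of power \<open>|a|\<^sup>2 - 1\<close>, which preserves the sphere: it swaps the two
  intersection points of every line through \<open>a\<close>. Its fixed points \<open>x \<bullet> a = 1\<close> bound the cap
  \<open>x \<bullet> a > 1\<close> that faces \<open>a\<close>.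

  The point of the argument is the choice of the apex: it always has height \<open>c\<close>. As \<open>a\<close>, \<open>x\<close> and the
  image of \<open>x\<close> are collinear and the image of a point of the cap is farther from \<open>a\<close>, the reflection
  pushes every point of the cap away from the level \<open>c\<close>, that is, in the direction in which \<open>K\<close>
  increases. By conformal covariance of the equation (\<open>sphere_jet_kelvin\<close>) the Kelvin transform of \<open>v\<close>
  solves the same equation with \<open>K\<close> replaced by its reflection. So whenever the gap between the
  Kelvin transform and \<open>v\<close> is nonnegative on the cap, it is a supersolution there
  (\<open>gap_supersolution\<close>), and it is a strict one off the level \<open>c\<close>.

  Fix a horizontal unit vector \<open>u\<close> and let the apex run along \<open>c e + s u\<close>, where \<open>e\<close> is the north pole,
  from the sphere to infinity. The set of \<open>s\<close> with nonnegative gap is all of the ray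
  (\<open>gap_nonneg_on_ray\<close>), because it is nonempty, closed and open:

  \<^item> Near the sphere the cap is tiny and the Kelvin transform is huge in most of it, as \<open>v\<close> has
    a positive lower bound. Close to the boundary of the cap the inequality follows from the
    monotonicity of \<open>|x - a|\<^sup>m v(x)\<close> along rays from \<open>a\<close> (\<open>gap_nonneg_near_sphere\<close>).

  \<^item> Closedness is continuity (\<open>gap_negative_open\<close>).

  \<^item> Openness (\<open>gap_nonneg_open\<close>) needs strictness at each limit of possible counterexamples. Inside
    the cap the gap is positive: at a zero off the level \<open>c\<close> the strict inequality contradicts the sign
    of the Laplacian at a minimum, and at a zero on the level \<open>c\<close> the gradient vanishes, against the
    Hopf lemma for the half \<open>x \<bullet> e > c\<close> (\<open>gap_pos\<close>). On the boundary of the cap the Hopf lemma gives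
    a strict derivative (\<open>boundary_monotonicity\<close>). At the image of a pole, where the Kelvin transform may be singular, a
    logarithmic barrier shows that points have zero capacity, which bounds the gap from below
    (\<open>isolated_point_lower_bound\<close>, \<open>pole_lower_bound\<close>).

  As \<open>s\<close> tends to infinity the reflections converge to the reflection in the hyperplane orthogonal to
  \<open>u\<close>, so \<open>v\<close> is dominated by its mirror image; the same for \<open>-u\<close> gives equality. Two points of
  equal height are always exchanged by such a hyperplane reflection, hence \<open>v\<close> depends on the height
  only.
\<close>

section \<open>Second-order jets along the unit sphere\<close>

text \<open>
  Near \<open>p\<close> the function \<open>f\<close> is the restriction to the sphere of a function whose gradient is \<open>g\<close>
  and whose second derivative is \<open>H\<close> at \<open>p\<close>. The extension is differentiable in a neighbourhood, but
  its gradient only has to be differentiable at \<open>p\<close>: maximum principles use jets pointwise.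
\<close>

definition sphere_jet :: "('a::euclidean_space \<Rightarrow> real) \<Rightarrow> 'a \<Rightarrow> 'a \<Rightarrow> ('a \<Rightarrow> 'a) \<Rightarrow> bool"
  where "sphere_jet f p g H \<longleftrightarrow>
    (\<exists>U F G. open U \<and> p \<in> U \<and> (\<forall>x\<in>U \<inter> sphere 0 1. F x = f x) \<and>
      (\<forall>x\<in>U. (F has_derivative (\<lambda>h. G x \<bullet> h)) (at x)) \<and>
      (G has_derivative H) (at p) \<and> G p = g)"

text \<open>
  The Laplacian along the sphere of a function with ambient gradient \<open>g\<close> and Hessian \<open>H\<close>: the trace of
  the Hessian without its normal part, corrected by the mean curvature term.
\<close>

definition jet_laplacian :: "'a::euclidean_space \<Rightarrow> 'a \<Rightarrow> ('a \<Rightarrow> 'a) \<Rightarrow> real"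
  where "jet_laplacian p g H =
    (\<Sum>b\<in>Basis. H b \<bullet> b) - H p \<bullet> p - (real DIM('a) - 1) * (g \<bullet> p)"

lemma sphere_jetE:
  assumes "sphere_jet f p g H"
  obtains U F G where "open U" "p \<in> U" "\<And>x. x \<in> U \<Longrightarrow> norm x = 1 \<Longrightarrow> F x = f x"
    "\<And>x. x \<in> U \<Longrightarrow> (F has_derivative (\<lambda>h. G x \<bullet> h)) (at x)" "(G has_derivative H) (at p)" "G p = g"
proof -
  obtain U F G where "open U \<and> p \<in> U \<and> (\<forall>x\<in>U \<inter> sphere 0 1. F x = f x) \<and>
      (\<forall>x\<in>U. (F has_derivative (\<lambda>h. G x \<bullet> h)) (at x)) \<and> (G has_derivative H) (at p) \<and> G p = g"
    using assms unfolding sphere_jet_def by blast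
  then show thesis
    by (intro that[of U F G]) auto
qed

lemma has_derivative_within_sphere_cong:
  assumes "(f has_derivative D) (at p within sphere 0 1)" "open U" "p \<in> U" "norm p = 1"
    and eq: "\<And>x. x \<in> U \<Longrightarrow> norm x = 1 \<Longrightarrow> f x = f' x"
  shows "(f' has_derivative D) (at p within sphere 0 1)"
proof -
  obtain d where "d > 0" "ball p d \<subseteq> U"
    using assms(2,3) open_contains_ball by blast
  then show ?thesis
    using assms(4) eq by (intro has_derivative_transform_within[OF assms(1) \<open>d > 0\<close>]) (auto simp: subset_iff dist_commute)
qed

lemma great_circle_in_sphere:
  fixes p u :: "'a::euclidean_space"
  assumes "norm p = 1" "norm u = 1" "u \<bullet> p = 0"
  shows "cos t *\<^sub>R p + sin t *\<^sub>R u \<in> sphere 0 1"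
proof -
  have "p \<bullet> p = 1" "u \<bullet> u = 1" "p \<bullet> u = 0"
    using assms by (simp_all add: dot_square_norm inner_commute)
  then have "(cos t *\<^sub>R p + sin t *\<^sub>R u) \<bullet> (cos t *\<^sub>R p + sin t *\<^sub>R u) = 1"
    using assms(3) sin_cos_squared_add2[of t]
    by (simp add: inner_add_left inner_add_right power2_eq_square)
  then show ?thesis
    by (simp add: norm_eq_sqrt_inner)
qed

lemma great_circle_chain:
  fixes p u :: "'a::euclidean_space" and f :: "'a \<Rightarrow> 'b::real_normed_vector"
  assumes "norm p = 1" "norm u = 1" "u \<bullet> p = 0" and D: "(f has_derivative D) (at p within sphere 0 1)"
  shows "((\<lambda>t. f (cos t *\<^sub>R p + sin t *\<^sub>R u)) has_derivative (\<lambda>t. D (t *\<^sub>R u))) (at 0)"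
proof -
  define \<gamma> where "\<gamma> t = cos t *\<^sub>R p + sin t *\<^sub>R u" for t :: real
  have \<gamma>': "(\<gamma> has_derivative (\<lambda>t. t *\<^sub>R u)) (at 0)"
    unfolding \<gamma>_def by (auto intro!: derivative_eq_intros)
  have "range \<gamma> \<subseteq> sphere 0 1"
    using great_circle_in_sphere[OF assms(1-3)] by (auto simp: \<gamma>_def)
  moreover have "\<gamma> 0 = p" by (simp add: \<gamma>_def)
  ultimately have "(f has_derivative D) (at (\<gamma> 0) within range \<gamma>)"
    using D has_derivative_subset by metis
  then have "(f \<circ> \<gamma> has_derivative D \<circ> (\<lambda>t. t *\<^sub>R u)) (at 0)"
    using diff_chain_within[OF \<gamma>'] by blast
  then show ?thesis by (simp add: o_def \<gamma>_def)
qed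

text \<open>
  A derivative within the sphere is an arbitrary linear map in the normal direction, so that only its
  values on tangent vectors are determined; great circles recover them.
\<close>

lemma sphere_derivative_unique:
  fixes p :: "'a::euclidean_space" and f :: "'a \<Rightarrow> 'b::real_normed_vector"
  assumes p: "norm p = 1"
    and D1: "(f has_derivative D1) (at p within sphere 0 1)"
    and D2: "(f has_derivative D2) (at p within sphere 0 1)"
    and e: "e \<bullet> p = 0"
  shows "D1 e = D2 e"
proof (cases "e = 0")
  case True
  then show ?thesis
    using D1 D2 by (simp add: has_derivative_def bounded_linear.linear linear_0)
next
  case False
  define u where "u = e /\<^sub>R norm e"
  have u: "norm u = 1" "u \<bullet> p = 0" "e = norm e *\<^sub>R u"
    using False e by (simp_all add: u_def)
  have "(\<lambda>t. D1 (t *\<^sub>R u)) = (\<lambda>t. D2 (t *\<^sub>R u))"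
    using has_derivative_unique[OF great_circle_chain[OF p u(1,2) D1] great_circle_chain[OF p u(1,2) D2]] .
  then have "D1 (norm e *\<^sub>R u) = D2 (norm e *\<^sub>R u)"
    by meson
  then show ?thesis
    using u(3) by simp
qed

lemma sphere_grad_eq:
  fixes p :: "'a::euclidean_space"
  assumes p: "norm p = 1" and D: "(f has_derivative (\<lambda>h. g \<bullet> h)) (at p within sphere 0 1)"
  shows "sphere_grad f p = tangent_proj p g"
proof -
  have pp: "p \<bullet> p = 1" using p by (simp add: dot_square_norm)
  \<comment> \<open>projecting does not change the derivative because \<open>|x|\<^sup>2\<close> is constant on the sphere\<close>
  have N: "((\<lambda>x. (x \<bullet> x - 1) * ((g \<bullet> p) / 2)) has_derivative (\<lambda>h. (g \<bullet> p) * (p \<bullet> h))) (at p within sphere 0 1)"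
    by (auto intro!: derivative_eq_intros simp: inner_commute)
  have "((\<lambda>x. f x - (x \<bullet> x - 1) * ((g \<bullet> p) / 2)) has_derivative (\<lambda>h. g \<bullet> h - (g \<bullet> p) * (p \<bullet> h)))
      (at p within sphere 0 1)"
    by (intro has_derivative_diff D N)
  then have "(f has_derivative (\<lambda>h. g \<bullet> h - (g \<bullet> p) * (p \<bullet> h))) (at p within sphere 0 1)"
    by (rule has_derivative_transform[rotated 2]) (use p in \<open>auto simp: dot_square_norm\<close>)
  then have T: "(f has_derivative (\<lambda>h. tangent_proj p g \<bullet> h)) (at p within sphere 0 1)"
    by (simp add: tangent_proj_def inner_diff_left)
  show ?thesis
    unfolding sphere_grad_def
  proof (rule the_equality)
    show "tangent_proj p g \<bullet> p = 0 \<and> (f has_derivative (\<lambda>h. tangent_proj p g \<bullet> h)) (at p within sphere 0 1)"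
      using T pp by (simp add: tangent_proj_def inner_diff_left)
    fix g' assume g': "g' \<bullet> p = 0 \<and> (f has_derivative (\<lambda>h. g' \<bullet> h)) (at p within sphere 0 1)"
    define d where "d = g' - tangent_proj p g"
    have "d \<bullet> p = 0"
      using g' pp by (simp add: d_def tangent_proj_def inner_diff_left)
    then have "g' \<bullet> d = tangent_proj p g \<bullet> d"
      using sphere_derivative_unique[OF p _ T] g' by blast
    then have "d \<bullet> d = 0"
      by (simp add: d_def inner_diff_left)
    then show "g' = tangent_proj p g"
      by (simp add: d_def)
  qed
qed

lemma sum_Basis_inner_mult: "(\<Sum>b\<in>Basis. (x \<bullet> b) * (y \<bullet> b)) = (x::'a::euclidean_space) \<bullet> y"
  by (simp add: euclidean_inner[of x y])

lemma sum_Basis_inner_linear: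
  fixes H :: "'a::euclidean_space \<Rightarrow> 'a"
  assumes "linear H"
  shows "(\<Sum>b\<in>Basis. (u \<bullet> b) * (H b \<bullet> w)) = H u \<bullet> w"
proof -
  have "H u = (\<Sum>b\<in>Basis. (u \<bullet> b) *\<^sub>R H b)"
    using assms by (metis (no_types, lifting) euclidean_representation linear_scale linear_sum sum.cong)
  then show ?thesis
    by (simp add: inner_sum_left)
qed

text \<open>
  Both the divergence of the spherical gradient and the sum of the second derivatives along great circles
  have this form, with \<open>k\<close> the normal derivative.
\<close>

lemma tangent_trace:
  fixes H :: "'a::euclidean_space \<Rightarrow> 'a"
  assumes H: "linear H" and p: "p \<bullet> p = 1"
  shows "(\<Sum>b\<in>Basis. (H (tangent_proj p b) - k *\<^sub>R tangent_proj p b) \<bullet> tangent_proj p b)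
    = (\<Sum>b\<in>Basis. H b \<bullet> b) - H p \<bullet> p - (real DIM('a) - 1) * k"
proof -
  have "(H (tangent_proj p b) - k *\<^sub>R tangent_proj p b) \<bullet> tangent_proj p b =
     H b \<bullet> b - (p \<bullet> b) * (H b \<bullet> p) - (p \<bullet> b) * (H p \<bullet> b) + (H p \<bullet> p) * ((p \<bullet> b) * (p \<bullet> b))
     - k * 1 + k * ((p \<bullet> b) * (p \<bullet> b))" if "b \<in> Basis" for b
    using p that
    by (simp add: tangent_proj_def linear_diff[OF H] linear_scale[OF H] inner_diff_left inner_diff_right
        inner_commute[of b p] algebra_simps)
  then have "(\<Sum>b\<in>Basis. (H (tangent_proj p b) - k *\<^sub>R tangent_proj p b) \<bullet> tangent_proj p b) =
     (\<Sum>b\<in>Basis. H b \<bullet> b - (p \<bullet> b) * (H b \<bullet> p) - (p \<bullet> b) * (H p \<bullet> b) + (H p \<bullet> p) * ((p \<bullet> b) * (p \<bullet> b))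
     - k * 1 + k * ((p \<bullet> b) * (p \<bullet> b)))"
    by (intro sum.cong) auto
  also have "\<dots> = (\<Sum>b\<in>Basis. H b \<bullet> b) - H p \<bullet> p - H p \<bullet> p + H p \<bullet> p - k * real DIM('a) + k"
    using sum_Basis_inner_linear[OF H, of p p] sum_Basis_inner_mult[of p "H p"] sum_Basis_inner_mult[of p p] p
    by (simp add: sum.distrib sum_subtractf sum_distrib_left[symmetric] inner_commute)
  finally show ?thesis
    by (simp add: algebra_simps)
qed

lemma sphere_laplacian_eq_jet_laplacian:
  fixes p :: "'a::euclidean_space"
  assumes p: "norm p = 1" and jet: "sphere_jet f p g H"
  shows "sphere_laplacian f p = jet_laplacian p g H"
proof -
  have pp: "p \<bullet> p = 1" using p by (simp add: dot_square_norm)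
  obtain U F G where U: "open U" "p \<in> U" and Ff: "\<And>x. x \<in> U \<Longrightarrow> norm x = 1 \<Longrightarrow> F x = f x"
    and F: "\<And>x. x \<in> U \<Longrightarrow> (F has_derivative (\<lambda>h. G x \<bullet> h)) (at x)"
    and G: "(G has_derivative H) (at p)" "G p = g"
    by (rule sphere_jetE[OF jet]) blast
  have grad: "sphere_grad f x = tangent_proj x (G x)" if "x \<in> U" "norm x = 1" for x
  proof (rule sphere_grad_eq[OF that(2)])
    have "(F has_derivative (\<lambda>h. G x \<bullet> h)) (at x within sphere 0 1)"
      using F[OF that(1)] has_derivative_at_withinI by blast
    then show "(f has_derivative (\<lambda>h. G x \<bullet> h)) (at x within sphere 0 1)"
      by (rule has_derivative_within_sphere_cong[OF _ U(1) that]) (rule Ff)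
  qed
  define D where "D h = H h - (p \<bullet> H h + h \<bullet> g) *\<^sub>R p - (g \<bullet> p) *\<^sub>R h" for h
  have lin: "linear H"
    using G(1) has_derivative_linear by blast
  have "((\<lambda>x. tangent_proj x (G x)) has_derivative D) (at p)"
    unfolding tangent_proj_def D_def
    by (auto intro!: derivative_eq_intros G(1) simp: G(2) inner_commute algebra_simps)
  then have "((\<lambda>x. tangent_proj x (G x)) has_derivative D) (at p within sphere 0 1)"
    using has_derivative_at_withinI by blast
  then have X: "(sphere_grad f has_derivative D) (at p within sphere 0 1)"
    by (rule has_derivative_within_sphere_cong[OF _ U p]) (simp add: grad)
  have "(sphere_grad f has_derivative frechet_derivative (sphere_grad f) (at p within sphere 0 1)) (at p within sphere 0 1)"
    using X by (meson differentiableI frechet_derivative_works)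
  then have fr: "frechet_derivative (sphere_grad f) (at p within sphere 0 1) (tangent_proj p b) = D (tangent_proj p b)" for b
    by (rule sphere_derivative_unique[OF p _ X]) (simp add: tangent_proj_def inner_diff_left pp)
  have "p \<bullet> tangent_proj p b = 0" for b
    by (simp add: tangent_proj_def inner_diff_right pp inner_commute)
  then have "D (tangent_proj p b) \<bullet> tangent_proj p b =
     (H (tangent_proj p b) - (g \<bullet> p) *\<^sub>R tangent_proj p b) \<bullet> tangent_proj p b" for b
    by (simp add: D_def inner_diff_left inner_commute algebra_simps)
  then show ?thesis
    unfolding sphere_laplacian_def sphere_div_def fr
    using tangent_trace[OF lin pp, of "g \<bullet> p"] by (simp add: jet_laplacian_def)
qed

lemma sphere_jet_has_derivative:
  assumes "sphere_jet f p g H" "norm p = 1"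
  shows "(f has_derivative (\<lambda>h. g \<bullet> h)) (at p within sphere 0 1)"
proof -
  obtain U F G where U: "open U" "p \<in> U" and Ff: "\<And>x. x \<in> U \<Longrightarrow> norm x = 1 \<Longrightarrow> F x = f x"
    and F: "\<And>x. x \<in> U \<Longrightarrow> (F has_derivative (\<lambda>h. G x \<bullet> h)) (at x)" and G: "(G has_derivative H) (at p)" "G p = g"
    by (rule sphere_jetE[OF assms(1)]) blast
  have "(F has_derivative (\<lambda>h. g \<bullet> h)) (at p within sphere 0 1)"
    using F[OF U(2)] G has_derivative_at_withinI by blast
  then show ?thesis
    by (rule has_derivative_within_sphere_cong[OF _ U assms(2)]) (rule Ff)
qed

lemma sphere_jet_linear_combination:
  assumes "sphere_jet f p g H" "sphere_jet f' p g' H'"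
  shows "sphere_jet (\<lambda>x. f x + k * f' x) p (g + k *\<^sub>R g') (\<lambda>h. H h + k *\<^sub>R H' h)"
proof -
  obtain U F G where U: "open U" "p \<in> U" and Ff: "\<And>x. x \<in> U \<Longrightarrow> norm x = 1 \<Longrightarrow> F x = f x"
    and F: "\<And>x. x \<in> U \<Longrightarrow> (F has_derivative (\<lambda>h. G x \<bullet> h)) (at x)"
    and G: "(G has_derivative H) (at p)" "G p = g"
    by (rule sphere_jetE[OF assms(1)]) blast
  obtain U' F' G' where U': "open U'" "p \<in> U'" and Ff': "\<And>x. x \<in> U' \<Longrightarrow> norm x = 1 \<Longrightarrow> F' x = f' x"
    and F': "\<And>x. x \<in> U' \<Longrightarrow> (F' has_derivative (\<lambda>h. G' x \<bullet> h)) (at x)"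
    and G': "(G' has_derivative H') (at p)" "G' p = g'"
    by (rule sphere_jetE[OF assms(2)]) blast
  show ?thesis
    unfolding sphere_jet_def
  proof (intro exI conjI ballI)
    show "open (U \<inter> U')" "p \<in> U \<inter> U'" using U U' by auto
    show "F x + k * F' x = f x + k * f' x" if "x \<in> U \<inter> U' \<inter> sphere 0 1" for x
      using that Ff Ff' by auto
    show "((\<lambda>x. F x + k * F' x) has_derivative (\<lambda>h. (G x + k *\<^sub>R G' x) \<bullet> h)) (at x)" if "x \<in> U \<inter> U'" for x
      using that F[of x] F'[of x] by (auto intro!: derivative_eq_intros simp: inner_add_left)
    show "((\<lambda>x. G x + k *\<^sub>R G' x) has_derivative (\<lambda>h. H h + k *\<^sub>R H' h)) (at p)"
      using G G' by (auto intro!: derivative_eq_intros)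
  qed (use G G' in auto)
qed

lemma jet_laplacian_linear_combination:
  "jet_laplacian p (g + k *\<^sub>R g') (\<lambda>h. H h + k *\<^sub>R H' h) = jet_laplacian p g H + k * jet_laplacian p g' H'"
  by (simp add: jet_laplacian_def inner_add_left sum.distrib sum_distrib_left algebra_simps)

text \<open>
  All barriers below are functions of one linear coordinate. The vector \<open>z\<close> need not be a unit vector:
  the Hopf lemma uses \<open>z\<close> close to a point of the sphere to describe small geodesic balls.
\<close>

lemma sphere_jet_zonal:
  fixes z p :: "'a::euclidean_space"
  assumes V: "open V" "p \<bullet> z \<in> V" and \<phi>: "\<And>t. t \<in> V \<Longrightarrow> (\<phi> has_real_derivative \<phi>' t) (at t)"
    and \<phi>': "(\<phi>' has_real_derivative d) (at (p \<bullet> z))"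
  shows "sphere_jet (\<lambda>x. \<phi> (x \<bullet> z)) p (\<phi>' (p \<bullet> z) *\<^sub>R z) (\<lambda>h. (d * (h \<bullet> z)) *\<^sub>R z)"
  unfolding sphere_jet_def
proof (intro exI conjI ballI)
  show "open {x. x \<bullet> z \<in> V}"
    using open_vimage[OF V(1), of "\<lambda>x. x \<bullet> z"] by (simp add: vimage_def continuous_intros)
  show "p \<in> {x. x \<bullet> z \<in> V}" using V by simp
  have in': "((\<lambda>x. x \<bullet> z) has_derivative (\<lambda>h. h \<bullet> z)) (at x)" for x
    by (auto intro!: derivative_eq_intros)
  show "((\<lambda>x. \<phi> (x \<bullet> z)) has_derivative (\<lambda>h. (\<phi>' (x \<bullet> z) *\<^sub>R z) \<bullet> h)) (at x)" if "x \<in> {x. x \<bullet> z \<in> V}" for x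
    using has_derivative_compose[OF in' \<phi>[of "x \<bullet> z", unfolded has_field_derivative_def]] that
    by (simp add: inner_commute)
  have "((\<lambda>x. \<phi>' (x \<bullet> z)) has_derivative (\<lambda>h. d * (h \<bullet> z))) (at p)"
    using has_derivative_compose[OF in' \<phi>'[unfolded has_field_derivative_def]] by simp
  then show "((\<lambda>x. \<phi>' (x \<bullet> z) *\<^sub>R z) has_derivative (\<lambda>h. (d * (h \<bullet> z)) *\<^sub>R z)) (at p)"
    by (auto intro!: derivative_eq_intros)
qed auto

lemma jet_laplacian_zonal:
  fixes z p :: "'a::euclidean_space"
  shows "jet_laplacian p (k *\<^sub>R z) (\<lambda>h. (d * (h \<bullet> z)) *\<^sub>R z) =
    d * (z \<bullet> z - (p \<bullet> z)\<^sup>2) - (real DIM('a) - 1) * k * (p \<bullet> z)"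
proof -
  have "(\<Sum>b\<in>Basis. ((d * (b \<bullet> z)) *\<^sub>R z) \<bullet> b) = d * (\<Sum>b\<in>Basis. (z \<bullet> b) * (z \<bullet> b))"
    by (simp add: sum_distrib_left inner_commute mult.assoc)
  then show ?thesis
    unfolding jet_laplacian_def sum_Basis_inner_mult
    by (simp add: power2_eq_square inner_commute algebra_simps)
qed

text \<open>
  Along each great circle through the minimum point the first derivative vanishes and the second is
  nonnegative. Summing over the tangential projections of the standard basis gives the trace.
\<close>

lemma sphere_jet_min:
  fixes p :: "'a::euclidean_space"
  assumes p: "norm p = 1" and jet: "sphere_jet f p g H"
    and V: "open V" "p \<in> V" and min: "\<And>x. x \<in> V \<Longrightarrow> norm x = 1 \<Longrightarrow> f p \<le> f x"
  shows "e \<bullet> p = 0 \<Longrightarrow> g \<bullet> e = 0" and "jet_laplacian p g H \<ge> 0"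
proof -
  have pp: "p \<bullet> p = 1" using p by (simp add: dot_square_norm)
  obtain U F G where U: "open U" "p \<in> U" and Ff: "\<And>x. x \<in> U \<Longrightarrow> norm x = 1 \<Longrightarrow> F x = f x"
    and F: "\<And>x. x \<in> U \<Longrightarrow> (F has_derivative (\<lambda>h. G x \<bullet> h)) (at x)"
    and G: "(G has_derivative H) (at p)" "G p = g"
    by (rule sphere_jetE[OF jet]) blast
  have lin: "linear H"
    using G(1) has_derivative_linear by blast
  have unit: "g \<bullet> u = 0 \<and> H u \<bullet> u - g \<bullet> p \<ge> 0" if u: "norm u = 1" "u \<bullet> p = 0" for u
  proof -
    define \<gamma> where "\<gamma> t = cos t *\<^sub>R p + sin t *\<^sub>R u" for t :: real
    define \<gamma>' where "\<gamma>' t = - sin t *\<^sub>R p + cos t *\<^sub>R u" for t :: real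
    have \<gamma>0: "\<gamma> 0 = p" "\<gamma>' 0 = u" by (auto simp: \<gamma>_def \<gamma>'_def)
    have d\<gamma>: "(\<gamma> has_derivative (\<lambda>s. s *\<^sub>R \<gamma>' t)) (at t)" for t
      unfolding \<gamma>_def \<gamma>'_def by (auto intro!: derivative_eq_intros simp: algebra_simps)
    have d\<gamma>': "(\<gamma>' has_derivative (\<lambda>s. s *\<^sub>R (- p))) (at 0)"
      unfolding \<gamma>'_def by (auto intro!: derivative_eq_intros)
    have sph: "norm (\<gamma> t) = 1" for t
      using great_circle_in_sphere[OF p u] by (simp add: \<gamma>_def)
    define T where "T = \<gamma> -` (U \<inter> V)"
    have T: "open T" "0 \<in> T"
      using U V \<gamma>0 by (auto simp: T_def \<gamma>_def intro!: open_vimage continuous_intros)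
    define \<psi> where "\<psi> t = F (\<gamma> t)" for t
    define \<psi>' where "\<psi>' t = G (\<gamma> t) \<bullet> \<gamma>' t" for t
    have d\<psi>: "(\<psi> has_real_derivative \<psi>' t) (at t)" if "t \<in> T" for t
    proof -
      have "(\<psi> has_derivative (\<lambda>s. G (\<gamma> t) \<bullet> (s *\<^sub>R \<gamma>' t))) (at t)"
        unfolding \<psi>_def by (rule has_derivative_compose[OF d\<gamma> F]) (use that in \<open>auto simp: T_def\<close>)
      then show ?thesis
        by (simp add: has_field_derivative_def \<psi>'_def mult.commute[of "_ \<bullet> _"] mult_commute_abs)
    qed
    have min\<psi>: "\<psi> 0 \<le> \<psi> t" if "t \<in> T" for t
      using that min[of "\<gamma> t"] Ff[of "\<gamma> t"] Ff[of p] sph U p by (auto simp: \<psi>_def T_def \<gamma>0)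
    obtain \<delta> where \<delta>: "\<delta> > 0" "\<And>t. \<bar>t\<bar> < \<delta> \<Longrightarrow> t \<in> T"
      using T by (auto simp: open_dist dist_real_def)
    have crit: "\<psi>' 0 = 0"
      by (rule DERIV_local_min[OF d\<psi>[OF T(2)] \<delta>(1)]) (use min\<psi> \<delta> in auto)
    have "((\<lambda>t. G (\<gamma> t)) has_derivative (\<lambda>s. H (s *\<^sub>R u))) (at 0)"
      using has_derivative_compose[OF d\<gamma>[of 0], of G H] G \<gamma>0 by simp
    then have "(\<psi>' has_derivative (\<lambda>s. G (\<gamma> 0) \<bullet> (s *\<^sub>R (- p)) + H (s *\<^sub>R u) \<bullet> \<gamma>' 0)) (at 0)"
      unfolding \<psi>'_def by (rule has_derivative_inner[OF _ d\<gamma>'])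
    moreover have "(\<lambda>s. G (\<gamma> 0) \<bullet> (s *\<^sub>R (- p)) + H (s *\<^sub>R u) \<bullet> \<gamma>' 0) = (*) (H u \<bullet> u - g \<bullet> p)"
      by (simp add: fun_eq_iff \<gamma>0 G(2) linear_scale[OF lin] algebra_simps)
    ultimately have d\<psi>': "(\<psi>' has_real_derivative (H u \<bullet> u - g \<bullet> p)) (at 0)"
      by (simp add: has_field_derivative_def)
    have "H u \<bullet> u - g \<bullet> p \<ge> 0"
    proof (rule ccontr)
      assume "\<not> ?thesis"
      then obtain d where d: "d > 0" "\<And>h. 0 < h \<Longrightarrow> h < d \<Longrightarrow> \<psi>' (0 + h) < \<psi>' 0"
        using DERIV_neg_dec_right[OF d\<psi>'] by auto
      define h where "h = min d \<delta> / 2"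
      have h: "0 < h" "h < d" "h < \<delta>" using d(1) \<delta>(1) by (auto simp: h_def)
      have "\<psi> h < \<psi> 0"
      proof (rule DERIV_neg_imp_decreasing_open[OF h(1)])
        fix x assume "0 < x" "x < h"
        then show "\<exists>y. (\<psi> has_real_derivative y) (at x) \<and> y < 0"
          using d\<psi>[OF \<delta>(2), of x] d(2)[of x] crit h by auto
      next
        have "isCont \<psi> t" if "t \<in> {0..h}" for t
          using d\<psi>[OF \<delta>(2), of t] h that by (intro DERIV_isCont) auto
        then show "continuous_on {0..h} \<psi>"
          using continuous_at_imp_continuous_on by blast
      qed
      then show False using min\<psi>[OF \<delta>(2), of h] h by simp
    qed
    then show ?thesis using crit by (simp add: \<psi>'_def \<gamma>0 G(2))
  qed
  have all: "g \<bullet> w = 0 \<and> (H w - (g \<bullet> p) *\<^sub>R w) \<bullet> w \<ge> 0" if w: "w \<bullet> p = 0" for w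
  proof (cases "w = 0")
    case True then show ?thesis by simp
  next
    case False
    define u where "u = w /\<^sub>R norm w"
    have u: "norm u = 1" "u \<bullet> p = 0" "w = norm w *\<^sub>R u"
      using False w by (simp_all add: u_def)
    have "(H w - (g \<bullet> p) *\<^sub>R w) \<bullet> w = (norm w)\<^sup>2 * (H u \<bullet> u - (g \<bullet> p) * (u \<bullet> u))"
      by (subst (1 2 3) u(3)) (simp add: linear_scale[OF lin] power2_eq_square inner_diff_left algebra_simps)
    moreover have "u \<bullet> u = 1" using u by (simp add: dot_square_norm)
    moreover have "g \<bullet> w = norm w * (g \<bullet> u)" by (subst u(3)) simp
    ultimately show ?thesis using unit[OF u(1,2)] by simp
  qed
  show "e \<bullet> p = 0 \<Longrightarrow> g \<bullet> e = 0" using all by blast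
  have "(\<Sum>b\<in>Basis. (H (tangent_proj p b) - (g \<bullet> p) *\<^sub>R tangent_proj p b) \<bullet> tangent_proj p b) \<ge> 0"
  proof (rule sum_nonneg)
    fix b
    have "tangent_proj p b \<bullet> p = 0"
      using pp by (simp add: tangent_proj_def inner_diff_left)
    then show "(H (tangent_proj p b) - (g \<bullet> p) *\<^sub>R tangent_proj p b) \<bullet> tangent_proj p b \<ge> 0"
      using all by blast
  qed
  then show "jet_laplacian p g H \<ge> 0"
    unfolding tangent_trace[OF lin pp] jet_laplacian_def .
qed

section \<open>Conformal reflections of the sphere and the Kelvin transform\<close>

definition conf_factor :: "'a::euclidean_space \<Rightarrow> 'a \<Rightarrow> real"
  where "conf_factor a x = (a \<bullet> a - 1) / ((x - a) \<bullet> (x - a))"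

text \<open>
  For a point \<open>a\<close> outside the unit sphere this is the inversion with centre \<open>a\<close> that preserves the
  sphere, and \<open>conf_factor a x\<close> is the factor by which it scales lengths at \<open>x\<close>.
\<close>

definition sphere_refl :: "'a::euclidean_space \<Rightarrow> 'a \<Rightarrow> 'a"
  where "sphere_refl a x = a + conf_factor a x *\<^sub>R (x - a)"

lemma unit_neq_outside: "norm x = 1 \<Longrightarrow> a \<bullet> a > 1 \<Longrightarrow> x \<noteq> (a::'a::euclidean_space)"
  by (auto simp: dot_square_norm)

lemma conf_factor_mult:
  assumes "norm x = 1" "a \<bullet> a > 1"
  shows "conf_factor a x * ((x - a) \<bullet> (x - a)) = a \<bullet> a - 1" "conf_factor a x > 0"
  using unit_neq_outside[OF assms] assms by (auto simp: conf_factor_def)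

lemma dist_apex:
  assumes "norm x = 1" shows "(x - a) \<bullet> (x - a) = 1 - 2 * (x \<bullet> a) + a \<bullet> (a::'a::euclidean_space)"
proof -
  have "x \<bullet> x = 1" using assms by (simp add: dot_square_norm)
  then show ?thesis
    by (simp add: inner_diff_left inner_diff_right inner_commute)
qed

lemma norm_sphere_refl:
  assumes "norm x = 1" "a \<bullet> a > 1"
  shows "norm (sphere_refl a x) = 1"
proof -
  define l where "l = conf_factor a x"
  have "l * ((x - a) \<bullet> (x - a)) = a \<bullet> a - 1"
    using conf_factor_mult[OF assms] by (simp add: l_def)
  moreover have "sphere_refl a x \<bullet> sphere_refl a x =
      a \<bullet> a + 2 * l * (a \<bullet> x - a \<bullet> a) + l * (l * ((x - a) \<bullet> (x - a)))"
    by (simp add: sphere_refl_def l_def[symmetric] inner_add_left inner_add_right inner_commute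
        inner_diff_left inner_diff_right algebra_simps)
  ultimately have "sphere_refl a x \<bullet> sphere_refl a x = 1"
    using dist_apex[OF assms(1), of a] by (simp add: inner_commute) algebra
  then show ?thesis by (simp add: norm_eq_sqrt_inner)
qed

lemma conf_factor_sphere_refl:
  assumes "norm x = 1" "a \<bullet> a > 1"
  shows "conf_factor a (sphere_refl a x) = 1 / conf_factor a x"
  using conf_factor_mult[OF assms] unit_neq_outside[OF assms] assms
  by (simp add: conf_factor_def[of a "sphere_refl a x"] sphere_refl_def) (simp add: conf_factor_def)

lemma sphere_refl_involution:
  assumes "norm x = 1" "a \<bullet> a > 1"
  shows "sphere_refl a (sphere_refl a x) = x"
  using conf_factor_mult(2)[OF assms] conf_factor_sphere_refl[OF assms]
  by (simp add: sphere_refl_def[of a "sphere_refl a x"]) (simp add: sphere_refl_def)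

lemma conf_factor_gt_1_iff:
  assumes "norm x = 1" "a \<bullet> a > 1"
  shows "conf_factor a x > 1 \<longleftrightarrow> x \<bullet> a > 1" "conf_factor a x = 1 \<longleftrightarrow> x \<bullet> a = 1"
proof -
  have "(x - a) \<bullet> (x - a) > 0" using unit_neq_outside[OF assms] by simp
  then show "conf_factor a x > 1 \<longleftrightarrow> x \<bullet> a > 1" "conf_factor a x = 1 \<longleftrightarrow> x \<bullet> a = 1"
    using dist_apex[OF assms(1), of a]
    unfolding conf_factor_def less_divide_eq_1_pos[OF \<open>(x - a) \<bullet> (x - a) > 0\<close>] by auto
qed

lemma conf_factor_has_derivative:
  fixes a z :: "'a::euclidean_space"
  assumes "z \<noteq> a" "a \<bullet> a > 1"
  shows "(conf_factor a has_derivative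
    (\<lambda>h. - (2 / (a \<bullet> a - 1)) * (conf_factor a z)\<^sup>2 * ((z - a) \<bullet> h))) (at z)"
proof -
  have k: "(z - a) \<bullet> (z - a) \<noteq> 0" using assms by simp
  have "((\<lambda>z. (z - a) \<bullet> (z - a)) has_derivative (\<lambda>h. 2 * ((z - a) \<bullet> h))) (at z)"
    by (auto intro!: derivative_eq_intros simp: inner_commute)
  from has_derivative_mult_right[OF Deriv.has_derivative_inverse[OF k this], of "a \<bullet> a - 1"]
  show ?thesis
    unfolding conf_factor_def[abs_def] divide_inverse
    by (rule has_derivative_eq_rhs) (use assms in \<open>simp add: fun_eq_iff power2_eq_square\<close>)
qed

lemma sphere_refl_has_derivative:
  fixes a z :: "'a::euclidean_space"
  assumes "z \<noteq> a" "a \<bullet> a > 1"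
  shows "(sphere_refl a has_derivative
    (\<lambda>h. conf_factor a z *\<^sub>R h - (2 / (a \<bullet> a - 1) * (conf_factor a z)\<^sup>2 * ((z - a) \<bullet> h)) *\<^sub>R (z - a))) (at z)"
  unfolding sphere_refl_def[abs_def]
  by (auto intro!: derivative_eq_intros conf_factor_has_derivative[OF assms] simp: fun_eq_iff)

text \<open>
  The differential of the inversion is a multiple of a hyperplane reflection, hence of the form \<open>D\<close>.
  These are the traces that occur when a Hessian \<open>B\<close> is pulled back by it.
\<close>

lemma trace_reflected_differential:
  fixes B :: "'a::euclidean_space \<Rightarrow> 'a"
  assumes "linear B" and D: "D = (\<lambda>h. l *\<^sub>R h - (c * (y \<bullet> h)) *\<^sub>R y)"
  shows "(\<Sum>b\<in>Basis. B (D b) \<bullet> b) = l * (\<Sum>b\<in>Basis. B b \<bullet> b) - c * (B y \<bullet> y)"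
    and "(\<Sum>b\<in>Basis. (B (D b) \<bullet> w) * (u \<bullet> b)) = l * (B u \<bullet> w) - c * (y \<bullet> u) * (B y \<bullet> w)"
proof -
  have *: "B (D b) = l *\<^sub>R B b - (c * (y \<bullet> b)) *\<^sub>R B y" for b
    unfolding D by (simp add: linear_diff[OF assms(1)] linear_scale[OF assms(1)])
  have "(\<Sum>b\<in>Basis. B (D b) \<bullet> b) = (\<Sum>b\<in>Basis. l * (B b \<bullet> b) - c * ((y \<bullet> b) * (B y \<bullet> b)))"
    unfolding * by (simp add: inner_diff_left mult.assoc)
  also have "\<dots> = l * (\<Sum>b\<in>Basis. B b \<bullet> b) - c * (B y \<bullet> y)"
    unfolding sum_subtractf sum_distrib_left[symmetric] sum_Basis_inner_mult by (simp add: inner_commute)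
  finally show "(\<Sum>b\<in>Basis. B (D b) \<bullet> b) = l * (\<Sum>b\<in>Basis. B b \<bullet> b) - c * (B y \<bullet> y)" .
  have "(\<Sum>b\<in>Basis. (B (D b) \<bullet> w) * (u \<bullet> b)) =
      (\<Sum>b\<in>Basis. l * ((u \<bullet> b) * (B b \<bullet> w)) - c * (B y \<bullet> w) * ((y \<bullet> b) * (u \<bullet> b)))"
    unfolding * by (intro sum.cong) (simp_all add: inner_diff_left algebra_simps)
  also have "\<dots> = l * (B u \<bullet> w) - c * (B y \<bullet> w) * (y \<bullet> u)"
    unfolding sum_subtractf sum_distrib_left[symmetric] sum_Basis_inner_mult sum_Basis_inner_linear[OF assms(1)] ..
  finally show "(\<Sum>b\<in>Basis. (B (D b) \<bullet> w) * (u \<bullet> b)) = l * (B u \<bullet> w) - c * (y \<bullet> u) * (B y \<bullet> w)"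
    by simp
qed

text \<open>
  Conformal covariance of the conformal Laplacian. Here \<open>n = 2m + 2\<close> is the dimension of the sphere, so
  that \<open>m (m + 1) = n (n - 2) / 4\<close>. The gradient is explicit because the boundary derivative of the gap
  has to be computed from it.
  
  The computation closes because the differential of the inversion at \<open>x\<close> maps the normal \<open>x\<close> to a
  multiple of the normal \<open>x'\<close> at the image: the normal part of the Hessian is then transformed into the
  normal part, and the terms that are linear in the gradient cancel for this exponent of the factor.
\<close>

lemma sphere_jet_kelvin:
  fixes a x \<gamma> :: "'a::euclidean_space" and v :: "'a \<Rightarrow> real" and m :: real
  assumes x: "norm x = 1" and a: "a \<bullet> a > 1" and jet: "sphere_jet v (sphere_refl a x) \<gamma> B"
    and m: "real DIM('a) = 2 * m + 3"
  defines "l \<equiv> conf_factor a x" and "\<kappa> \<equiv> 2 / (a \<bullet> a - 1)" and "y \<equiv> x - a" and "x' \<equiv> sphere_refl a x"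
  obtains H where
    "sphere_jet (\<lambda>z. conf_factor a z powr m * v (sphere_refl a z)) x
      (l powr m *\<^sub>R (l *\<^sub>R \<gamma> - (\<kappa> * l\<^sup>2 * (\<gamma> \<bullet> y)) *\<^sub>R y - (m * \<kappa> * l * v x') *\<^sub>R y)) H"
    "jet_laplacian x (l powr m *\<^sub>R (l *\<^sub>R \<gamma> - (\<kappa> * l\<^sup>2 * (\<gamma> \<bullet> y)) *\<^sub>R y - (m * \<kappa> * l * v x') *\<^sub>R y)) H
      - m * (m + 1) * (l powr m * v x')
     = l powr m * l\<^sup>2 * (jet_laplacian x' \<gamma> B - m * (m + 1) * v x')"
proof -
  obtain U F G where U: "open U" "sphere_refl a x \<in> U" and Fv: "\<And>x. x \<in> U \<Longrightarrow> norm x = 1 \<Longrightarrow> F x = v x"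
    and F: "\<And>x. x \<in> U \<Longrightarrow> (F has_derivative (\<lambda>h. G x \<bullet> h)) (at x)"
    and G: "(G has_derivative B) (at (sphere_refl a x))" "G (sphere_refl a x) = \<gamma>"
    by (rule sphere_jetE[OF jet]) blast
  have lin: "linear B" using G(1) has_derivative_linear by blast
  define W where "W = {z. z \<noteq> a \<and> sphere_refl a z \<in> U}"
  have W: "open W" "x \<in> W"
  proof -
    have "continuous_on (- {a}) (sphere_refl a)"
      by (intro continuous_at_imp_continuous_on ballI has_derivative_continuous[OF sphere_refl_has_derivative[OF _ a]]) auto
    then have "open (- {a} \<inter> sphere_refl a -` U)"
      using U(1) by (intro continuous_open_preimage) auto
    moreover have "W = - {a} \<inter> sphere_refl a -` U" by (auto simp: W_def)
    ultimately show "open W" by simp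
  qed (use U unit_neq_outside[OF x a] in \<open>auto simp: W_def\<close>)
  define D where "D z h = conf_factor a z *\<^sub>R h - (\<kappa> * (conf_factor a z)\<^sup>2 * ((z - a) \<bullet> h)) *\<^sub>R (z - a)" for z h
  have d\<Phi>: "(sphere_refl a has_derivative D z) (at z)" if "z \<in> W" for z
    using sphere_refl_has_derivative[OF _ a, of z] that unfolding D_def \<kappa>_def W_def by simp
  have dl: "(conf_factor a has_derivative (\<lambda>h. - \<kappa> * (conf_factor a z)\<^sup>2 * ((z - a) \<bullet> h))) (at z)" if "z \<in> W" for z
    using conf_factor_has_derivative[OF _ a, of z] that unfolding \<kappa>_def W_def by simp
  have lpos: "conf_factor a z > 0" if "z \<in> W" for z
    using a that by (auto simp: conf_factor_def W_def)
  define \<psi> where "\<psi> z = conf_factor a z powr m" for z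
  have d\<psi>: "(\<psi> has_derivative (\<lambda>h. - (m * \<kappa> * conf_factor a z * \<psi> z * ((z - a) \<bullet> h)))) (at z)" if "z \<in> W" for z
  proof -
    have pw: "conf_factor a z powr (m - 1) * (conf_factor a z)\<^sup>2 = conf_factor a z * \<psi> z"
      using lpos[OF that] by (simp add: \<psi>_def powr_diff power2_eq_square)
    have "((\<lambda>t. t powr m) has_derivative (*) (m * conf_factor a z powr (m - 1))) (at (conf_factor a z))"
      using has_real_derivative_powr[OF lpos[OF that], of m] by (simp add: has_field_derivative_def)
    from has_derivative_compose[OF dl[OF that] this] show ?thesis
      unfolding \<psi>_def[abs_def, symmetric]
      by (rule has_derivative_eq_rhs) (simp add: fun_eq_iff mult.assoc pw[symmetric] mult.left_commute)
  qed
  define F' where "F' z = F (sphere_refl a z)" for z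
  define G' where "G' z = G (sphere_refl a z)" for z
  have dF': "(F' has_derivative (\<lambda>h. G' z \<bullet> D z h)) (at z)" if "z \<in> W" for z
    using has_derivative_compose[OF d\<Phi>[OF that] F] that unfolding F'_def G'_def W_def by simp
  have dG': "(G' has_derivative (\<lambda>h. B (D x h))) (at x)"
    using has_derivative_compose[OF d\<Phi>[OF W(2)] G(1)] unfolding G'_def .
  have dot: "((\<lambda>z. G' z \<bullet> (z - a)) has_derivative (\<lambda>h. B (D x h) \<bullet> y + \<gamma> \<bullet> h)) (at x)"
    by (rule derivative_eq_intros dG' refl)+ (simp add: y_def G'_def G(2) fun_eq_iff)
  let ?l = "conf_factor a"
  define Gr where "Gr z = (\<psi> z * ?l z) *\<^sub>R G' z - (\<kappa> * \<psi> z * (?l z)\<^sup>2 * (G' z \<bullet> (z - a))) *\<^sub>R (z - a)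
     - (m * \<kappa> * \<psi> z * ?l z * F' z) *\<^sub>R (z - a)" for z
  define s where "s = \<gamma> \<bullet> y"
  define \<Psi> where "\<Psi> = \<psi> x"
  define f where "f = F' x"
  \<comment> \<open>the product rule applied to each of the three terms of the gradient\<close>
  define H where "H h = (\<Psi> * l) *\<^sub>R B (D x h) - ((m + 1) * \<kappa> * \<Psi> * l\<^sup>2 * (y \<bullet> h)) *\<^sub>R \<gamma>
     - (\<kappa> * (\<Psi> * l\<^sup>2 * (B (D x h) \<bullet> y + \<gamma> \<bullet> h) - (m + 2) * \<kappa> * \<Psi> * l^3 * (y \<bullet> h) * s)) *\<^sub>R y
     - (\<kappa> * \<Psi> * l\<^sup>2 * s) *\<^sub>R h
     - (m * \<kappa> * (\<Psi> * l * (\<gamma> \<bullet> D x h) - (m + 1) * \<kappa> * \<Psi> * l\<^sup>2 * (y \<bullet> h) * f)) *\<^sub>R y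
     - (m * \<kappa> * \<Psi> * l * f) *\<^sub>R h" for h
  have dGr: "(Gr has_derivative H) (at x)"
    unfolding Gr_def
    by (rule derivative_eq_intros dG' dot dF' dl d\<psi> W refl)+
      (simp add: H_def fun_eq_iff \<Psi>_def f_def s_def l_def y_def G'_def G(2) algebra_simps power2_eq_square power3_eq_cube)
  have Gr_x: "Gr x = l powr m *\<^sub>R (l *\<^sub>R \<gamma> - (\<kappa> * l\<^sup>2 * (\<gamma> \<bullet> y)) *\<^sub>R y - (m * \<kappa> * l * v x') *\<^sub>R y)"
    using Fv[OF U(2)] norm_sphere_refl[OF x a]
    by (simp add: Gr_def \<psi>_def l_def y_def x'_def G'_def F'_def G(2) scaleR_diff_right mult.assoc mult.left_commute)
  have fv: "f = v x'"
    using Fv[OF U(2)] norm_sphere_refl[OF x a] by (simp add: f_def F'_def x'_def)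
  have jetx: "sphere_jet (\<lambda>z. conf_factor a z powr m * v (sphere_refl a z)) x (Gr x) H"
    unfolding sphere_jet_def
  proof (intro exI conjI ballI)
    show "open W" "x \<in> W" by fact+
    show "\<psi> z * F' z = conf_factor a z powr m * v (sphere_refl a z)" if "z \<in> W \<inter> sphere 0 1" for z
      using that Fv[of "sphere_refl a z"] norm_sphere_refl[OF _ a, of z] by (simp add: \<psi>_def F'_def W_def)
    show "((\<lambda>z. \<psi> z * F' z) has_derivative (\<lambda>h. Gr z \<bullet> h)) (at z)" if "z \<in> W" for z
      by (rule has_derivative_eq_rhs[OF has_derivative_mult[OF d\<psi>[OF that] dF'[OF that]]])
        (simp add: fun_eq_iff Gr_def D_def inner_diff_left inner_diff_right algebra_simps power2_eq_square)
    show "(Gr has_derivative H) (at x)" by fact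
  qed simp
  define k where "k = y \<bullet> y"
  have kpos: "k > 0" "\<kappa> > 0" "l > 0"
    using unit_neq_outside[OF x a] a lpos[OF W(2)] by (auto simp: k_def y_def \<kappa>_def l_def)
  \<comment> \<open>with these two relations the identity becomes polynomial in the remaining scalars\<close>
  have rel1: "\<kappa> * l * k = 2"
    using conf_factor_mult(1)[OF x a] a by (simp add: \<kappa>_def l_def k_def y_def field_simps)
  define \<beta> where "\<beta> = y \<bullet> x"
  have rel2: "\<kappa> * l * \<beta> = 1 - l"
  proof -
    have "2 * \<beta> = k - (a \<bullet> a - 1)"
    proof -
      have "x \<bullet> x = 1" using x by (simp add: dot_square_norm)
      then show ?thesis
        unfolding \<beta>_def k_def y_def dist_apex[OF x, of a] by (simp add: inner_diff_left inner_commute[of a x])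
    qed
    then have "2 * (\<kappa> * l * \<beta>) = \<kappa> * l * k - \<kappa> * (a \<bullet> a - 1) * l"
      by (metis (no_types, opaque_lifting) mult.assoc mult.commute mult.left_commute right_diff_distrib)
    moreover have "\<kappa> * (a \<bullet> a - 1) = 2"
      unfolding \<kappa>_def by (subst times_divide_eq_left, subst nonzero_mult_div_cancel_right) (use a in auto)
    ultimately show ?thesis using rel1 by simp
  qed
  have x'_eq: "x' = x - (1 - l) *\<^sub>R y"
    by (simp add: x'_def sphere_refl_def l_def y_def scaleR_diff_left algebra_simps)
  have Dx: "D x = (\<lambda>h. l *\<^sub>R h - (\<kappa> * l\<^sup>2 * (y \<bullet> h)) *\<^sub>R y)"
    by (simp add: fun_eq_iff D_def l_def y_def)
  have Dxx: "D x x = l *\<^sub>R x'"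
  proof -
    have "\<kappa> * l\<^sup>2 * (y \<bullet> x) = l * (1 - l)"
    proof -
      have "\<kappa> * l\<^sup>2 * (y \<bullet> x) = l * (\<kappa> * l * \<beta>)"
        by (simp add: \<beta>_def power2_eq_square mult.assoc mult.left_commute)
      then show ?thesis by (simp add: rel2)
    qed
    then show ?thesis by (simp add: Dx x'_eq scaleR_diff_right)
  qed
  have Dxy: "D x y = - l *\<^sub>R y"
  proof -
    have "\<kappa> * l\<^sup>2 * (y \<bullet> y) = l * 2"
    proof -
      have "\<kappa> * l\<^sup>2 * (y \<bullet> y) = l * (\<kappa> * l * k)"
        by (simp add: k_def power2_eq_square mult.assoc mult.left_commute)
      then show ?thesis by (simp add: rel1)
    qed
    then show ?thesis by (simp add: Dx scaleR_diff_left[symmetric])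
  qed
  define t where "t = (\<Sum>b\<in>Basis. B b \<bullet> b)"
  define byy where "byy = B y \<bullet> y"
  define q1 where "q1 = B x' \<bullet> x"
  define q2 where "q2 = B x' \<bullet> y"
  define gx where "gx = \<gamma> \<bullet> x"
  define N where "N = real DIM('a)"
  have trD: "(\<Sum>b\<in>Basis. (\<gamma> \<bullet> D x b) * (y \<bullet> b)) = - l * s"
  proof -
    have "(\<Sum>b\<in>Basis. (\<gamma> \<bullet> D x b) * (y \<bullet> b)) = (\<Sum>b\<in>Basis. l * ((\<gamma> \<bullet> b) * (y \<bullet> b)) - \<kappa> * l\<^sup>2 * s * ((y \<bullet> b) * (y \<bullet> b)))"
      by (intro sum.cong) (simp_all add: Dx s_def inner_diff_right algebra_simps)
    also have "\<dots> = l * s - \<kappa> * l\<^sup>2 * s * k"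
      unfolding sum_subtractf sum_distrib_left[symmetric] sum_Basis_inner_mult s_def k_def ..
    also have "\<dots> = l * s - l * s * (\<kappa> * l * k)" by (simp add: power2_eq_square)
    finally show ?thesis by (simp add: rel1)
  qed
  have trH: "(\<Sum>b\<in>Basis. H b \<bullet> b) =
      \<Psi> * l * (l * t - \<kappa> * l\<^sup>2 * byy) - (m + 1) * \<kappa> * \<Psi> * l\<^sup>2 * s
     - \<kappa> * \<Psi> * l\<^sup>2 * (- l * byy + s) + \<kappa> * (m + 2) * \<kappa> * \<Psi> * l^3 * s * k
     - \<kappa> * \<Psi> * l\<^sup>2 * s * N - m * \<kappa> * \<Psi> * l * (- l * s) + m * \<kappa> * (m + 1) * \<kappa> * \<Psi> * l\<^sup>2 * f * k
     - m * \<kappa> * \<Psi> * l * f * N"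
  proof -
    have "(\<Sum>b\<in>Basis. (B (D x b) \<bullet> y) * (y \<bullet> b)) = l * (B y \<bullet> y) - \<kappa> * l\<^sup>2 * (y \<bullet> y) * (B y \<bullet> y)"
      by (rule trace_reflected_differential(2)[OF lin Dx])
    also have "\<dots> = B (D x y) \<bullet> y"
      by (simp add: Dx linear_diff[OF lin] linear_scale[OF lin] inner_diff_left mult.assoc)
    also have "\<dots> = - l * byy"
      unfolding Dxy linear_scale[OF lin] by (simp add: byy_def)
    finally have 1: "(\<Sum>b\<in>Basis. (B (D x b) \<bullet> y) * (y \<bullet> b)) = - l * byy" .
    have 2: "(\<Sum>b\<in>Basis. B (D x b) \<bullet> b) = l * t - \<kappa> * l\<^sup>2 * byy"
      unfolding trace_reflected_differential(1)[OF lin Dx] t_def byy_def ..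
    have "H b \<bullet> b = \<Psi> * l * (B (D x b) \<bullet> b) - (m + 1) * \<kappa> * \<Psi> * l\<^sup>2 * ((\<gamma> \<bullet> b) * (y \<bullet> b))
     - \<kappa> * \<Psi> * l\<^sup>2 * ((B (D x b) \<bullet> y) * (y \<bullet> b)) - \<kappa> * \<Psi> * l\<^sup>2 * ((\<gamma> \<bullet> b) * (y \<bullet> b))
     + \<kappa> * (m + 2) * \<kappa> * \<Psi> * l^3 * s * ((y \<bullet> b) * (y \<bullet> b))
     - \<kappa> * \<Psi> * l\<^sup>2 * s * 1 - m * \<kappa> * \<Psi> * l * ((\<gamma> \<bullet> D x b) * (y \<bullet> b)) + m * \<kappa> * (m + 1) * \<kappa> * \<Psi> * l\<^sup>2 * f * ((y \<bullet> b) * (y \<bullet> b))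
     - m * \<kappa> * \<Psi> * l * f * 1" if "b \<in> Basis" for b
      using that unfolding H_def by (simp add: inner_diff_left) (simp add: algebra_simps)
    then have "(\<Sum>b\<in>Basis. H b \<bullet> b) = (\<Sum>b\<in>Basis. \<Psi> * l * (B (D x b) \<bullet> b) - (m + 1) * \<kappa> * \<Psi> * l\<^sup>2 * ((\<gamma> \<bullet> b) * (y \<bullet> b))
     - \<kappa> * \<Psi> * l\<^sup>2 * ((B (D x b) \<bullet> y) * (y \<bullet> b)) - \<kappa> * \<Psi> * l\<^sup>2 * ((\<gamma> \<bullet> b) * (y \<bullet> b))
     + \<kappa> * (m + 2) * \<kappa> * \<Psi> * l^3 * s * ((y \<bullet> b) * (y \<bullet> b))
     - \<kappa> * \<Psi> * l\<^sup>2 * s * 1 - m * \<kappa> * \<Psi> * l * ((\<gamma> \<bullet> D x b) * (y \<bullet> b)) + m * \<kappa> * (m + 1) * \<kappa> * \<Psi> * l\<^sup>2 * f * ((y \<bullet> b) * (y \<bullet> b))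
     - m * \<kappa> * \<Psi> * l * f * 1)"
      by (intro sum.cong) auto
    also have "\<dots> = \<Psi> * l * (l * t - \<kappa> * l\<^sup>2 * byy) - (m + 1) * \<kappa> * \<Psi> * l\<^sup>2 * s
     - \<kappa> * \<Psi> * l\<^sup>2 * (- l * byy) - \<kappa> * \<Psi> * l\<^sup>2 * s + \<kappa> * (m + 2) * \<kappa> * \<Psi> * l^3 * s * k
     - \<kappa> * \<Psi> * l\<^sup>2 * s * N - m * \<kappa> * \<Psi> * l * (- l * s) + m * \<kappa> * (m + 1) * \<kappa> * \<Psi> * l\<^sup>2 * f * k
     - m * \<kappa> * \<Psi> * l * f * N"
      unfolding sum_subtractf sum.distrib sum_distrib_left[symmetric] 1 2 trD sum_Basis_inner_mult
      by (simp add: s_def k_def N_def)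
    finally show ?thesis by (simp add: algebra_simps)
  qed
  have BD: "B (D x x) = l *\<^sub>R B x'" unfolding Dxx linear_scale[OF lin] ..
  have gx': "\<gamma> \<bullet> x' = gx - (1 - l) * s" by (simp add: x'_eq gx_def s_def inner_diff_right)
  have xx: "x \<bullet> x = 1" using x by (simp add: dot_square_norm)
  have Hxx: "H x \<bullet> x = \<Psi> * l\<^sup>2 * q1 - (m + 1) * \<kappa> * \<Psi> * l\<^sup>2 * \<beta> * gx
     - \<kappa> * (\<Psi> * l\<^sup>2 * (l * q2 + gx) - (m + 2) * \<kappa> * \<Psi> * l^3 * \<beta> * s) * \<beta>
     - \<kappa> * \<Psi> * l\<^sup>2 * s
     - m * \<kappa> * (\<Psi> * l * (l * (gx - (1 - l) * s)) - (m + 1) * \<kappa> * \<Psi> * l\<^sup>2 * \<beta> * f) * \<beta>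
     - m * \<kappa> * \<Psi> * l * f"
    unfolding H_def BD inner_diff_left
    by (simp add: Dxx gx' xx q1_def q2_def gx_def[symmetric] \<beta>_def[symmetric] inner_commute[of x \<gamma>] inner_commute[of x y] power2_eq_square mult.assoc)
  have Gx: "Gr x \<bullet> x = \<Psi> * l * gx - \<kappa> * \<Psi> * l\<^sup>2 * s * \<beta> - m * \<kappa> * \<Psi> * l * f * \<beta>"
    by (simp add: Gr_def \<Psi>_def l_def[symmetric] y_def[symmetric] G'_def G(2) f_def s_def gx_def \<beta>_def inner_diff_left)
  have Bxx: "B x' \<bullet> x' = q1 - (1 - l) * q2"
    by (subst (2) x'_eq) (simp add: q1_def q2_def inner_diff_right)
  have "jet_laplacian x (Gr x) H - m * (m + 1) * (\<Psi> * f)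
      = \<Psi> * l\<^sup>2 * (jet_laplacian x' \<gamma> B - m * (m + 1) * f)"
  proof -
    have lb: "\<beta> = (1 - l) / (\<kappa> * l)" "k = 2 / (\<kappa> * l)" "N = 2 * m + 3"
      using rel1 rel2 kpos m by (simp_all add: field_simps N_def)
    show ?thesis
      unfolding jet_laplacian_def trH Hxx Gx Bxx gx' t_def[symmetric] N_def[symmetric] lb
      using kpos by (simp add: field_simps) (algebra | simp add: power2_eq_square power3_eq_cube algebra_simps)
  qed
  moreover have "\<Psi> = l powr m" by (simp add: \<Psi>_def \<psi>_def l_def)
  ultimately show thesis
    using that[of H] jetx unfolding Gr_x fv by blast
qed

section \<open>Comparison, Hopf lemma and isolated singularities on the sphere\<close>

lemma sphere_comparison:
  fixes \<zeta> :: "'a::euclidean_space \<Rightarrow> real"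
  assumes A: "compact A" "A \<subseteq> sphere 0 1" and cont: "continuous_on A \<zeta>"
    and neg: "\<And>x. x \<in> A \<Longrightarrow> \<zeta> x < 0 \<Longrightarrow>
      \<exists>V g H. open V \<and> x \<in> V \<and> V \<inter> sphere 0 1 \<subseteq> A \<and> sphere_jet \<zeta> x g H \<and> jet_laplacian x g H < 0"
    and x: "x \<in> A"
  shows "0 \<le> \<zeta> x"
proof (rule ccontr)
  assume "\<not> 0 \<le> \<zeta> x"
  obtain p where p: "p \<in> A" "\<And>y. y \<in> A \<Longrightarrow> \<zeta> p \<le> \<zeta> y"
    using continuous_attains_inf[OF A(1) _ cont] x by blast
  have "\<zeta> p < 0" using p(2)[OF x] \<open>\<not> 0 \<le> \<zeta> x\<close> by simp
  then obtain V g H where V: "open V" "p \<in> V" "V \<inter> sphere 0 1 \<subseteq> A" and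
    j: "sphere_jet \<zeta> p g H" and L: "jet_laplacian p g H < 0"
    using neg[OF p(1)] by blast
  have "\<zeta> p \<le> \<zeta> y" if "y \<in> V" "norm y = 1" for y
    using that V(3) p(2) by auto
  then show False
    using sphere_jet_min(2)[OF _ j V(1,2)] p(1) A(2) L by force
qed

lemma sphere_jet_continuous:
  assumes "sphere_jet f p g H" "norm p = 1"
  shows "continuous (at p within sphere 0 1) f"
  using has_derivative_continuous[OF sphere_jet_has_derivative[OF assms]] .

lemma norm_diff_unit:
  "norm x = 1 \<Longrightarrow> norm y = 1 \<Longrightarrow> (norm (x - y))\<^sup>2 = 2 * (1 - x \<bullet> (y::'a::euclidean_space))"
  using dot_norm_neg[of x y] by simp

lemma compact_zonal_band: "compact {x::'a::euclidean_space. norm x = 1 \<and> s \<le> x \<bullet> z \<and> x \<bullet> z \<le> t}"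
proof -
  have "closed {x::'a. s \<le> x \<bullet> z \<and> x \<bullet> z \<le> t}"
    by (intro closed_Collect_conj closed_Collect_le continuous_intros)
  then have "compact (sphere 0 1 \<inter> {x::'a. s \<le> x \<bullet> z \<and> x \<bullet> z \<le> t})"
    by (intro compact_Int_closed) auto
  moreover have "sphere 0 1 \<inter> {x::'a. s \<le> x \<bullet> z \<and> x \<bullet> z \<le> t} = {x::'a. norm x = 1 \<and> s \<le> x \<bullet> z \<and> x \<bullet> z \<le> t}"
    by auto
  ultimately show ?thesis by simp
qed

lemma positive_lower_bound_zonal_circle:
  fixes w :: "'a::euclidean_space \<Rightarrow> real"
  assumes "\<And>x. norm x = 1 \<Longrightarrow> x \<bullet> z = t \<Longrightarrow> w x > 0 \<and> continuous (at x within sphere 0 1) w"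
  obtains \<mu> where "0 < \<mu>" "\<mu> \<le> 1" "\<And>x. norm x = 1 \<Longrightarrow> x \<bullet> z = t \<Longrightarrow> \<mu> \<le> w x"
proof (cases "\<exists>x. norm x = 1 \<and> x \<bullet> z = t")
  case False
  then show ?thesis using that[of 1] by auto
next
  case True
  define B where "B = {x::'a. norm x = 1 \<and> t \<le> x \<bullet> z \<and> x \<bullet> z \<le> t}"
  have B: "compact B" "B \<noteq> {}" "\<And>x. x \<in> B \<longleftrightarrow> norm x = 1 \<and> x \<bullet> z = t"
    using compact_zonal_band[of t z t] True by (auto simp: B_def)
  have "continuous_on B w"
    unfolding continuous_on_eq_continuous_within
    using assms B(3) by (auto intro: continuous_within_subset[of _ "sphere 0 1"])
  then obtain p where "p \<in> B" "\<And>y. y \<in> B \<Longrightarrow> w p \<le> w y"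
    using continuous_attains_inf[OF B(1,2)] by blast
  then show ?thesis
    using that[of "min 1 (w p)"] assms B(3) by (auto simp: min_le_iff_disj)
qed

text \<open>
  Hopf lemma for the region \<open>x \<bullet> q > x0 \<bullet> q\<close>. The condition on \<open>q\<close> says that it is not a multiple of
  \<open>x0\<close>, so that the boundary of the region is a genuine hypersurface. The differential inequality is
  only used where \<open>w \<le> 1\<close>, because the barrier is small; this allows nonlinear equations and
  functions that are unbounded elsewhere.
  
  The barrier \<open>exp (\<alpha> (x \<bullet> z))\<close> lives on the geodesic ball \<open>x \<bullet> z > x0 \<bullet> z\<close> with \<open>z\<close> slightly moved
  from \<open>x0\<close> in the direction \<open>q\<close>, which touches the boundary of the region at \<open>x0\<close> only.
\<close>

lemma hopf_boundary_point:
  fixes w :: "'a::euclidean_space \<Rightarrow> real"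
  assumes x0: "norm x0 = 1" and q: "(q \<bullet> x0)\<^sup>2 < q \<bullet> q" and U: "open U" "x0 \<in> U" and C: "C \<ge> 0"
    and pos: "\<And>x. x \<in> U \<Longrightarrow> norm x = 1 \<Longrightarrow> x \<bullet> q > x0 \<bullet> q \<Longrightarrow> w x > 0"
    and jet: "\<And>x. x \<in> U \<Longrightarrow> norm x = 1 \<Longrightarrow> x \<bullet> q > x0 \<bullet> q \<Longrightarrow>
      \<exists>g H. sphere_jet w x g H \<and> (w x \<le> 1 \<longrightarrow> jet_laplacian x g H \<le> C * w x)"
    and w0: "w x0 = 0" and D: "(w has_derivative (\<lambda>h. g \<bullet> h)) (at x0 within sphere 0 1)"
  shows "g \<bullet> (q - (q \<bullet> x0) *\<^sub>R x0) > 0"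
proof -
  have xx: "x0 \<bullet> x0 = 1" using x0 by (simp add: dot_square_norm)
  have "q \<noteq> 0" using q by auto
  then have nq: "norm q > 0" by simp
  obtain r where r: "r > 0" "ball x0 r \<subseteq> U" using U open_contains_ball by blast
  define d where "d = x0 \<bullet> q"
  \<comment> \<open>the first bound makes \<open>x0 \<bullet> z\<close> positive, the second one puts the ball inside \<open>U\<close>\<close>
  define \<kappa> where "\<kappa> = min (1 / (2 * norm q)) (r\<^sup>2 / (8 * norm q))"
  have \<kappa>: "\<kappa> > 0" "\<kappa> * norm q \<le> 1/2" "\<kappa> * norm q \<le> r\<^sup>2 / 8"
    using nq r(1) by (auto simp: \<kappa>_def min_def field_simps)
  define z where "z = x0 + \<kappa> *\<^sub>R q"
  define t0 where "t0 = 1 + \<kappa> * d"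
  have dle: "\<bar>d\<bar> \<le> norm q" using Cauchy_Schwarz_ineq2[of x0 q] x0 by (simp add: d_def)
  have t0z: "x0 \<bullet> z = t0" by (simp add: z_def t0_def d_def xx inner_add_right)
  have t0pos: "t0 > 0"
  proof -
    have "\<kappa> * \<bar>d\<bar> \<le> 1/2" using \<kappa> dle mult_left_mono[OF dle, of \<kappa>] by argo
    moreover have "\<bar>\<kappa> * d\<bar> = \<kappa> * \<bar>d\<bar>" using \<kappa>(1) by (simp add: abs_mult)
    ultimately show ?thesis unfolding t0_def by argo
  qed
  have zz: "z \<bullet> z - t0\<^sup>2 = \<kappa>\<^sup>2 * (q \<bullet> q - (q \<bullet> x0)\<^sup>2)"
    by (simp add: z_def t0_def d_def inner_add_left inner_add_right xx inner_commute[of q x0] power2_eq_square algebra_simps)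
  define \<sigma> where "\<sigma> = (z \<bullet> z - t0\<^sup>2) / 2"
  have \<sigma>: "\<sigma> > 0" unfolding \<sigma>_def zz using q \<kappa>(1) by simp
  define t1 where "t1 = sqrt (z \<bullet> z - \<sigma>)"
  have t1sq: "t1\<^sup>2 = z \<bullet> z - \<sigma>" and t01: "t0 < t1"
  proof -
    have "t0\<^sup>2 < z \<bullet> z - \<sigma>" using \<sigma> unfolding \<sigma>_def by argo
    moreover from this have "0 \<le> z \<bullet> z - \<sigma>"
      using zero_le_power2[of t0] less_imp_le order_trans by blast
    ultimately show "t0 < t1" "t1\<^sup>2 = z \<bullet> z - \<sigma>"
      by (auto simp: t1_def intro: real_less_rsqrt)
  qed
  \<comment> \<open>the small ball touches the region from inside only at the point itself\<close>
  have inside: "x \<in> U \<and> x \<bullet> q > x0 \<bullet> q" if x: "norm x = 1" "x \<bullet> z \<ge> t0" "x \<noteq> x0" for x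
  proof -
    have n: "(norm (x - x0))\<^sup>2 = 2 * (1 - x \<bullet> x0)"
      by (rule norm_diff_unit) (use x(1) x0 in auto)
    have "norm (x - x0) > 0" using x(3) by simp
    then have 1: "1 - x \<bullet> x0 > 0" using n zero_less_power[of "norm (x - x0)" 2] by simp
    have "x \<bullet> x0 + \<kappa> * (x \<bullet> q) \<ge> 1 + \<kappa> * d" using x(2) by (simp add: z_def t0_def inner_add_right)
    then have 2: "1 - x \<bullet> x0 \<le> \<kappa> * (x \<bullet> q - d)" by (simp add: algebra_simps)
    then have "\<kappa> * (x \<bullet> q - d) > 0" using 1 by argo
    then have 3: "x \<bullet> q > d" using \<kappa>(1) by (simp add: zero_less_mult_iff)
    have "\<bar>x \<bullet> q\<bar> \<le> norm q" using Cauchy_Schwarz_ineq2[of x q] x(1) by simp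
    then have "\<kappa> * (x \<bullet> q - d) \<le> \<kappa> * (2 * norm q)" using \<kappa>(1) dle by (intro mult_left_mono) auto
    then have "(norm (x - x0))\<^sup>2 \<le> r\<^sup>2 / 2" using n 2 \<kappa>(3) by simp
    then have "(norm (x - x0))\<^sup>2 < r\<^sup>2" using r(1) by (smt (verit) zero_less_power field_sum_of_halves)
    then have "norm (x - x0) < r" using r(1) by (simp add: power2_less_imp_less)
    then show ?thesis using r(2) 3 by (auto simp: d_def dist_norm norm_minus_commute)
  qed
  define N where "N = real DIM('a)"
  \<comment> \<open>large enough for the second derivative of the exponential to beat the first order term and \<open>C\<close>\<close>
  define \<alpha> where "\<alpha> = ((N - 1) * t1 + C + 1) / \<sigma> + 1"
  have N: "N \<ge> 1" unfolding N_def using DIM_positive[where 'a='a] by linarith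
  have t1pos: "t1 > 0" using t0pos t01 by simp
  have \<alpha>: "\<alpha> \<ge> 1" "\<alpha> * \<sigma> > (N - 1) * t1 + C"
  proof -
    have *: "(N - 1) * t1 \<ge> 0" using N t1pos by simp
    then show "\<alpha> \<ge> 1" using C \<sigma> by (simp add: \<alpha>_def)
    have "\<alpha> * \<sigma> = ((N - 1) * t1 + C + 1) + \<sigma>" unfolding \<alpha>_def by (subst distrib_right) (use \<sigma> in simp)
    then show "\<alpha> * \<sigma> > (N - 1) * t1 + C" using \<sigma> by simp
  qed
  have \<alpha>': "\<alpha>\<^sup>2 * \<sigma> - (N - 1) * \<alpha> * t1 > C"
  proof -
    have "\<alpha> * (\<alpha> * \<sigma> - (N - 1) * t1) \<ge> 1 * (\<alpha> * \<sigma> - (N - 1) * t1)"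
      using \<alpha> C by (intro mult_right_mono) auto
    then show ?thesis using \<alpha>(2) by (simp add: power2_eq_square algebra_simps)
  qed
  have cont: "continuous (at x within sphere 0 1) w" if "norm x = 1" "x \<bullet> z \<ge> t0" for x
  proof (cases "x = x0")
    case True then show ?thesis using has_derivative_continuous[OF D] by simp
  next
    case False
    then show ?thesis using jet[of x] inside[of x] that sphere_jet_continuous by blast
  qed
  have "w x > 0 \<and> continuous (at x within sphere 0 1) w" if "norm x = 1" "x \<bullet> z = t1" for x
    using cont[of x] inside[of x] pos[of x] that t01 t0z by force
  then obtain \<mu> where \<mu>: "0 < \<mu>" "\<mu> \<le> 1" "\<And>x. norm x = 1 \<Longrightarrow> x \<bullet> z = t1 \<Longrightarrow> \<mu> \<le> w x"
    using positive_lower_bound_zonal_circle[of z t1 w] by blast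
  define \<epsilon> where "\<epsilon> = \<mu> / exp (\<alpha> * t1)"
  have \<epsilon>: "\<epsilon> > 0" using \<mu> by (simp add: \<epsilon>_def)
  define \<phi> where "\<phi> t = exp (\<alpha> * t) - exp (\<alpha> * t0)" for t
  have \<phi>le: "\<epsilon> * \<phi> t < \<mu>" if "t \<le> t1" for t
  proof -
    have "exp (\<alpha> * t) \<le> exp (\<alpha> * t1)" using that \<alpha>(1) by simp
    then have "\<phi> t < exp (\<alpha> * t1)" unfolding \<phi>_def by (smt (verit) exp_gt_zero)
    then have "\<epsilon> * \<phi> t < \<epsilon> * exp (\<alpha> * t1)" using \<epsilon> by simp
    then show ?thesis by (simp add: \<epsilon>_def)
  qed
  define A where "A = {x::'a. norm x = 1 \<and> t0 \<le> x \<bullet> z \<and> x \<bullet> z \<le> t1}"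
  have barrier: "0 \<le> w x + (- \<epsilon>) * \<phi> (x \<bullet> z)" if "x \<in> A" for x
  proof (rule sphere_comparison[of A "\<lambda>x. w x + (- \<epsilon>) * \<phi> (x \<bullet> z)", OF _ _ _ _ that])
    show "compact A" unfolding A_def by (rule compact_zonal_band)
    show sub: "A \<subseteq> sphere 0 1" by (auto simp: A_def)
    have "continuous_on A w"
      unfolding continuous_on_eq_continuous_within
      using cont sub by (auto simp: A_def intro: continuous_within_subset[of _ "sphere 0 1"])
    then show "continuous_on A (\<lambda>x. w x + (- \<epsilon>) * \<phi> (x \<bullet> z))"
      unfolding \<phi>_def by (intro continuous_intros)
    fix x assume x: "x \<in> A" and neg: "w x + (- \<epsilon>) * \<phi> (x \<bullet> z) < 0"
    let ?t = "x \<bullet> z"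
    have xA: "norm x = 1" "t0 \<le> ?t" "?t \<le> t1" using x by (auto simp: A_def)
    have ne: "x \<noteq> x0" using neg w0 t0z by (auto simp: \<phi>_def)
    have wpos: "w x > 0" using pos inside[OF xA(1,2) ne] xA(1) by blast
    have "?t \<noteq> t0" using neg wpos by (auto simp: \<phi>_def)
    moreover have "?t \<noteq> t1" using neg \<mu>(3)[OF xA(1)] \<phi>le[of t1] by auto
    ultimately have t: "t0 < ?t" "?t < t1" using xA by auto
    obtain g H where jw: "sphere_jet w x g H" "w x \<le> 1 \<Longrightarrow> jet_laplacian x g H \<le> C * w x"
      using jet inside[OF xA(1,2) ne] xA(1) by blast
    have "w x \<le> 1" using neg \<phi>le[OF xA(3)] \<mu>(2) by simp
    then have Lw: "jet_laplacian x g H \<le> C * (\<epsilon> * exp (\<alpha> * ?t))"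
    proof -
      have "w x \<le> \<epsilon> * exp (\<alpha> * ?t)"
        using neg \<epsilon> by (simp add: \<phi>_def algebra_simps) (smt (verit) exp_gt_zero mult_pos_pos)
      then show ?thesis using jw(2)[OF \<open>w x \<le> 1\<close>] C mult_left_mono by fastforce
    qed
    have jz: "sphere_jet (\<lambda>x. \<phi> (x \<bullet> z)) x ((\<alpha> * exp (\<alpha> * ?t)) *\<^sub>R z) (\<lambda>h. (\<alpha>\<^sup>2 * exp (\<alpha> * ?t) * (h \<bullet> z)) *\<^sub>R z)"
      by (rule sphere_jet_zonal[of UNIV _ _ _ "\<lambda>t. \<alpha> * exp (\<alpha> * t)"])
        (auto simp: \<phi>_def power2_eq_square intro!: derivative_eq_intros)
    have "\<exists>g H. sphere_jet (\<lambda>x. w x + (- \<epsilon>) * \<phi> (x \<bullet> z)) x g H \<and> jet_laplacian x g H < 0"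
    proof (intro exI conjI)
      show "sphere_jet (\<lambda>x. w x + (- \<epsilon>) * \<phi> (x \<bullet> z)) x
        (g + (- \<epsilon>) *\<^sub>R (\<alpha> * exp (\<alpha> * ?t)) *\<^sub>R z) (\<lambda>h. H h + (- \<epsilon>) *\<^sub>R (\<alpha>\<^sup>2 * exp (\<alpha> * ?t) * (h \<bullet> z)) *\<^sub>R z)"
        by (rule sphere_jet_linear_combination[OF jw(1) jz])
      have "?t\<^sup>2 \<le> t1\<^sup>2" using t t0pos by (intro power_mono) auto
      then have "z \<bullet> z - ?t\<^sup>2 \<ge> \<sigma>" using t1sq by simp
      then have "\<alpha>\<^sup>2 * (z \<bullet> z - ?t\<^sup>2) \<ge> \<alpha>\<^sup>2 * \<sigma>" by (intro mult_left_mono) auto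
      moreover have "(N - 1) * \<alpha> * ?t \<le> (N - 1) * \<alpha> * t1" using N \<alpha> t by (intro mult_left_mono) auto
      ultimately have "\<alpha>\<^sup>2 * (z \<bullet> z - ?t\<^sup>2) - (N - 1) * \<alpha> * ?t > C" using \<alpha>' by argo
      then have "\<epsilon> * exp (\<alpha> * ?t) * (\<alpha>\<^sup>2 * (z \<bullet> z - ?t\<^sup>2) - (N - 1) * \<alpha> * ?t) > \<epsilon> * exp (\<alpha> * ?t) * C"
        using \<epsilon> by simp
      then show "jet_laplacian x (g + (- \<epsilon>) *\<^sub>R (\<alpha> * exp (\<alpha> * ?t)) *\<^sub>R z)
          (\<lambda>h. H h + (- \<epsilon>) *\<^sub>R (\<alpha>\<^sup>2 * exp (\<alpha> * ?t) * (h \<bullet> z)) *\<^sub>R z) < 0"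
        using Lw unfolding jet_laplacian_linear_combination jet_laplacian_zonal N_def
        by (simp add: algebra_simps)
    qed
    moreover have "open {x. t0 < x \<bullet> z \<and> x \<bullet> z < t1}"
      by (intro open_Collect_conj open_Collect_less continuous_intros)
    moreover have "{x. t0 < x \<bullet> z \<and> x \<bullet> z < t1} \<inter> sphere 0 1 \<subseteq> A" by (auto simp: A_def)
    ultimately show "\<exists>V g H. open V \<and> x \<in> V \<and> V \<inter> sphere 0 1 \<subseteq> A \<and>
        sphere_jet (\<lambda>x. w x + (- \<epsilon>) * \<phi> (x \<bullet> z)) x g H \<and> jet_laplacian x g H < 0"
      using t by blast
  qed
  define e where "e = q - (q \<bullet> x0) *\<^sub>R x0"
  have ex0: "e \<bullet> x0 = 0" by (simp add: e_def inner_diff_left xx)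
  have eq: "e \<bullet> q = q \<bullet> q - (q \<bullet> x0)\<^sup>2"
    by (simp add: e_def inner_diff_left power2_eq_square inner_commute[of x0 q])
  have "e \<noteq> 0" using eq q by auto
  define u where "u = e /\<^sub>R norm e"
  have u: "norm u = 1" "u \<bullet> x0 = 0" using \<open>e \<noteq> 0\<close> ex0 by (auto simp: u_def)
  have uz: "u \<bullet> z > 0"
    using q eq \<kappa>(1) \<open>e \<noteq> 0\<close> ex0 by (simp add: u_def z_def inner_add_right)
  define \<gamma> where "\<gamma> t = cos t *\<^sub>R x0 + sin t *\<^sub>R u" for t :: real
  have \<gamma>0: "\<gamma> 0 = x0" by (simp add: \<gamma>_def)
  have d1: "((\<lambda>s. w (\<gamma> s)) has_real_derivative (g \<bullet> u)) (at 0)"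
    using great_circle_chain[OF x0 u D] by (simp add: \<gamma>_def has_field_derivative_def mult_commute_abs)
  have d2: "((\<lambda>s. \<gamma> s \<bullet> z) has_real_derivative (u \<bullet> z)) (at 0)"
    unfolding \<gamma>_def inner_add_left by (auto intro!: derivative_eq_intros)
  have d3: "((\<lambda>s. \<phi> (\<gamma> s \<bullet> z)) has_real_derivative (\<alpha> * exp (\<alpha> * t0) * (u \<bullet> z))) (at 0)"
    unfolding \<phi>_def by (rule derivative_eq_intros d2 refl)+ (simp add: \<gamma>0 t0z)
  have d4: "((\<lambda>s. w (\<gamma> s) - \<epsilon> * \<phi> (\<gamma> s \<bullet> z)) has_real_derivative (g \<bullet> u - \<epsilon> * (\<alpha> * exp (\<alpha> * t0) * (u \<bullet> z)))) (at 0)"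
    by (rule derivative_eq_intros d1 d3 refl)+ simp
  have "g \<bullet> u - \<epsilon> * (\<alpha> * exp (\<alpha> * t0) * (u \<bullet> z)) \<ge> 0"
  proof (rule ccontr)
    assume "\<not> ?thesis"
    then obtain \<delta> where \<delta>: "\<delta> > 0" "\<And>h. 0 < h \<Longrightarrow> h < \<delta> \<Longrightarrow>
        w (\<gamma> h) - \<epsilon> * \<phi> (\<gamma> h \<bullet> z) < w (\<gamma> 0) - \<epsilon> * \<phi> (\<gamma> 0 \<bullet> z)"
      using DERIV_neg_dec_right[OF d4] by auto
    obtain \<delta>' where \<delta>': "\<delta>' > 0" "\<And>h. 0 < h \<Longrightarrow> h < \<delta>' \<Longrightarrow> \<gamma> 0 \<bullet> z < \<gamma> h \<bullet> z"
      using DERIV_pos_inc_right[OF d2 uz] by auto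
    have "isCont (\<lambda>s. \<gamma> s \<bullet> z) 0" using d2 DERIV_isCont by blast
    then have "eventually (\<lambda>s. \<gamma> s \<bullet> z < t1) (at 0)"
      using t01 t0z \<gamma>0 by (auto simp: isCont_def intro: order_tendstoD(2))
    then obtain \<delta>'' where \<delta>'': "\<delta>'' > 0" "\<And>h. h \<noteq> 0 \<Longrightarrow> \<bar>h\<bar> < \<delta>'' \<Longrightarrow> \<gamma> h \<bullet> z < t1"
      by (auto simp: eventually_at dist_real_def)
    define h where "h = min \<delta> (min \<delta>' \<delta>'') / 2"
    have h: "0 < h" "h < \<delta>" "h < \<delta>'" "\<bar>h\<bar> < \<delta>''" using \<delta>(1) \<delta>'(1) \<delta>''(1) by (auto simp: h_def)
    have "\<gamma> h \<in> A"
      using \<delta>'(2)[OF h(1,3)] \<delta>''(2)[OF _ h(4)] h(1) great_circle_in_sphere[OF x0 u, of h]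
      by (simp add: A_def \<gamma>0 t0z) (simp add: \<gamma>_def)
    from barrier[OF this] \<delta>(2)[OF h(1,2)] show False
      by (simp add: \<gamma>0 w0 t0z \<phi>_def)
  qed
  moreover have "\<epsilon> * (\<alpha> * exp (\<alpha> * t0) * (u \<bullet> z)) > 0" using \<epsilon> \<alpha>(1) uz by simp
  ultimately have "g \<bullet> u > 0" by argo
  then show ?thesis
    using \<open>e \<noteq> 0\<close> by (simp add: u_def e_def[symmetric] zero_less_mult_iff)
qed

text \<open>
  Points have zero capacity, so a positive supersolution cannot decay towards a puncture. The
  barrier \<open>\<epsilon> (1 + A (1 - t))\<close> with \<open>t = x \<bullet> q\<close> is a strict subsolution near \<open>q\<close>, and for any
  \<open>\<eta> > 0\<close> it may be lowered by \<open>- \<eta> ln (1 - t)\<close>, which tends to infinity at \<open>q\<close> and is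
  superharmonic near \<open>q\<close> as the sphere has dimension at least three. After the comparison, \<open>\<eta>\<close> tends
  to zero.
\<close>

lemma isolated_point_lower_bound:
  fixes w :: "'a::euclidean_space \<Rightarrow> real"
  assumes dim: "DIM('a) \<ge> 4" and q: "norm q = 1" and U: "open U" "q \<in> U" and C: "C \<ge> 0"
    and pos: "\<And>x. x \<in> U \<Longrightarrow> norm x = 1 \<Longrightarrow> x \<noteq> q \<Longrightarrow> w x > 0"
    and jet: "\<And>x. x \<in> U \<Longrightarrow> norm x = 1 \<Longrightarrow> x \<noteq> q \<Longrightarrow>
      \<exists>g H. sphere_jet w x g H \<and> (w x \<le> 1 \<longrightarrow> jet_laplacian x g H \<le> C * w x)"
  shows "\<exists>\<epsilon>>0. \<exists>V. open V \<and> q \<in> V \<and> (\<forall>x\<in>V. norm x = 1 \<longrightarrow> x \<noteq> q \<longrightarrow> \<epsilon> \<le> w x)"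
proof -
  have qq: "q \<bullet> q = 1" using q by (simp add: dot_square_norm)
  obtain r where r: "r > 0" "ball q r \<subseteq> U" using U open_contains_ball by blast
  define A where "A = C + 1"
  \<comment> \<open>the three bounds give superharmonicity of the logarithm, the strict subsolution, and the inclusion in \<open>U\<close>\<close>
  define t1 where "t1 = 1 - min (1/2) (min (1 / (2 * A)) (r\<^sup>2 / 4))"
  have A: "A > C" "A \<ge> 1" using C by (auto simp: A_def)
  have t1: "1/2 \<le> t1" "t1 < 1" "A * (1 - t1) \<le> 1/2" "1 - t1 \<le> r\<^sup>2 / 4"
  proof -
    show "1/2 \<le> t1" "t1 < 1" "1 - t1 \<le> r\<^sup>2 / 4" using r A by (auto simp: t1_def min_def)
    have "1 - t1 \<le> 1 / (2 * A)" by (auto simp: t1_def)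
    then show "A * (1 - t1) \<le> 1/2" using A by (simp add: field_simps)
  qed
  have near: "x \<in> U" "x \<bullet> q \<le> 1" "x \<noteq> q \<Longrightarrow> x \<bullet> q < 1" if x: "norm x = 1" "x \<bullet> q \<ge> t1" for x
  proof -
    have n: "(norm (x - q))\<^sup>2 = 2 * (1 - x \<bullet> q)"
      by (rule norm_diff_unit) (use x(1) q in auto)
    show "x \<bullet> q \<le> 1" using n zero_le_power2[of "norm (x - q)"] by argo
    have "(norm (x - q))\<^sup>2 \<le> r\<^sup>2 / 2" using n x(2) t1(4) by simp
    then have "(norm (x - q))\<^sup>2 < r\<^sup>2" using r(1) by (smt (verit) zero_less_power field_sum_of_halves)
    then have "norm (x - q) < r" using r(1) by (simp add: power2_less_imp_less)
    then show "x \<in> U" using r(2) by (auto simp: dist_norm norm_minus_commute)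
    show "x \<bullet> q < 1" if "x \<noteq> q"
    proof -
      have "norm (x - q) > 0" using that by simp
      then show ?thesis using n zero_less_power[of "norm (x - q)" 2] by simp
    qed
  qed
  have cont: "continuous (at x within sphere 0 1) w" if "norm x = 1" "t1 \<le> x \<bullet> q" "x \<bullet> q < 1" for x
  proof -
    have "x \<noteq> q" using that(3) qq by auto
    then show ?thesis using jet[of x] near(1)[of x] that sphere_jet_continuous by blast
  qed
  have "w x > 0 \<and> continuous (at x within sphere 0 1) w" if "norm x = 1" "x \<bullet> q = t1" for x
    using cont[of x] pos[of x] near[of x] that t1 qq by force
  then obtain \<mu> where \<mu>: "0 < \<mu>" "\<mu> \<le> 1" "\<And>x. norm x = 1 \<Longrightarrow> x \<bullet> q = t1 \<Longrightarrow> \<mu> \<le> w x"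
    using positive_lower_bound_zonal_circle[of q t1 w] by blast
  define \<epsilon> where "\<epsilon> = \<mu> / (1 + A * (1 - t1))"
  have den: "1 + A * (1 - t1) > 0" using A t1 by (simp add: add_pos_nonneg)
  have \<epsilon>: "\<epsilon> > 0" using \<mu> den by (simp add: \<epsilon>_def)
  define h where "h t = \<epsilon> * (1 + A * (1 - t))" for t
  have hle: "h t \<le> \<mu>" if "t \<ge> t1" for t
  proof -
    have "h t \<le> \<epsilon> * (1 + A * (1 - t1))"
      unfolding h_def using that \<epsilon> A by (intro mult_left_mono add_left_mono) auto
    then show ?thesis using den by (simp add: \<epsilon>_def)
  qed
  have key: "0 \<le> w x + (-1) * (h (x \<bullet> q) + \<eta> * ln (1 - x \<bullet> q))"
    if x: "norm x = 1" "t1 \<le> x \<bullet> q" "x \<bullet> q < 1" and \<eta>: "\<eta> > 0" for x \<eta>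
  proof -
    \<comment> \<open>beyond this height the logarithmic term alone compensates the rest of the barrier\<close>
    define t2 where "t2 = 1 - exp (- (\<mu> / \<eta>))"
    define T where "T = max t2 (x \<bullet> q)"
    have T: "T < 1" "t2 \<le> T" "x \<bullet> q \<le> T" using x by (auto simp: T_def t2_def)
    have big: "\<mu> \<le> - \<eta> * ln (1 - t)" if "t2 \<le> t" "t < 1" for t
    proof -
      have "1 - t \<le> exp (- (\<mu> / \<eta>))" using that by (simp add: t2_def)
      then have "ln (1 - t) \<le> - (\<mu> / \<eta>)" using that by (metis diff_gt_0_iff_gt exp_gt_zero ln_exp ln_le_cancel_iff)
      then show ?thesis using \<eta> by (simp add: field_simps)
    qed
    define \<phi> where "\<phi> t = h t + \<eta> * ln (1 - t)" for t
    define B where "B = {x::'a. norm x = 1 \<and> t1 \<le> x \<bullet> q \<and> x \<bullet> q \<le> T}"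
    have "0 \<le> w x + (-1) * \<phi> (x \<bullet> q)"
    proof (rule sphere_comparison[of B "\<lambda>x. w x + (-1) * \<phi> (x \<bullet> q)"])
      show "compact B" unfolding B_def by (rule compact_zonal_band)
      show sub: "B \<subseteq> sphere 0 1" by (auto simp: B_def)
      have "continuous_on B w"
        unfolding continuous_on_eq_continuous_within
        using cont sub T by (auto simp: B_def intro: continuous_within_subset[of _ "sphere 0 1"])
      then show "continuous_on B (\<lambda>x. w x + (-1) * \<phi> (x \<bullet> q))"
        unfolding \<phi>_def h_def using T by (intro continuous_intros) (auto simp: B_def)
      show "x \<in> B" using x T by (simp add: B_def)
      fix x assume "x \<in> B" and neg: "w x + (-1) * \<phi> (x \<bullet> q) < 0"
      let ?t = "x \<bullet> q"
      have xB: "norm x = 1" "t1 \<le> ?t" "?t \<le> T" "?t < 1" using \<open>x \<in> B\<close> T by (auto simp: B_def)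
      have ne: "x \<noteq> q" using xB(4) qq by auto
      have wpos: "w x > 0" using pos near(1)[OF xB(1,2)] xB(1) ne by blast
      have ln: "ln (1 - ?t) < 0" using xB t1 by (intro ln_less_zero) auto
      then have wh: "w x < h ?t" using neg \<eta> mult_pos_neg[OF \<eta> ln] by (simp add: \<phi>_def)
      have "\<not> t2 \<le> ?t"
        using big[of ?t] xB(4) neg wpos hle[OF xB(2)] by (auto simp: \<phi>_def)
      moreover have "?t \<noteq> t1" using wh \<mu>(3)[OF xB(1)] hle[of t1] by auto
      ultimately have t: "t1 < ?t" "?t < T" using xB T by auto
      obtain g H where jw: "sphere_jet w x g H" "w x \<le> 1 \<Longrightarrow> jet_laplacian x g H \<le> C * w x"
        using jet near(1)[OF xB(1,2)] xB(1) ne by blast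
      have "w x \<le> 1" using wh hle[OF xB(2)] \<mu>(2) by simp
      then have Lw: "jet_laplacian x g H \<le> C * h ?t"
        using jw(2) wh C by (meson less_imp_le mult_left_mono order_trans)
      let ?N = "real DIM('a)"
      define k where "k = - \<epsilon> * A - \<eta> / (1 - ?t)"
      define d where "d = - \<eta> / (1 - ?t)\<^sup>2"
      have jz: "sphere_jet (\<lambda>x. \<phi> (x \<bullet> q)) x (k *\<^sub>R q) (\<lambda>h. (d * (h \<bullet> q)) *\<^sub>R q)"
        unfolding k_def
      proof (rule sphere_jet_zonal[of "{..<1}" _ _ _ "\<lambda>t. - \<epsilon> * A - \<eta> / (1 - t)"])
        show "open {..<1::real}" "?t \<in> {..<1}" using xB by auto
        show "(\<phi> has_real_derivative - \<epsilon> * A - \<eta> / (1 - t)) (at t)" if "t \<in> {..<1}" for t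
        proof -
          have "((\<lambda>t. ln (1 - t)) has_real_derivative - (1 / (1 - t))) (at t)"
            using that by (auto intro!: derivative_eq_intros simp: divide_inverse)
          from DERIV_cmult[OF this, of \<eta>]
          have "((\<lambda>t. h t + \<eta> * ln (1 - t)) has_real_derivative - \<epsilon> * A + \<eta> * - (1 / (1 - t))) (at t)"
            unfolding h_def by (intro DERIV_add) (auto intro!: derivative_eq_intros)
          then show ?thesis by (simp add: \<phi>_def[abs_def])
        qed
        show "((\<lambda>t. - \<epsilon> * A - \<eta> / (1 - t)) has_real_derivative d) (at ?t)"
        proof -
          have "((\<lambda>t. inverse (1 - t)) has_real_derivative inverse ((1 - ?t)\<^sup>2)) (at ?t)"
            using xB(4) by (auto intro!: derivative_eq_intros simp: power2_eq_square)
          from DERIV_cmult[OF this, of \<eta>]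
          have "((\<lambda>t. - \<epsilon> * A - \<eta> * inverse (1 - t)) has_real_derivative 0 - \<eta> * inverse ((1 - ?t)\<^sup>2)) (at ?t)"
            by (intro DERIV_diff DERIV_const)
          then show ?thesis by (simp add: d_def divide_inverse)
        qed
      qed
      have Lz: "jet_laplacian x (k *\<^sub>R q) (\<lambda>h. (d * (h \<bullet> q)) *\<^sub>R q) \<ge> 3/2 * (\<epsilon> * A)"
      proof -
        have t: "?t \<ge> 1/2" "1 - ?t > 0" using xB t1 by auto
        define y where "y = \<eta> / (1 - ?t)"
        have "d * (1 - ?t\<^sup>2) = - y * (1 + ?t)"
        proof -
          have "1 - ?t\<^sup>2 = (1 - ?t) * (1 + ?t)" by (simp add: power2_eq_square algebra_simps)
          then show ?thesis using t(2) by (simp add: d_def y_def power2_eq_square)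
        qed
        then have "jet_laplacian x (k *\<^sub>R q) (\<lambda>h. (d * (h \<bullet> q)) *\<^sub>R q)
          = (\<epsilon> * A) * ((?N - 1) * ?t) + y * ((?N - 1) * ?t - (1 + ?t))"
          unfolding jet_laplacian_zonal qq k_def y_def[symmetric] by (simp add: algebra_simps)
        moreover have N: "(?N - 1) * ?t \<ge> 3 * ?t" using dim t by (intro mult_right_mono) auto
        moreover have "(\<epsilon> * A) * ((?N - 1) * ?t) \<ge> (\<epsilon> * A) * (3/2)"
        proof (rule mult_left_mono)
          show "3/2 \<le> (?N - 1) * ?t" using N t(1) by argo
        qed (use \<epsilon> A in auto)
        moreover have "y * ((?N - 1) * ?t - (1 + ?t)) \<ge> 0"
        proof (rule mult_nonneg_nonneg)
          show "0 \<le> (?N - 1) * ?t - (1 + ?t)" using N t(1) by argo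
        qed (use t \<eta> in \<open>auto simp: y_def\<close>)
        ultimately show ?thesis by argo
      qed
      have "C * h ?t < 3/2 * (\<epsilon> * A)"
      proof -
        have "C * (1 - ?t) \<le> A * (1 - t1)" using A C xB by (intro mult_mono) auto
        then have "A * (C * (1 - ?t)) \<le> A * (1/2)" using t1(3) A by (intro mult_left_mono) auto
        then have "C * (1 + A * (1 - ?t)) < 3/2 * A" using A by (simp add: algebra_simps)
        then have "\<epsilon> * (C * (1 + A * (1 - ?t))) < \<epsilon> * (3/2 * A)" using \<epsilon> by (rule mult_strict_left_mono)
        then show ?thesis by (simp add: h_def algebra_simps)
      qed
      then have "\<exists>g H. sphere_jet (\<lambda>x. w x + (-1) * \<phi> (x \<bullet> q)) x g H \<and> jet_laplacian x g H < 0"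
        using sphere_jet_linear_combination[OF jw(1) jz, of "-1"] Lw Lz
          jet_laplacian_linear_combination[of x g "-1" "k *\<^sub>R q" H "\<lambda>h. (d * (h \<bullet> q)) *\<^sub>R q"]
        by (intro exI conjI) (assumption, argo)
      moreover have "open {x. t1 < x \<bullet> q \<and> x \<bullet> q < T}"
        by (intro open_Collect_conj open_Collect_less continuous_intros)
      moreover have "{x. t1 < x \<bullet> q \<and> x \<bullet> q < T} \<inter> sphere 0 1 \<subseteq> B" by (auto simp: B_def)
      ultimately show "\<exists>V g H. open V \<and> x \<in> V \<and> V \<inter> sphere 0 1 \<subseteq> B \<and>
          sphere_jet (\<lambda>x. w x + (-1) * \<phi> (x \<bullet> q)) x g H \<and> jet_laplacian x g H < 0"
        using t by blast
    qed
    then show ?thesis by (simp add: \<phi>_def)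
  qed
  have bound: "\<epsilon> \<le> w x" if x: "norm x = 1" "t1 < x \<bullet> q" "x \<noteq> q" for x
  proof -
    let ?t = "x \<bullet> q"
    have t: "t1 \<le> ?t" "?t < 1" using x near(3)[of x] by auto
    have ln: "ln (1 - ?t) < 0" using t t1 by (intro ln_less_zero) auto
    have "h ?t \<le> w x"
    proof (rule ccontr)
      assume "\<not> h ?t \<le> w x"
      define \<eta> where "\<eta> = (h ?t - w x) / (- 2 * ln (1 - ?t))"
      have \<eta>: "\<eta> > 0" unfolding \<eta>_def using \<open>\<not> h ?t \<le> w x\<close> ln by (intro divide_pos_pos) auto
      have "\<eta> * ln (1 - ?t) = - (h ?t - w x) / 2"
        unfolding \<eta>_def by (subst times_divide_eq_left, subst nonzero_divide_eq_eq) (use ln in \<open>auto simp: algebra_simps\<close>)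
      then show False using key[OF x(1) t \<eta>] \<open>\<not> h ?t \<le> w x\<close> by simp
    qed
    moreover have "\<epsilon> * 1 \<le> h ?t" unfolding h_def using \<epsilon> A t by (intro mult_left_mono) auto
    ultimately show ?thesis by simp
  qed
  have "open {x. t1 < x \<bullet> q}" by (intro open_Collect_less continuous_intros)
  then show ?thesis
    using bound \<epsilon> t1(2) qq by (intro exI[of _ \<epsilon>] conjI exI[of _ "{x. t1 < x \<bullet> q}"]) auto
qed

section \<open>The gap between the Kelvin transform and the solution\<close>

lemma powr_diff_le:
  fixes u V B p :: real
  assumes "0 < u" "u \<le> V" "V \<le> B" "p \<ge> 1"
  shows "V powr p - u powr p \<le> p * B powr (p - 1) * (V - u)"
proof (cases "u = V")
  case False
  then have "u < V" using assms by simp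
  have "\<exists>z>u. z < V \<and> V powr p - u powr p = (V - u) * (p * z powr (p - 1))"
    by (rule MVT2[OF \<open>u < V\<close>]) (use assms in \<open>auto intro!: has_real_derivative_powr\<close>)
  then obtain z where z: "u < z" "z < V" "V powr p - u powr p = (V - u) * (p * z powr (p - 1))" by blast
  have "z powr (p - 1) \<le> B powr (p - 1)" using z assms by (intro powr_mono2) auto
  then have "p * z powr (p - 1) \<le> p * B powr (p - 1)" using assms by (intro mult_left_mono) auto
  then have "(V - u) * (p * z powr (p - 1)) \<le> (V - u) * (p * B powr (p - 1))"
    using assms by (intro mult_left_mono) auto
  then show ?thesis using z(3) by (simp add: mult.commute)
qed simp

text \<open>
  The apex, the point and its image are collinear. In the cap the factor exceeds one, so a point moves
  away from the level of the apex.
\<close>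

lemma sphere_refl_height:
  assumes "a \<bullet> e = c"
  shows "sphere_refl a x \<bullet> e - c = conf_factor a x * (x \<bullet> e - c)"
  using assms by (simp add: sphere_refl_def inner_add_left inner_diff_left)

lemma tendsto_conf_factor:
  fixes a x :: "'a::euclidean_space"
  assumes "(A \<longlongrightarrow> a) F" "(X \<longlongrightarrow> x) F" "x \<noteq> a"
  shows "((\<lambda>k. conf_factor (A k) (X k)) \<longlongrightarrow> conf_factor a x) F"
  unfolding conf_factor_def using assms by (intro tendsto_intros) auto

lemma tendsto_sphere_refl:
  fixes a x :: "'a::euclidean_space"
  assumes "(A \<longlongrightarrow> a) F" "(X \<longlongrightarrow> x) F" "x \<noteq> a"
  shows "((\<lambda>k. sphere_refl (A k) (X k)) \<longlongrightarrow> sphere_refl a x) F"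
  unfolding sphere_refl_def using assms by (intro tendsto_intros tendsto_conf_factor)

lemma continuous_on_sphere_refl: "continuous_on (- {a}) (sphere_refl (a::'a::euclidean_space))"
  unfolding continuous_on_def using tendsto_sphere_refl[OF tendsto_const tendsto_ident_at] by auto

lemma continuous_within_open_nbhd:
  fixes f :: "'a::t2_space \<Rightarrow> real"
  assumes "continuous (at x within S) f" "\<delta> > 0"
  obtains U where "open U" "x \<in> U" "\<And>y. y \<in> U \<Longrightarrow> y \<in> S \<Longrightarrow> \<bar>f y - f x\<bar> < \<delta>"
proof -
  have "(f \<longlongrightarrow> f x) (at x within S)" using assms(1) by (simp add: continuous_within)
  then have "eventually (\<lambda>y. \<bar>f y - f x\<bar> < \<delta>) (at x within S)"
    using tendstoD[OF _ assms(2), of f "f x"] by (simp add: dist_real_def)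
  then obtain U where "open U" "x \<in> U" "\<forall>y\<in>U. y \<noteq> x \<longrightarrow> y \<in> S \<longrightarrow> \<bar>f y - f x\<bar> < \<delta>"
    unfolding eventually_at_topological by blast
  then have "\<bar>f y - f x\<bar> < \<delta>" if "y \<in> U" "y \<in> S" for y
    using that assms(2) by (cases "y = x") auto
  then show thesis using that \<open>open U\<close> \<open>x \<in> U\<close> by blast
qed

text \<open>
  The unit vector \<open>e\<close> is the axis, \<open>x \<bullet> e\<close> is the height of \<open>x\<close>, and the sphere has dimension
  \<open>n = 2m + 2\<close>. Thus \<open>m (m + 1) = n (n - 2) / 4\<close> and the exponent \<open>(m + 2) / m\<close> is
  \<open>(n + 2) / (n - 2)\<close>.
\<close>

locale axial_curvature_equation =
  fixes e :: "'a::euclidean_space" and K v :: "'a \<Rightarrow> real" and c m :: real and P :: "'a set"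
  assumes P_def: "P = sphere 0 1 - {e, - e}"
    and unit_e: "norm e = 1"
    and dim: "real DIM('a) = 2 * m + 3" and dim4: "DIM('a) \<ge> 4"
    and c: "-1 < c" "c < 1"
    and K_cont: "continuous_on P K"
    and K_level: "\<And>x y. x \<in> P \<Longrightarrow> y \<in> P \<Longrightarrow> x \<bullet> e = y \<bullet> e \<Longrightarrow> K x = K y"
    and K_up: "\<And>x y. x \<in> P \<Longrightarrow> y \<in> P \<Longrightarrow> y \<bullet> e < x \<bullet> e \<Longrightarrow> c \<le> y \<bullet> e \<Longrightarrow> K y < K x"
    and K_down: "\<And>x y. x \<in> P \<Longrightarrow> y \<in> P \<Longrightarrow> x \<bullet> e < y \<bullet> e \<Longrightarrow> y \<bullet> e \<le> c \<Longrightarrow> K y < K x"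
    and v_jet: "\<And>x. x \<in> P \<Longrightarrow> \<exists>g H. sphere_jet v x g H"
    and v_eq: "\<And>x g H. x \<in> P \<Longrightarrow> sphere_jet v x g H \<Longrightarrow>
      jet_laplacian x g H - m * (m + 1) * v x = - K x * v x powr ((m + 2) / m)"
    and v_pos: "\<And>x. x \<in> P \<Longrightarrow> v x > 0"
    and v_poles: "\<exists>\<delta>>0. \<exists>V. open V \<and> e \<in> V \<and> - e \<in> V \<and> (\<forall>x\<in>V \<inter> P. \<delta> \<le> v x)"
begin

text \<open>
  The Kelvin transform of \<open>v\<close> with respect to the apex \<open>a\<close>, minus \<open>v\<close>.
\<close>

definition gap :: "'a \<Rightarrow> 'a \<Rightarrow> real"
  where "gap a x = conf_factor a x powr m * v (sphere_refl a x) - v x"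

text \<open>
  The moving-reflection inequality on the cap that faces \<open>a\<close>. The guard leaves out the images of the
  poles, where the Kelvin transform is not defined.
\<close>

definition gap_nonneg :: "'a \<Rightarrow> bool"
  where "gap_nonneg a \<longleftrightarrow> (\<forall>x\<in>P. x \<bullet> a > 1 \<longrightarrow> sphere_refl a x \<in> P \<longrightarrow> 0 \<le> gap a x)"

lemma m_pos: "m > 0" "(m + 2) / m \<ge> 1"
proof -
  show "m > 0" using dim dim4 by linarith
  then show "(m + 2) / m \<ge> 1" by simp
qed

lemma P_norm: "x \<in> P \<Longrightarrow> norm x = 1"
  by (simp add: P_def)

lemma P_open: "open (- {e, - e})" "x \<in> P \<longleftrightarrow> norm x = 1 \<and> x \<in> - {e, - e}"
  by (auto simp: P_def)

lemma ee: "e \<bullet> e = 1"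
  using unit_e by (simp add: dot_square_norm)

lemma height_1_iff: "norm x = 1 \<Longrightarrow> x \<bullet> e = 1 \<longleftrightarrow> x = e"
  using norm_diff_unit[of x e] unit_e ee by auto

lemma height_minus_1_iff: "norm x = 1 \<Longrightarrow> x \<bullet> e = -1 \<longleftrightarrow> x = - e"
  using height_1_iff[of "- x"] by (auto simp: minus_equation_iff)

lemma v_continuous: "x \<in> P \<Longrightarrow> continuous (at x within sphere 0 1) v"
  using v_jet sphere_jet_continuous P_norm by blast

lemma v_continuous_on: "continuous_on P v"
  unfolding continuous_on_eq_continuous_within
proof
  fix x assume "x \<in> P"
  moreover have "P \<subseteq> sphere 0 1" by (auto simp: P_def)
  ultimately show "continuous (at x within P) v"
    using v_continuous continuous_within_subset by blast
qed

lemma v_lower_bound: "\<exists>\<mu>>0. \<forall>x\<in>P. \<mu> \<le> v x"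
proof -
  obtain \<delta> V where V: "\<delta> > 0" "open V" "e \<in> V" "- e \<in> V" "\<And>x. x \<in> V \<Longrightarrow> x \<in> P \<Longrightarrow> \<delta> \<le> v x"
    using v_poles by blast
  define B where "B = sphere 0 1 - V"
  have "compact B" unfolding B_def using V(2) by (intro compact_diff) auto
  have "B \<subseteq> P" using V by (auto simp: B_def P_def)
  then have cont: "continuous_on B v" using v_continuous_on continuous_on_subset by blast
  show ?thesis
  proof (cases "B = {}")
    case True
    then have "x \<in> V" if "x \<in> P" for x using P_norm[OF that] by (auto simp: B_def)
    then show ?thesis using V(1,5) by blast
  next
    case False
    then obtain p where p: "p \<in> B" "\<And>x. x \<in> B \<Longrightarrow> v p \<le> v x"
      using continuous_attains_inf[OF \<open>compact B\<close> _ cont] by blast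
    have "min \<delta> (v p) > 0" using V(1) v_pos p(1) \<open>B \<subseteq> P\<close> by auto
    moreover have "min \<delta> (v p) \<le> v x" if "x \<in> P" for x
      using V(5)[OF _ that] p(2)[of x] P_norm[OF that] by (cases "x \<in> V") (auto simp: B_def min_le_iff_disj)
    ultimately show ?thesis by blast
  qed
qed

lemma cap_point_in_P:
  assumes "norm x = 1" "a \<bullet> e = c" "x \<bullet> a \<ge> 1"
  shows "x \<in> P"
  using assms c by (auto simp: P_def inner_commute)

text \<open>
  The power of the conformal factor that covariance produces in front of \<open>K\<close> is absorbed by the
  critical exponent, so the Kelvin transform solves the equation with the reflected \<open>K\<close>.
\<close>

lemma gap_jet:
  assumes a: "a \<bullet> a > 1" and x: "x \<in> P" "sphere_refl a x \<in> P"
    and jv: "sphere_jet v x g H0" and jv': "sphere_jet v (sphere_refl a x) \<gamma> B"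
  defines "l \<equiv> conf_factor a x" and "\<kappa> \<equiv> 2 / (a \<bullet> a - 1)" and "y \<equiv> x - a" and "x' \<equiv> sphere_refl a x"
  shows "\<exists>H. sphere_jet (gap a) x
      (l powr m *\<^sub>R (l *\<^sub>R \<gamma> - (\<kappa> * l\<^sup>2 * (\<gamma> \<bullet> y)) *\<^sub>R y - (m * \<kappa> * l * v x') *\<^sub>R y) - g) H \<and>
    jet_laplacian x
      (l powr m *\<^sub>R (l *\<^sub>R \<gamma> - (\<kappa> * l\<^sup>2 * (\<gamma> \<bullet> y)) *\<^sub>R y - (m * \<kappa> * l * v x') *\<^sub>R y) - g) H
     = m * (m + 1) * gap a x - (K x' * (l powr m * v x') powr ((m + 2) / m) - K x * v x powr ((m + 2) / m))"
proof -
  let ?p = "(m + 2) / m"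
  let ?G = "l powr m *\<^sub>R (l *\<^sub>R \<gamma> - (\<kappa> * l\<^sup>2 * (\<gamma> \<bullet> y)) *\<^sub>R y - (m * \<kappa> * l * v x') *\<^sub>R y)"
  have nx: "norm x = 1" using x P_norm by blast
  have l: "l > 0" using conf_factor_mult[OF nx a] by (simp add: l_def)
  obtain H where H: "sphere_jet (\<lambda>z. conf_factor a z powr m * v (sphere_refl a z)) x ?G H"
    "jet_laplacian x ?G H - m * (m + 1) * (l powr m * v x')
     = l powr m * l\<^sup>2 * (jet_laplacian x' \<gamma> B - m * (m + 1) * v x')"
    using sphere_jet_kelvin[OF nx a jv' dim] unfolding l_def \<kappa>_def y_def x'_def by blast
  have pw: "l powr m * l\<^sup>2 * v x' powr ?p = (l powr m * v x') powr ?p"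
  proof -
    have "m * ?p = m + 2" using m_pos by simp
    then have "(l powr m) powr ?p = l powr m * l\<^sup>2"
      using l by (simp add: powr_powr powr_add)
    moreover have "(l powr m * v x') powr ?p = (l powr m) powr ?p * v x' powr ?p"
      by (rule powr_mult)
    ultimately show ?thesis by simp
  qed
  have J: "sphere_jet (gap a) x (?G - g) (\<lambda>h. H h + (-1) *\<^sub>R H0 h)"
    using sphere_jet_linear_combination[OF H(1) jv, of "-1"] unfolding gap_def[abs_def] by simp
  have "jet_laplacian x' \<gamma> B - m * (m + 1) * v x' = - K x' * v x' powr ?p"
    using v_eq[OF x(2) jv'] by (simp add: x'_def)
  then have "jet_laplacian x ?G H - m * (m + 1) * (l powr m * v x') = - K x' * (l powr m * v x') powr ?p"
    unfolding H(2) by (simp add: pw[symmetric])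
  moreover have "jet_laplacian x g H0 - m * (m + 1) * v x = - K x * v x powr ?p"
    using v_eq[OF x(1) jv] .
  moreover have "jet_laplacian x (?G - g) (\<lambda>h. H h + (-1) *\<^sub>R H0 h) = jet_laplacian x ?G H - jet_laplacian x g H0"
    using jet_laplacian_linear_combination[of x ?G "-1" g H H0] by simp
  ultimately have "jet_laplacian x (?G - g) (\<lambda>h. H h + (-1) *\<^sub>R H0 h)
      = m * (m + 1) * gap a x - (K x' * (l powr m * v x') powr ?p - K x * v x powr ?p)"
    by (simp add: gap_def l_def[symmetric] x'_def[symmetric] algebra_simps)
  then show ?thesis using J by blast
qed

lemma K_sphere_refl:
  assumes a: "a \<bullet> a > 1" "a \<bullet> e = c" and x: "x \<in> P" "sphere_refl a x \<in> P" "x \<bullet> a > 1"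
  shows "K x \<le> K (sphere_refl a x)" "x \<bullet> e \<noteq> c \<Longrightarrow> K x < K (sphere_refl a x)"
proof -
  have l: "conf_factor a x > 1" using conf_factor_gt_1_iff[OF P_norm[OF x(1)] a(1)] x(3) by simp
  note h = sphere_refl_height[OF a(2), of x]
  show strict: "K x < K (sphere_refl a x)" if "x \<bullet> e \<noteq> c"
  proof (cases "x \<bullet> e > c")
    case True
    then have "1 * (x \<bullet> e - c) < conf_factor a x * (x \<bullet> e - c)"
      using l by (intro mult_strict_right_mono) auto
    then have "x \<bullet> e - c < sphere_refl a x \<bullet> e - c" using h by simp
    then show ?thesis using True by (intro K_up x) auto
  next
    case False
    then have "conf_factor a x * (x \<bullet> e - c) < 1 * (x \<bullet> e - c)"
      using l that by (intro mult_strict_right_mono_neg) auto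
    then have "sphere_refl a x \<bullet> e - c < x \<bullet> e - c" using h by simp
    then show ?thesis using False by (intro K_down x) auto
  qed
  show "K x \<le> K (sphere_refl a x)"
  proof (cases "x \<bullet> e = c")
    case True
    then have "sphere_refl a x \<bullet> e = c" using h by simp
    then show ?thesis using K_level[OF x(1,2)] True by simp
  qed (use strict in simp)
qed

text \<open>
  Since the reflection increases \<open>K\<close> and the gap is nonnegative, replacing the reflected \<open>K\<close> by \<open>K\<close>
  only helps; the difference of the powers is then linear in the gap as long as the gap is bounded. The
  constant is uniform near \<open>x0\<close>, also when \<open>x0\<close> is the image of a pole, where the Kelvin transform
  may be unbounded.
\<close>

lemma gap_supersolution:
  assumes a: "a \<bullet> a > 1" "a \<bullet> e = c" "gap_nonneg a" and x0: "x0 \<in> P"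
  shows "\<exists>C\<ge>0. \<exists>U. open U \<and> x0 \<in> U \<and> U \<subseteq> - {e, - e} \<and>
    (\<forall>x\<in>U. norm x = 1 \<longrightarrow> x \<bullet> a > 1 \<longrightarrow> sphere_refl a x \<in> P \<longrightarrow>
      (\<exists>g H. sphere_jet (gap a) x g H \<and> (gap a x \<le> 1 \<longrightarrow> jet_laplacian x g H \<le> C * gap a x)))"
proof -
  let ?p = "(m + 2) / m"
  obtain U1 where U1: "open U1" "x0 \<in> U1" "\<And>y. y \<in> U1 \<Longrightarrow> y \<in> P \<Longrightarrow> \<bar>v y - v x0\<bar> < 1"
    using continuous_within_open_nbhd[of x0 P v 1] v_continuous_on x0
    unfolding continuous_on_eq_continuous_within by auto
  obtain U2 where U2: "open U2" "x0 \<in> U2" "\<And>y. y \<in> U2 \<Longrightarrow> y \<in> P \<Longrightarrow> \<bar>K y - K x0\<bar> < 1"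
    using continuous_within_open_nbhd[of x0 P K 1] K_cont x0
    unfolding continuous_on_eq_continuous_within by auto
  define B where "B = v x0 + 2"
  define k where "k = \<bar>K x0\<bar> + 1"
  define C where "C = m * (m + 1) + k * (?p * B powr (?p - 1))"
  have k: "k \<ge> 0" by (simp add: k_def)
  have "C \<ge> 0" using m_pos k by (simp add: C_def)
  define U where "U = U1 \<inter> U2 \<inter> - {e, - e}"
  have "\<exists>g H. sphere_jet (gap a) x g H \<and> (gap a x \<le> 1 \<longrightarrow> jet_laplacian x g H \<le> C * gap a x)"
    if x: "x \<in> U" "norm x = 1" "x \<bullet> a > 1" "sphere_refl a x \<in> P" for x
  proof -
    have xP: "x \<in> P" using x by (simp add: P_open(2) U_def)
    let ?x' = "sphere_refl a x"
    define W where "W = conf_factor a x powr m * v ?x'"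
    obtain g H where gH: "sphere_jet (gap a) x g H"
      "jet_laplacian x g H = m * (m + 1) * gap a x - (K ?x' * W powr ?p - K x * v x powr ?p)"
      using gap_jet[OF a(1) xP x(4)] v_jet[OF xP] v_jet[OF x(4)] unfolding W_def by meson
    have gW: "gap a x = W - v x" by (simp add: gap_def W_def)
    have gap0: "0 \<le> gap a x" using a(3) xP x unfolding gap_nonneg_def by blast
    have "jet_laplacian x g H \<le> C * gap a x" if "gap a x \<le> 1"
    proof -
      have vx: "v x \<le> v x0 + 1" "\<bar>K x\<bar> \<le> k" "v x > 0"
        using U1(3)[of x] U2(3)[of x] x(1) xP v_pos by (auto simp: U_def k_def)
      have d: "W powr ?p - v x powr ?p \<le> ?p * B powr (?p - 1) * gap a x"
        unfolding gW using vx gap0 that m_pos by (intro powr_diff_le) (auto simp: gW B_def)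
      have d0: "W powr ?p - v x powr ?p \<ge> 0"
        using vx(3) gap0 m_pos by (simp add: gW powr_mono2)
      have "K x * W powr ?p \<le> K ?x' * W powr ?p"
        using K_sphere_refl(1)[OF a(1,2) xP x(4,3)] by (intro mult_right_mono) auto
      then have "- (K ?x' * W powr ?p - K x * v x powr ?p) \<le> (- K x) * (W powr ?p - v x powr ?p)"
        by (simp add: algebra_simps)
      also have "\<dots> \<le> k * (W powr ?p - v x powr ?p)"
        using vx(2) d0 by (intro mult_right_mono) auto
      also have "\<dots> \<le> k * (?p * B powr (?p - 1) * gap a x)"
        using d k by (rule mult_left_mono)
      finally show ?thesis unfolding gH(2) C_def by (simp add: algebra_simps)
    qed
    then show ?thesis using gH(1) by blast
  qed
  moreover have "open U" "x0 \<in> U" "U \<subseteq> - {e, - e}"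
    using U1 U2 x0 by (auto simp: U_def P_open)
  ultimately show ?thesis using \<open>C \<ge> 0\<close> by blast
qed

lemma open_refl_preimage: "open {x. x \<noteq> a \<and> sphere_refl a x \<in> - {e, - e}}"
proof -
  have "open (- {a} \<inter> sphere_refl a -` (- {e, - e}))"
    using continuous_on_sphere_refl P_open(1) by (intro continuous_open_preimage) auto
  moreover have "{x. x \<noteq> a \<and> sphere_refl a x \<in> - {e, - e}} = - {a} \<inter> sphere_refl a -` (- {e, - e})"
    by auto
  ultimately show ?thesis by simp
qed

lemma refl_nbhd:
  assumes a: "a \<bullet> a > 1" and x0: "x0 \<in> P" "sphere_refl a x0 \<in> P"
  obtains W where "open W" "x0 \<in> W" "\<And>x. x \<in> W \<Longrightarrow> norm x = 1 \<Longrightarrow> x \<in> P \<and> sphere_refl a x \<in> P"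
proof
  let ?W = "{x. x \<noteq> a \<and> sphere_refl a x \<in> - {e, - e}} \<inter> - {e, - e}"
  show "open ?W" using open_refl_preimage P_open(1) by (intro open_Int)
  show "x0 \<in> ?W" using x0 unit_neq_outside[OF P_norm[OF x0(1)] a] by (auto simp: P_open(2))
  show "x \<in> P \<and> sphere_refl a x \<in> P" if "x \<in> ?W" "norm x = 1" for x
    using that norm_sphere_refl[OF that(2) a] by (auto simp: P_open(2))
qed

text \<open>
  At an interior zero the gap has a minimum. Off the level \<open>c\<close> the strict increase of \<open>K\<close> makes
  its Laplacian negative there, which is impossible. So zeros lie on the level \<open>c\<close>, the gap is positive
  on the side \<open>x \<bullet> e > c\<close>, and the Hopf lemma for that side contradicts the vanishing gradient.
\<close>

lemma gap_pos:
  assumes a: "a \<bullet> a > 1" "a \<bullet> e = c" "gap_nonneg a"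
    and x0: "x0 \<in> P" "sphere_refl a x0 \<in> P" "x0 \<bullet> a > 1"
  shows "gap a x0 > 0"
proof (rule ccontr)
  assume "\<not> gap a x0 > 0"
  have zero: "gap a x = 0 \<Longrightarrow> x \<bullet> e = c" and crit: "gap a x = 0 \<Longrightarrow> sphere_jet (gap a) x g H \<Longrightarrow> w \<bullet> x = 0 \<Longrightarrow> g \<bullet> w = 0"
    if x: "x \<in> P" "sphere_refl a x \<in> P" "x \<bullet> a > 1" for x g H w
  proof -
    obtain W where W: "open W" "x \<in> W" "\<And>y. y \<in> W \<Longrightarrow> norm y = 1 \<Longrightarrow> y \<in> P \<and> sphere_refl a y \<in> P"
      using refl_nbhd[OF a(1) x(1,2)] by blast
    define V where "V = W \<inter> {y. 1 < y \<bullet> a}"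
    have V: "open V" "x \<in> V"
      unfolding V_def using W x by (auto intro!: open_Int open_Collect_less continuous_intros)
    have min: "gap a x \<le> gap a y" if "gap a x = 0" "y \<in> V" "norm y = 1" for y
      using that W(3)[of y] a(3) unfolding gap_nonneg_def V_def by auto
    have nx: "norm x = 1" using P_norm x by blast
    show "g \<bullet> w = 0" if "gap a x = 0" "sphere_jet (gap a) x g H" "w \<bullet> x = 0"
      using sphere_jet_min(1)[OF nx that(2) V min[OF that(1)] that(3)] by blast
    show "x \<bullet> e = c" if g0: "gap a x = 0"
    proof (rule ccontr)
      assume "x \<bullet> e \<noteq> c"
      let ?p = "(m + 2) / m"
      obtain g H where gH: "sphere_jet (gap a) x g H"
        "jet_laplacian x g H = m * (m + 1) * gap a x -
          (K (sphere_refl a x) * (conf_factor a x powr m * v (sphere_refl a x)) powr ?p - K x * v x powr ?p)"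
        using gap_jet[OF a(1) x(1,2)] v_jet[OF x(1)] v_jet[OF x(2)] by meson
      have "conf_factor a x powr m * v (sphere_refl a x) = v x" using g0 by (simp add: gap_def)
      then have "jet_laplacian x g H = - ((K (sphere_refl a x) - K x) * v x powr ?p)"
        using gH(2) g0 by (simp add: algebra_simps)
      moreover have "(K (sphere_refl a x) - K x) * v x powr ?p > 0"
        using K_sphere_refl(2)[OF a(1,2) x \<open>x \<bullet> e \<noteq> c\<close>] v_pos[OF x(1)] by simp
      ultimately show False
        using sphere_jet_min(2)[OF nx gH(1) V min[OF g0]] by simp
    qed
  qed
  have "gap a x0 = 0" using \<open>\<not> gap a x0 > 0\<close> a(3) x0 unfolding gap_nonneg_def by force
  then have h0: "x0 \<bullet> e = c" using zero[OF x0] by simp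
  have nx0: "norm x0 = 1" using P_norm x0 by blast
  obtain C U where C: "C \<ge> 0" and U: "open U" "x0 \<in> U" and ineq: "\<And>x. x \<in> U \<Longrightarrow> norm x = 1 \<Longrightarrow> x \<bullet> a > 1 \<Longrightarrow>
      sphere_refl a x \<in> P \<Longrightarrow> \<exists>g H. sphere_jet (gap a) x g H \<and> (gap a x \<le> 1 \<longrightarrow> jet_laplacian x g H \<le> C * gap a x)"
    using gap_supersolution[OF a x0(1)] by metis
  obtain W where W: "open W" "x0 \<in> W" "\<And>y. y \<in> W \<Longrightarrow> norm y = 1 \<Longrightarrow> y \<in> P \<and> sphere_refl a y \<in> P"
    using refl_nbhd[OF a(1) x0(1,2)] by blast
  define V where "V = U \<inter> W \<inter> {y. 1 < y \<bullet> a}"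
  have V: "open V" "x0 \<in> V"
    unfolding V_def using U W x0 by (auto intro!: open_Int open_Collect_less continuous_intros)
  obtain g H where gH: "sphere_jet (gap a) x0 g H" using ineq[OF U(2) nx0 x0(3,2)] by blast
  have "g \<bullet> (e - (e \<bullet> x0) *\<^sub>R x0) > 0"
  proof (rule hopf_boundary_point[OF nx0 _ V C])
    have "c\<^sup>2 < 1" using c by (simp add: abs_square_less_1)
    then show "(e \<bullet> x0)\<^sup>2 < e \<bullet> e" using h0 ee by (simp add: inner_commute)
    show "gap a x > 0" if "x \<in> V" "norm x = 1" "x \<bullet> e > x0 \<bullet> e" for x
    proof -
      have x: "x \<in> P" "sphere_refl a x \<in> P" "x \<bullet> a > 1" using that W(3) by (auto simp: V_def)
      then have "gap a x \<noteq> 0" using zero[OF x] that(3) h0 by auto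
      moreover have "gap a x \<ge> 0" using a(3) x unfolding gap_nonneg_def by blast
      ultimately show ?thesis by simp
    qed
    show "\<exists>g H. sphere_jet (gap a) x g H \<and> (gap a x \<le> 1 \<longrightarrow> jet_laplacian x g H \<le> C * gap a x)"
      if "x \<in> V" "norm x = 1" for x
      using that ineq[of x] W(3)[of x] by (auto simp: V_def)
    show "gap a x0 = 0" by fact
    show "(gap a has_derivative (\<lambda>h. g \<bullet> h)) (at x0 within sphere 0 1)"
      by (rule sphere_jet_has_derivative[OF gH nx0])
  qed
  moreover have "(e - (e \<bullet> x0) *\<^sub>R x0) \<bullet> x0 = 0"
    using nx0 by (simp add: inner_diff_left dot_square_norm)
  ultimately show False using crit[OF x0 \<open>gap a x0 = 0\<close> gH] by auto
qed

text \<open>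
  The gap vanishes on the boundary of the cap, and its inner derivative there, positive by the Hopf
  lemma, is twice the expression below. Up to a positive factor this expression is the derivative of
  \<open>|x - a|\<^sup>m v(x)\<close> at \<open>x0\<close> along the ray from \<open>a\<close>.
\<close>

lemma boundary_monotonicity:
  assumes a: "a \<bullet> a > 1" "a \<bullet> e = c" "gap_nonneg a"
    and x0: "norm x0 = 1" "x0 \<bullet> a = 1" and j: "sphere_jet v x0 g H"
  shows "m * v x0 + g \<bullet> (x0 - a) > 0"
proof -
  have l1: "conf_factor a x0 = 1" using conf_factor_gt_1_iff(2)[OF x0(1) a(1)] x0(2) by simp
  have fix0: "sphere_refl a x0 = x0" by (simp add: sphere_refl_def l1)
  have x0P: "x0 \<in> P" using cap_point_in_P[OF x0(1) a(2)] x0(2) by simp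
  obtain C U where C: "C \<ge> 0" and U: "open U" "x0 \<in> U" and ineq: "\<And>x. x \<in> U \<Longrightarrow> norm x = 1 \<Longrightarrow> x \<bullet> a > 1 \<Longrightarrow>
      sphere_refl a x \<in> P \<Longrightarrow> \<exists>g H. sphere_jet (gap a) x g H \<and> (gap a x \<le> 1 \<longrightarrow> jet_laplacian x g H \<le> C * gap a x)"
    using gap_supersolution[OF a x0P] by metis
  obtain W where W: "open W" "x0 \<in> W" "\<And>y. y \<in> W \<Longrightarrow> norm y = 1 \<Longrightarrow> y \<in> P \<and> sphere_refl a y \<in> P"
    using refl_nbhd[OF a(1) x0P] fix0 x0P by auto
  let ?V = "U \<inter> W"
  define \<kappa> where "\<kappa> = 2 / (a \<bullet> a - 1)"
  define y where "y = x0 - a"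
  define G where "G = g - (\<kappa> * (g \<bullet> y)) *\<^sub>R y - (m * \<kappa> * v x0) *\<^sub>R y - g"
  have "\<exists>H'. sphere_jet (gap a) x0 G H'"
    using gap_jet[OF a(1) x0P _ j, of g H] x0P j fix0 unfolding l1 \<kappa>_def[symmetric] y_def[symmetric] G_def by auto
  then obtain H' where gH: "sphere_jet (gap a) x0 G H'" by blast
  have "G \<bullet> (a - (a \<bullet> x0) *\<^sub>R x0) > 0"
  proof (rule hopf_boundary_point[OF x0(1) _ _ _ C, of a ?V "gap a"])
    show "(a \<bullet> x0)\<^sup>2 < a \<bullet> a" using a(1) x0(2) by (simp add: inner_commute)
    show "open ?V" "x0 \<in> ?V" using U W by auto
    show "gap a x > 0" if "x \<in> ?V" "norm x = 1" "x \<bullet> a > x0 \<bullet> a" for x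
      using gap_pos[OF a, of x] that W(3)[of x] x0(2) by auto
    show "\<exists>g H. sphere_jet (gap a) x g H \<and> (gap a x \<le> 1 \<longrightarrow> jet_laplacian x g H \<le> C * gap a x)"
      if "x \<in> ?V" "norm x = 1" "x \<bullet> a > x0 \<bullet> a" for x
      using that ineq[of x] W(3)[of x] x0(2) by auto
    show "gap a x0 = 0" by (simp add: gap_def l1 fix0)
    show "(gap a has_derivative (\<lambda>h. G \<bullet> h)) (at x0 within sphere 0 1)"
      by (rule sphere_jet_has_derivative[OF gH x0(1)])
  qed
  moreover have "a - (a \<bullet> x0) *\<^sub>R x0 = - y" using x0(2) by (simp add: y_def inner_commute)
  moreover have yy: "y \<bullet> y = a \<bullet> a - 1"
    using dist_apex[OF x0(1), of a] x0(2) by (simp add: y_def)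
  moreover have "\<kappa> * (y \<bullet> y) = 2"
    unfolding yy \<kappa>_def using a(1) by (subst times_divide_eq_left, subst nonzero_mult_div_cancel_right) auto
  moreover have "G \<bullet> - y = (\<kappa> * (y \<bullet> y)) * (g \<bullet> y) + m * (\<kappa> * (y \<bullet> y)) * v x0"
    by (simp add: G_def inner_diff_left)
  ultimately show ?thesis by (simp add: y_def)
qed

lemma v_tendsto:
  assumes "(X \<longlongrightarrow> x) F" "x \<in> P" "eventually (\<lambda>k. X k \<in> P) F"
  shows "((\<lambda>k. v (X k)) \<longlongrightarrow> v x) F"
  using continuous_on_tendsto_compose[OF v_continuous_on assms] .

section \<open>Moving the apex\<close>

text \<open>
  The quantitative form of positivity of the gap at the image of a pole. It is stated as a lower bound
  for \<open>v\<close> near the pole, because in this form it does not involve the apex and survives a small motion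
  of the apex.
\<close>

lemma pole_lower_bound:
  assumes a: "a \<bullet> a > 1" "a \<bullet> e = c" "gap_nonneg a" and pole: "pole = e \<or> pole = - e"
  shows "\<exists>B N. v (sphere_refl a pole) < conf_factor a (sphere_refl a pole) powr m * B \<and>
    open N \<and> pole \<in> N \<and> (\<forall>y\<in>N \<inter> P. B \<le> v y)"
proof -
  define q where "q = sphere_refl a pole"
  have no: "norm pole = 1" using pole unit_e by auto
  have oa: "pole \<bullet> a < 1" using pole a(2) c by (auto simp: inner_commute)
  have lo: "0 < conf_factor a pole" "conf_factor a pole < 1"
    using conf_factor_mult(2)[OF no a(1)] conf_factor_gt_1_iff[OF no a(1)] oa by auto
  have nq: "norm q = 1" unfolding q_def by (rule norm_sphere_refl[OF no a(1)])
  have lq: "conf_factor a q = 1 / conf_factor a pole"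
    unfolding q_def by (rule conf_factor_sphere_refl[OF no a(1)])
  have qa: "q \<bullet> a > 1"
    using conf_factor_gt_1_iff(1)[OF nq a(1)] lo by (simp add: lq)
  have qP: "q \<in> P" using cap_point_in_P[OF nq a(2)] qa by simp
  have qo: "sphere_refl a q = pole" unfolding q_def by (rule sphere_refl_involution[OF no a(1)])
  obtain C U where C: "C \<ge> 0" and U: "open U" "q \<in> U" "U \<subseteq> - {e, - e}" and ineq: "\<And>x. x \<in> U \<Longrightarrow> norm x = 1 \<Longrightarrow> x \<bullet> a > 1 \<Longrightarrow>
      sphere_refl a x \<in> P \<Longrightarrow> \<exists>g H. sphere_jet (gap a) x g H \<and> (gap a x \<le> 1 \<longrightarrow> jet_laplacian x g H \<le> C * gap a x)"
    using gap_supersolution[OF a qP] by metis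
  \<comment> \<open>the image of the other pole has to be avoided as well\<close>
  define W where "W = - {a} \<inter> sphere_refl a -` (- {- pole})"
  have W: "open W" "q \<in> W"
  proof -
    show "open W" unfolding W_def
      using continuous_on_sphere_refl by (intro continuous_open_preimage) auto
    have "pole \<noteq> - pole"
    proof
      assume "pole = - pole"
      then have "2 *\<^sub>R pole = 0" unfolding scaleR_2 by (metis add.right_inverse)
      then show False using no by simp
    qed
    then show "q \<in> W" using qo unit_neq_outside[OF nq a(1)] by (auto simp: W_def)
  qed
  define V where "V = U \<inter> W \<inter> {x. 1 < x \<bullet> a}"
  have V: "open V" "q \<in> V"
    unfolding V_def using U W qa by (auto intro!: open_Int open_Collect_less continuous_intros)
  have Vx: "x \<in> P" "sphere_refl a x \<in> P" "x \<bullet> a > 1" if x: "x \<in> V" "norm x = 1" "x \<noteq> q" for x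
  proof -
    show "x \<bullet> a > 1" "x \<in> P" using x U by (auto simp: V_def P_open(2))
    have "sphere_refl a x \<noteq> pole"
      using sphere_refl_involution[OF x(2) a(1)] x(3) by (auto simp: q_def)
    moreover have "sphere_refl a x \<noteq> - pole" using x by (auto simp: V_def W_def)
    ultimately show "sphere_refl a x \<in> P"
      using pole norm_sphere_refl[OF x(2) a(1)] by (auto simp: P_def)
  qed
  have "\<exists>\<epsilon>>0. \<exists>V. open V \<and> q \<in> V \<and> (\<forall>x\<in>V. norm x = 1 \<longrightarrow> x \<noteq> q \<longrightarrow> \<epsilon> \<le> gap a x)"
  proof (rule isolated_point_lower_bound[OF dim4 nq V C])
    show "gap a x > 0" if "x \<in> V" "norm x = 1" "x \<noteq> q" for x
      using gap_pos[OF a Vx[OF that]] .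
    show "\<exists>g H. sphere_jet (gap a) x g H \<and> (gap a x \<le> 1 \<longrightarrow> jet_laplacian x g H \<le> C * gap a x)"
      if "x \<in> V" "norm x = 1" "x \<noteq> q" for x
      using ineq[of x] Vx[OF that] that by (auto simp: V_def)
  qed
  then obtain \<epsilon> V' where \<epsilon>: "\<epsilon> > 0" and V': "open V'" "q \<in> V'" "\<And>x. x \<in> V' \<Longrightarrow> norm x = 1 \<Longrightarrow> x \<noteq> q \<Longrightarrow> \<epsilon> \<le> gap a x"
    by blast
  let ?F = "at pole within P"
  have oneq: "pole \<noteq> a" using unit_neq_outside[OF no a(1)] .
  have t1: "(sphere_refl a \<longlongrightarrow> q) ?F"
    unfolding q_def by (rule tendsto_sphere_refl[OF tendsto_const tendsto_ident_at oneq])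
  have t2: "(conf_factor a \<longlongrightarrow> conf_factor a pole) ?F"
    by (rule tendsto_conf_factor[OF tendsto_const tendsto_ident_at oneq])
  have inP: "eventually (\<lambda>y. y \<in> P) ?F" by (simp add: eventually_at_filter)
  have "eventually (\<lambda>y. sphere_refl a y \<in> - {e, - e}) ?F"
    using topological_tendstoD[OF t1 P_open(1)] qP by (simp add: P_open(2))
  then have rP: "eventually (\<lambda>y. sphere_refl a y \<in> P) ?F"
    using inP by eventually_elim (use norm_sphere_refl[OF _ a(1)] in \<open>auto simp: P_open(2)\<close>)
  have lim: "((\<lambda>y. conf_factor a y powr m * (\<epsilon> + v (sphere_refl a y))) \<longlongrightarrow> conf_factor a pole powr m * (\<epsilon> + v q)) ?F"
    by (intro tendsto_intros t2 v_tendsto[OF t1 qP rP]) (use lo in auto)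
  define B where "B = conf_factor a pole powr m * (\<epsilon> / 2 + v q)"
  have "B < conf_factor a pole powr m * (\<epsilon> + v q)" using \<epsilon> lo by (simp add: B_def)
  then have "eventually (\<lambda>y. B < conf_factor a y powr m * (\<epsilon> + v (sphere_refl a y))) ?F"
    by (rule order_tendstoD(1)[OF lim])
  moreover have "eventually (\<lambda>y. sphere_refl a y \<in> V') ?F"
    using topological_tendstoD[OF t1 V'(1,2)] .
  ultimately have "eventually (\<lambda>y. B \<le> v y) ?F"
    using inP
  proof eventually_elim
    case (elim y)
    have ny: "norm y = 1" using elim P_norm by blast
    let ?x = "sphere_refl a y"
    have "?x \<noteq> q" using sphere_refl_involution[OF ny a(1)] elim(3) pole qo by (auto simp: P_def)
    then have "\<epsilon> \<le> gap a ?x" using V'(3) elim(2) norm_sphere_refl[OF ny a(1)] by blast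
    then have "\<epsilon> + v ?x \<le> (1 / conf_factor a y) powr m * v y"
      by (simp add: gap_def sphere_refl_involution[OF ny a(1)] conf_factor_sphere_refl[OF ny a(1)])
    then have "conf_factor a y powr m * (\<epsilon> + v ?x) \<le> conf_factor a y powr m * ((1 / conf_factor a y) powr m * v y)"
      by (intro mult_left_mono) auto
    also have "\<dots> = v y"
      using conf_factor_mult(2)[OF ny a(1)] by (simp add: powr_divide)
    finally show ?case using elim(1) by simp
  qed
  then obtain N where N: "open N" "pole \<in> N" "\<And>y. y \<in> N \<Longrightarrow> y \<noteq> pole \<Longrightarrow> y \<in> P \<Longrightarrow> B \<le> v y"
    unfolding eventually_at_topological by blast
  have "pole \<notin> P" using pole by (auto simp: P_def)
  then have N': "\<forall>y\<in>N \<inter> P. B \<le> v y" using N(3) by auto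
  have "conf_factor a q powr m * B = \<epsilon> / 2 + v q"
    using lo by (simp add: B_def lq powr_divide)
  then have "v q < conf_factor a q powr m * B" using \<epsilon> by simp
  then show ?thesis unfolding q_def[symmetric] using N N' by blast
qed

text \<open>
  Up to a positive factor, the positive expression is the derivative of \<open>|z - a|\<^sup>m F(z)\<close> along the ray
  from \<open>a\<close> at \<open>x0\<close>, for a local extension \<open>F\<close> of \<open>v\<close>. By continuity it stays positive near \<open>x0\<close> and
  for apexes near \<open>a\<close>. The segment from \<open>x\<close> to \<open>y\<close> leaves the
  sphere, which is why the extension is used.
\<close>

lemma local_ray_monotonicity:
  assumes x0: "norm x0 = 1" and j: "sphere_jet v x0 g H" and pos: "m * v x0 + g \<bullet> (x0 - a) > 0"
  shows "\<exists>\<delta>>0. \<forall>b x y t. norm (b - a) < \<delta> \<longrightarrow> norm (x - x0) < \<delta> \<longrightarrow> norm (y - x0) < \<delta> \<longrightarrow>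
    norm x = 1 \<longrightarrow> norm y = 1 \<longrightarrow> y - b = t *\<^sub>R (x - b) \<longrightarrow> t > 1 \<longrightarrow> v x < t powr m * v y"
proof -
  obtain U F G where U: "open U" "x0 \<in> U" and Fv: "\<And>x. x \<in> U \<Longrightarrow> norm x = 1 \<Longrightarrow> F x = v x"
    and F: "\<And>x. x \<in> U \<Longrightarrow> (F has_derivative (\<lambda>h. G x \<bullet> h)) (at x)"
    and G: "(G has_derivative H) (at x0)" "G x0 = g"
    by (rule sphere_jetE[OF j]) blast
  obtain r where r: "r > 0" "ball x0 r \<subseteq> U" using U open_contains_ball by blast
  have cF: "(F \<longlongrightarrow> F x0) (nhds x0)" and cG: "(G \<longlongrightarrow> G x0) (nhds x0)"
    using has_derivative_continuous[OF F[OF U(2)]] has_derivative_continuous[OF G(1)]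
    by (simp_all add: continuous_at tendsto_at_iff_tendsto_nhds)
  let ?N = "nhds a \<times>\<^sub>F nhds x0"
  have "((\<lambda>p. m * F (snd p) + G (snd p) \<bullet> (snd p - fst p)) \<longlongrightarrow> m * F x0 + G x0 \<bullet> (x0 - a)) ?N"
    by (intro tendsto_intros filterlim_compose[OF cF] filterlim_compose[OF cG] filterlim_snd filterlim_fst)
  moreover have "m * F x0 + G x0 \<bullet> (x0 - a) > 0" using pos Fv[OF U(2) x0] G(2) by simp
  ultimately have "eventually (\<lambda>p. m * F (snd p) + G (snd p) \<bullet> (snd p - fst p) > 0) ?N"
    by (rule order_tendstoD(1))
  then obtain \<delta>0 where \<delta>0: "\<delta>0 > 0" "\<And>b z. dist (b, z) (a, x0) < \<delta>0 \<Longrightarrow> m * F z + G z \<bullet> (z - b) > 0"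
    unfolding nhds_prod[symmetric] eventually_nhds_metric by auto
  define \<delta> where "\<delta> = min (\<delta>0 / 2) r"
  have \<delta>: "\<delta> > 0" "\<delta> \<le> \<delta>0 / 2" "\<delta> \<le> r" using \<delta>0 r by (auto simp: \<delta>_def)
  have "v x < t powr m * v y" if h: "norm (b - a) < \<delta>" "norm (x - x0) < \<delta>" "norm (y - x0) < \<delta>"
    "norm x = 1" "norm y = 1" "y - b = t *\<^sub>R (x - b)" "t > 1" for b x y t
  proof -
    define z where "z \<sigma> = b + \<sigma> *\<^sub>R (x - b)" for \<sigma>
    have z1: "z 1 = x" "z t = y" using h(6) by (auto simp: z_def algebra_simps)
    have zin: "z \<sigma> \<in> ball x0 \<delta>" if "1 \<le> \<sigma>" "\<sigma> \<le> t" for \<sigma>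
    proof -
      have "z \<sigma> = ((t - \<sigma>) / (t - 1)) *\<^sub>R x + ((\<sigma> - 1) / (t - 1)) *\<^sub>R y"
      proof -
        have y: "y = b + t *\<^sub>R (x - b)" using h(6) by (simp add: algebra_simps)
        have co: "(t - \<sigma>) / (t - 1) + (\<sigma> - 1) / (t - 1) = 1"
          using h(7) by (simp add: add_divide_distrib[symmetric])
        have cs: "(t - \<sigma>) / (t - 1) + (\<sigma> - 1) / (t - 1) * t = \<sigma>"
        proof -
          have "(t - \<sigma>) + (\<sigma> - 1) * t = \<sigma> * (t - 1)" by (simp add: algebra_simps)
          then show ?thesis
            using h(7) by (simp add: add_divide_distrib[symmetric])
        qed
        have "((t - \<sigma>) / (t - 1)) *\<^sub>R x + ((\<sigma> - 1) / (t - 1)) *\<^sub>R y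
          = ((t - \<sigma>) / (t - 1) + (\<sigma> - 1) / (t - 1)) *\<^sub>R b + ((t - \<sigma>) / (t - 1) + (\<sigma> - 1) / (t - 1) * t) *\<^sub>R (x - b)"
          unfolding y by (simp add: algebra_simps)
        then show ?thesis unfolding co cs z_def by simp
      qed
      moreover have "x \<in> ball x0 \<delta>" "y \<in> ball x0 \<delta>" using h by (auto simp: dist_norm norm_minus_commute)
      moreover have "(t - \<sigma>) / (t - 1) \<ge> 0" "(\<sigma> - 1) / (t - 1) \<ge> 0" "(t - \<sigma>) / (t - 1) + (\<sigma> - 1) / (t - 1) = 1"
        using that h(7) by (auto simp: add_divide_distrib[symmetric])
      ultimately show ?thesis using convex_ball[of x0 \<delta>] by (simp add: convex_def)
    qed
    \<comment> \<open>up to the constant \<open>|x - b|\<^sup>m\<close> this is \<open>|z - b|\<^sup>m F(z)\<close> along the ray\<close>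
    define \<phi> where "\<phi> \<sigma> = \<sigma> powr m * F (z \<sigma>)" for \<sigma>
    have d\<phi>: "(\<phi> has_real_derivative \<sigma> powr (m - 1) * (m * F (z \<sigma>) + G (z \<sigma>) \<bullet> (z \<sigma> - b))) (at \<sigma>)"
      if "1 \<le> \<sigma>" "\<sigma> \<le> t" for \<sigma>
    proof -
      have zU: "z \<sigma> \<in> U" using zin[OF that] r(2) \<delta>(3) by auto
      have "(z has_derivative (\<lambda>s. s *\<^sub>R (x - b))) (at \<sigma>)"
        unfolding z_def by (auto intro!: derivative_eq_intros)
      from has_derivative_compose[OF this F[OF zU]]
      have "((\<lambda>\<sigma>. F (z \<sigma>)) has_derivative (\<lambda>s. s * (G (z \<sigma>) \<bullet> (x - b)))) (at \<sigma>)" by simp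
      then have dF: "((\<lambda>\<sigma>. F (z \<sigma>)) has_real_derivative (G (z \<sigma>) \<bullet> (x - b))) (at \<sigma>)"
        by (simp add: has_field_derivative_def mult_commute_abs)
      have "((\<lambda>\<sigma>. \<sigma> powr m) has_real_derivative m * \<sigma> powr (m - 1)) (at \<sigma>)"
        using that by (intro has_real_derivative_powr) auto
      from DERIV_mult[OF this dF]
      have "(\<phi> has_real_derivative m * \<sigma> powr (m - 1) * F (z \<sigma>) + (G (z \<sigma>) \<bullet> (x - b)) * \<sigma> powr m) (at \<sigma>)"
        by (simp add: \<phi>_def[abs_def])
      moreover have "\<sigma> powr m = \<sigma> * \<sigma> powr (m - 1)" using that by (simp add: powr_diff)
      moreover have "G (z \<sigma>) \<bullet> (z \<sigma> - b) = \<sigma> * (G (z \<sigma>) \<bullet> (x - b))" by (simp add: z_def)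
      ultimately show ?thesis by (simp only: distrib_left mult.assoc mult.commute mult.left_commute)
    qed
    have "\<phi> 1 < \<phi> t"
    proof (rule DERIV_pos_imp_increasing[OF h(7)])
      fix \<sigma> assume s: "1 \<le> \<sigma>" "\<sigma> \<le> t"
      have "norm (z \<sigma> - x0) < \<delta>" using zin[OF s] by (simp add: dist_norm norm_minus_commute)
      have "dist (b, z \<sigma>) (a, x0) \<le> dist b a + dist (z \<sigma>) x0"
        unfolding dist_prod_def fst_conv snd_conv by (rule sqrt_sum_squares_le_sum) auto
      also have "\<dots> < \<delta>0" using \<open>norm (z \<sigma> - x0) < \<delta>\<close> h(1) \<delta>(2) by (simp add: dist_norm)
      finally have "m * F (z \<sigma>) + G (z \<sigma>) \<bullet> (z \<sigma> - b) > 0" by (rule \<delta>0(2))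
      then have "\<sigma> powr (m - 1) * (m * F (z \<sigma>) + G (z \<sigma>) \<bullet> (z \<sigma> - b)) > 0"
        using s by (intro mult_pos_pos) auto
      then show "\<exists>y. (\<phi> has_real_derivative y) (at \<sigma>) \<and> y > 0" using d\<phi>[OF s] by blast
    qed
    moreover have "x \<in> U" "y \<in> U" using zin[of 1] zin[of t] z1 h(7) r(2) \<delta>(3) by auto
    ultimately show ?thesis using Fv h(4,5) by (simp add: \<phi>_def z1)
  qed
  then show ?thesis using \<delta>(1) by blast
qed

text \<open>
  Otherwise there are apexes converging to \<open>a\<close> with points of negative gap, which accumulate at some
  \<open>x\<close> in the closed cap. On the boundary of the cap this contradicts the monotonicity along rays, in
  its interior the positivity of the gap, and at the image of a pole the lower bound near the pole.
\<close>

lemma gap_nonneg_open: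
  assumes a: "a \<bullet> a > 1" "a \<bullet> e = c" "gap_nonneg a"
  shows "\<exists>\<delta>>0. \<forall>b. norm (b - a) < \<delta> \<longrightarrow> b \<bullet> e = c \<longrightarrow> gap_nonneg b"
proof (rule ccontr)
  assume contra: "\<not> ?thesis"
  have "open {b. 1 < b \<bullet> b}" by (intro open_Collect_less continuous_intros)
  then obtain \<delta>0 where \<delta>0: "\<delta>0 > 0" "ball a \<delta>0 \<subseteq> {b. 1 < b \<bullet> b}"
    using a(1) open_contains_ball by blast
  have "\<exists>b x. norm (b - a) < min \<delta>0 (inverse (real (Suc k))) \<and> b \<bullet> e = c \<and>
      x \<in> P \<and> x \<bullet> b > 1 \<and> sphere_refl b x \<in> P \<and> gap b x < 0" for k
  proof -
    have "min \<delta>0 (inverse (real (Suc k))) > 0" using \<delta>0(1) by simp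
    then obtain b where "norm (b - a) < min \<delta>0 (inverse (real (Suc k)))" "b \<bullet> e = c" "\<not> gap_nonneg b"
      using contra by blast
    then show ?thesis unfolding gap_nonneg_def by (metis not_le)
  qed
  then obtain A0 X0 where AX0: "\<And>k. norm (A0 k - a) < min \<delta>0 (inverse (real (Suc k)))" "\<And>k. A0 k \<bullet> e = c"
      "\<And>k. X0 k \<in> P" "\<And>k. X0 k \<bullet> A0 k > 1" "\<And>k. sphere_refl (A0 k) (X0 k) \<in> P" "\<And>k. gap (A0 k) (X0 k) < 0"
    by metis
  have "seq_compact (sphere (0::'a) 1)" using compact_imp_seq_compact compact_sphere by blast
  then obtain x r where x: "x \<in> sphere 0 1" "strict_mono r" "(X0 \<circ> r) \<longlonglongrightarrow> x"
    by (rule seq_compactE[where f = X0]) (use AX0(3) P_norm in auto)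
  define A where "A = A0 \<circ> r"
  define X where "X = X0 \<circ> r"
  define Y where "Y k = sphere_refl (A k) (X k)" for k
  have "A0 \<longlonglongrightarrow> a"
    by (rule Lim_transform_bound[OF _ LIMSEQ_inverse_real_of_nat, THEN LIM_zero_cancel])
      (use AX0(1) in \<open>auto intro!: always_eventually less_imp_le\<close>)
  then have tA: "A \<longlonglongrightarrow> a" unfolding A_def by (rule LIMSEQ_subseq_LIMSEQ[OF _ x(2)])
  have tX: "X \<longlonglongrightarrow> x" using x(3) by (simp add: X_def)
  have AX: "A k \<bullet> A k > 1" "X k \<in> P" "X k \<bullet> A k > 1" "Y k \<in> P" "gap (A k) (X k) < 0" "norm (X k) = 1" for k
    using AX0 \<delta>0(2) P_norm by (auto simp: A_def X_def Y_def dist_norm norm_minus_commute subset_iff)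
  have nx: "norm x = 1" using x(1) by simp
  have xa: "x \<noteq> a" using unit_neq_outside[OF nx a(1)] .
  have tl: "(\<lambda>k. conf_factor (A k) (X k)) \<longlonglongrightarrow> conf_factor a x"
    by (rule tendsto_conf_factor[OF tA tX xa])
  have tY: "Y \<longlonglongrightarrow> sphere_refl a x"
    unfolding Y_def by (rule tendsto_sphere_refl[OF tA tX xa])
  have "(\<lambda>k. X k \<bullet> A k) \<longlonglongrightarrow> x \<bullet> a" by (intro tendsto_intros tX tA)
  then have "1 \<le> x \<bullet> a" by (rule LIMSEQ_le_const) (use AX(3) in \<open>auto intro: less_imp_le\<close>)
  then have xP: "x \<in> P" using cap_point_in_P[OF nx a(2)] by simp
  have lpos: "conf_factor a x > 0" using conf_factor_mult(2)[OF nx a(1)] .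
  have tvX: "(\<lambda>k. v (X k)) \<longlonglongrightarrow> v x" by (rule v_tendsto[OF tX xP]) (simp add: AX)
  have tlm: "(\<lambda>k. conf_factor (A k) (X k) powr m) \<longlonglongrightarrow> conf_factor a x powr m"
    using lpos by (intro tendsto_intros tl) auto
  have viol: "conf_factor (A k) (X k) powr m * v (Y k) < v (X k)" for k
    using AX(5)[of k] by (simp add: gap_def Y_def)
  consider "x \<bullet> a = 1" | "x \<bullet> a > 1" "sphere_refl a x \<in> P" | "x \<bullet> a > 1" "sphere_refl a x \<notin> P"
    using \<open>1 \<le> x \<bullet> a\<close> by force
  then show False
  proof cases
    case 1
    have fix0: "sphere_refl a x = x"
      using conf_factor_gt_1_iff(2)[OF nx a(1)] 1 by (simp add: sphere_refl_def)
    obtain g H where j: "sphere_jet v x g H" using v_jet[OF xP] by blast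
    obtain \<delta> where \<delta>: "\<delta> > 0" "\<And>b z y t. norm (b - a) < \<delta> \<Longrightarrow> norm (z - x) < \<delta> \<Longrightarrow> norm (y - x) < \<delta> \<Longrightarrow>
        norm z = 1 \<Longrightarrow> norm y = 1 \<Longrightarrow> y - b = t *\<^sub>R (z - b) \<Longrightarrow> t > 1 \<Longrightarrow> v z < t powr m * v y"
      using local_ray_monotonicity[OF nx j boundary_monotonicity[OF a nx 1 j]] by metis
    have "eventually (\<lambda>k. norm (A k - a) < \<delta> \<and> norm (X k - x) < \<delta> \<and> norm (Y k - x) < \<delta>) sequentially"
      using tendstoD[OF tA \<delta>(1)] tendstoD[OF tX \<delta>(1)] tendstoD[OF tY \<delta>(1)]
      by eventually_elim (simp add: dist_norm fix0)
    then obtain k where k: "norm (A k - a) < \<delta>" "norm (X k - x) < \<delta>" "norm (Y k - x) < \<delta>"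
      by (auto simp: eventually_sequentially)
    have "v (X k) < conf_factor (A k) (X k) powr m * v (Y k)"
    proof (rule \<delta>(2)[OF k])
      show "norm (X k) = 1" "norm (Y k) = 1" using AX P_norm by auto
      show "Y k - A k = conf_factor (A k) (X k) *\<^sub>R (X k - A k)" by (simp add: Y_def sphere_refl_def)
      show "conf_factor (A k) (X k) > 1" using conf_factor_gt_1_iff(1)[OF AX(6,1)] AX(3) by blast
    qed
    then show False using viol[of k] by simp
  next
    case 2
    have "(\<lambda>k. v (Y k)) \<longlonglongrightarrow> v (sphere_refl a x)" by (rule v_tendsto[OF tY 2(2)]) (simp add: AX)
    then have "(\<lambda>k. conf_factor (A k) (X k) powr m * v (Y k)) \<longlonglongrightarrow> conf_factor a x powr m * v (sphere_refl a x)"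
      by (intro tendsto_intros tlm)
    from LIMSEQ_le[OF this tvX] have "conf_factor a x powr m * v (sphere_refl a x) \<le> v x"
      using viol by (auto intro: less_imp_le)
    then show False using gap_pos[OF a xP 2(2,1)] by (simp add: gap_def)
  next
    case 3
    define pole' where "pole' = sphere_refl a x"
    have pole: "pole' = e \<or> pole' = - e" using 3(2) norm_sphere_refl[OF nx a(1)] by (auto simp: pole'_def P_def)
    have ox: "sphere_refl a pole' = x" unfolding pole'_def by (rule sphere_refl_involution[OF nx a(1)])
    obtain B N where B: "v x < conf_factor a x powr m * B" "open N" "pole' \<in> N" "\<And>y. y \<in> N \<Longrightarrow> y \<in> P \<Longrightarrow> B \<le> v y"
      using pole_lower_bound[OF a pole] unfolding ox by blast
    have "eventually (\<lambda>k. Y k \<in> N) sequentially"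
      using topological_tendstoD[OF tY B(2)] B(3) by (simp add: pole'_def)
    then have "eventually (\<lambda>k. conf_factor (A k) (X k) powr m * B \<le> v (X k)) sequentially"
    proof eventually_elim
      case (elim k)
      have "conf_factor (A k) (X k) powr m * B \<le> conf_factor (A k) (X k) powr m * v (Y k)"
        using B(4)[OF elim AX(4)] by (intro mult_left_mono) auto
      then show ?case using viol[of k] by simp
    qed
    moreover have "(\<lambda>k. conf_factor (A k) (X k) powr m * B) \<longlonglongrightarrow> conf_factor a x powr m * B"
      by (intro tendsto_intros tlm)
    ultimately have "conf_factor a x powr m * B \<le> v x"
      by (intro tendsto_le[OF _ tvX]) auto
    then show False using B(1) by simp
  qed
qed

lemma gap_negative_open:
  assumes a: "a \<bullet> a > 1" "\<not> gap_nonneg a"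
  shows "\<exists>\<delta>>0. \<forall>b. norm (b - a) < \<delta> \<longrightarrow> \<not> gap_nonneg b"
proof -
  obtain x where x: "x \<in> P" "x \<bullet> a > 1" "sphere_refl a x \<in> P" "gap a x < 0"
    using a(2) unfolding gap_nonneg_def by auto
  have nx: "norm x = 1" using P_norm x by blast
  have xa: "x \<noteq> a" using unit_neq_outside[OF nx a(1)] .
  have l: "conf_factor a x > 0" using conf_factor_mult(2)[OF nx a(1)] .
  have id: "((\<lambda>b. b) \<longlongrightarrow> a) (nhds a)" by (rule filterlim_ident)
  have ta: "((\<lambda>b. sphere_refl b x) \<longlongrightarrow> sphere_refl a x) (nhds a)"
    by (rule tendsto_sphere_refl[OF id tendsto_const xa])
  have big: "eventually (\<lambda>b. b \<bullet> b > 1) (nhds a)"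
    by (rule order_tendstoD(1)[OF tendsto_inner[OF id id] a(1)])
  have "eventually (\<lambda>b. sphere_refl b x \<in> - {e, - e}) (nhds a)"
    using topological_tendstoD[OF ta P_open(1)] x(3) by (simp add: P_open(2))
  then have rP: "eventually (\<lambda>b. sphere_refl b x \<in> P) (nhds a)"
    using big by eventually_elim (use norm_sphere_refl[OF nx] in \<open>auto simp: P_open(2)\<close>)
  have "((\<lambda>b. gap b x) \<longlongrightarrow> gap a x) (nhds a)"
    unfolding gap_def using l
    by (intro tendsto_intros tendsto_conf_factor[OF id tendsto_const xa] v_tendsto[OF ta x(3) rP]) auto
  then have "eventually (\<lambda>b. gap b x < 0) (nhds a)" using x(4) by (rule order_tendstoD(2))
  moreover have "eventually (\<lambda>b. x \<bullet> b > 1) (nhds a)"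
    by (rule order_tendstoD(1)[OF tendsto_inner[OF tendsto_const id] x(2)])
  ultimately have "eventually (\<lambda>b. \<not> gap_nonneg b) (nhds a)"
    using rP by eventually_elim (use x(1) in \<open>force simp: gap_nonneg_def\<close>)
  then show ?thesis by (auto simp: eventually_nhds_metric dist_norm)
qed

text \<open>
  When \<open>a\<close> is close to \<open>p\<close>, so is the whole cap. If the image of \<open>x\<close> is also close to \<open>p\<close>, rays
  from \<open>a\<close> are directions of increase, since \<open>z - a\<close> is small and \<open>m v(p) > 0\<close>. Otherwise
  the conformal factor at \<open>x\<close> is so large that the global lower bound of \<open>v\<close> suffices.
\<close>

lemma gap_nonneg_near_sphere:
  assumes p: "norm p = 1" "p \<bullet> e = c"
  shows "\<exists>\<delta>>0. \<forall>a. norm (a - p) < \<delta> \<longrightarrow> a \<bullet> a > 1 \<longrightarrow> gap_nonneg a"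
proof -
  have pP: "p \<in> P" using p ee c by (auto simp: P_def)
  have pp: "p \<bullet> p = 1" using p by (simp add: dot_square_norm)
  obtain g H where j: "sphere_jet v p g H" using v_jet[OF pP] by blast
  have "m * v p + g \<bullet> (p - p) > 0" using m_pos v_pos[OF pP] by simp
  then obtain \<delta>1 where \<delta>1: "\<delta>1 > 0" "\<And>b z y t. norm (b - p) < \<delta>1 \<Longrightarrow> norm (z - p) < \<delta>1 \<Longrightarrow> norm (y - p) < \<delta>1 \<Longrightarrow>
        norm z = 1 \<Longrightarrow> norm y = 1 \<Longrightarrow> y - b = t *\<^sub>R (z - b) \<Longrightarrow> t > 1 \<Longrightarrow> v z < t powr m * v y"
    using local_ray_monotonicity[OF p(1) j, of p] by metis
  obtain \<mu> where \<mu>: "\<mu> > 0" "\<And>x. x \<in> P \<Longrightarrow> \<mu> \<le> v x" using v_lower_bound by blast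
  obtain U where U: "open U" "p \<in> U" "\<And>y. y \<in> U \<Longrightarrow> y \<in> P \<Longrightarrow> \<bar>v y - v p\<bar> < 1"
    using continuous_within_open_nbhd[of p P v 1] v_continuous_on pP
    unfolding continuous_on_eq_continuous_within by auto
  obtain r0 where r0: "r0 > 0" "ball p r0 \<subseteq> U" using U open_contains_ball by blast
  \<comment> \<open>a conformal factor of this size lifts the lower bound \<open>\<mu>\<close> above \<open>v\<close> near \<open>p\<close>\<close>
  define \<Lambda> where "\<Lambda> = ((v p + 1) / \<mu>) powr (1 / m)"
  have "v p + 1 > 0" using v_pos[OF pP] by simp
  have \<Lambda>: "\<Lambda> > 0" "\<Lambda> powr m = (v p + 1) / \<mu>" using \<open>v p + 1 > 0\<close> \<mu>(1) m_pos by (auto simp: \<Lambda>_def powr_powr)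
  define d where "d = min \<delta>1 r0"
  define r1 where "r1 = min (d / 2) (\<delta>1 / (2 * \<Lambda>))"
  have r1: "r1 > 0" "r1 \<le> d / 2" "r1 * \<Lambda> \<le> \<delta>1 / 2"
  proof -
    show "r1 > 0" "r1 \<le> d / 2" using \<delta>1 r0 \<Lambda> by (auto simp: r1_def d_def)
    have "r1 \<le> \<delta>1 / (2 * \<Lambda>)" by (simp add: r1_def)
    then have "r1 * \<Lambda> \<le> \<delta>1 / (2 * \<Lambda>) * \<Lambda>" using \<Lambda> by (intro mult_right_mono) auto
    then show "r1 * \<Lambda> \<le> \<delta>1 / 2" using \<Lambda>(1) by simp
  qed
  have "open {b. b \<bullet> b < 1 + r1\<^sup>2}" by (intro open_Collect_less continuous_intros)
  moreover have "p \<in> {b. b \<bullet> b < 1 + r1\<^sup>2}" using r1(1) pp by simp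
  ultimately obtain \<eta>0 where \<eta>0: "\<eta>0 > 0" "ball p \<eta>0 \<subseteq> {b. b \<bullet> b < 1 + r1\<^sup>2}" using open_contains_ball by blast
  define \<eta> where "\<eta> = min \<eta>0 (d / 2)"
  have \<eta>: "\<eta> > 0" "\<eta> \<le> \<eta>0" "\<eta> \<le> d / 2" using \<eta>0 \<delta>1 r0 by (auto simp: \<eta>_def d_def)
  have d: "d \<le> \<delta>1" "d \<le> r0" by (auto simp: d_def)
  have "gap_nonneg a" if a: "norm (a - p) < \<eta>" "a \<bullet> a > 1" for a
    unfolding gap_nonneg_def
  proof (intro ballI impI)
    fix x assume x: "x \<in> P" "x \<bullet> a > 1" "sphere_refl a x \<in> P"
    let ?l = "conf_factor a x" and ?y = "sphere_refl a x"
    have nx: "norm x = 1" using P_norm x by blast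
    have l: "?l > 1" using conf_factor_gt_1_iff(1)[OF nx a(2)] x(2) by simp
    have "a \<bullet> a < 1 + r1\<^sup>2" using \<eta>0(2) a(1) \<eta>(2) by (auto simp: dist_norm norm_minus_commute subset_iff)
    moreover have "?l * (norm (x - a))\<^sup>2 = a \<bullet> a - 1"
      using conf_factor_mult(1)[OF nx a(2)] by (simp add: power2_norm_eq_inner)
    moreover have "1 * (norm (x - a))\<^sup>2 \<le> ?l * (norm (x - a))\<^sup>2" using l by (intro mult_right_mono) auto
    ultimately have "(norm (x - a))\<^sup>2 < r1\<^sup>2" by simp
    then have xa: "norm (x - a) < r1" using r1(1) by (simp add: power2_less_imp_less)
    have "norm (x - p) \<le> norm (x - a) + norm (a - p)"
      using norm_triangle_ineq[of "x - a" "a - p"] by simp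
    then have xp: "norm (x - p) < d" using xa a(1) r1(2) \<eta>(3) by simp
    have vx: "v x < v p + 1"
      using U(3)[of x] r0(2) xp d x(1) by (auto simp: dist_norm norm_minus_commute subset_iff)
    have ya: "?y - a = ?l *\<^sub>R (x - a)" by (simp add: sphere_refl_def)
    show "0 \<le> gap a x"
    proof (cases "norm (?y - p) < \<delta>1")
      case True
      have "v x < ?l powr m * v ?y"
        by (rule \<delta>1(2)[OF _ _ True nx _ ya l]) (use a \<eta>(3) d xp \<delta>1(1) P_norm[OF x(3)] in auto)
      then show ?thesis by (simp add: gap_def)
    next
      case False
      have "norm (?y - p) \<le> norm (?y - a) + norm (a - p)"
        using norm_triangle_ineq[of "?y - a" "a - p"] by simp
      then have "\<delta>1 / 2 < norm (?y - a)" using False a(1) \<eta>(3) d \<delta>1(1) by simp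
      also have "norm (?y - a) = ?l * norm (x - a)" unfolding ya using l by simp
      also have "\<dots> \<le> ?l * r1" using xa l by (intro mult_left_mono) auto
      finally have "r1 * \<Lambda> < r1 * ?l" using r1(3) by (simp add: mult.commute)
      then have "\<Lambda> \<le> ?l" using r1(1) by simp
      then have "\<Lambda> powr m \<le> ?l powr m" using \<Lambda>(1) m_pos by (intro powr_mono2) auto
      then have "\<Lambda> powr m * \<mu> \<le> ?l powr m * v ?y" using \<mu>(1) \<mu>(2)[OF x(3)] by (intro mult_mono) auto
      then have "v p + 1 \<le> ?l powr m * v ?y" using \<mu>(1) by (simp add: \<Lambda>(2))
      then show ?thesis using vx by (simp add: gap_def)
    qed
  qed
  then show ?thesis using \<eta>(1) by blast
qed

text \<open>
  The apex starts on the sphere, at \<open>s = sqrt (1 - c\<^sup>2)\<close>; the rest is connectedness of the ray.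
\<close>

lemma gap_nonneg_on_ray:
  assumes u: "norm u = 1" "u \<bullet> e = 0" and s: "s > sqrt (1 - c\<^sup>2)"
  shows "gap_nonneg (c *\<^sub>R e + s *\<^sub>R u)"
proof -
  let ?a = "\<lambda>s. c *\<^sub>R e + s *\<^sub>R u"
  define s0 where "s0 = sqrt (1 - c\<^sup>2)"
  have uu: "u \<bullet> u = 1" using u by (simp add: dot_square_norm)
  have c2: "c\<^sup>2 < 1" using c by (simp add: abs_square_less_1)
  have aa: "?a s \<bullet> ?a s = c\<^sup>2 + s\<^sup>2" for s
    by (simp add: inner_add_left inner_add_right ee uu u inner_commute[of e u] power2_eq_square)
  have ae: "?a s \<bullet> e = c" for s by (simp add: inner_add_left ee u)
  have s0sq: "s0\<^sup>2 = 1 - c\<^sup>2" "s0 > 0" using c2 by (auto simp: s0_def)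
  have aa1: "?a s \<bullet> ?a s > 1" if "s > s0" for s
  proof -
    have "s0\<^sup>2 < s\<^sup>2" using that s0sq(2) by (intro power_strict_mono) auto
    then show ?thesis unfolding aa using s0sq(1) by simp
  qed
  have diff: "norm (?a t - ?a s) = \<bar>t - s\<bar>" for s t
  proof -
    have "?a t - ?a s = (t - s) *\<^sub>R u" by (simp add: algebra_simps)
    then show ?thesis using u by simp
  qed
  define T where "T = {s. s > s0 \<and> gap_nonneg (?a s)}"
  define T' where "T' = {s. s > s0 \<and> \<not> gap_nonneg (?a s)}"
  have "open T"
    unfolding open_dist
  proof
    fix s assume "s \<in> T"
    then have s: "s > s0" "gap_nonneg (?a s)" by (auto simp: T_def)
    obtain \<delta> where "\<delta> > 0" "\<And>b. norm (b - ?a s) < \<delta> \<Longrightarrow> b \<bullet> e = c \<Longrightarrow> gap_nonneg b"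
      using gap_nonneg_open[OF aa1[OF s(1)] ae s(2)] by blast
    then show "\<exists>\<epsilon>>0. \<forall>t. dist t s < \<epsilon> \<longrightarrow> t \<in> T"
      using s(1) diff ae by (intro exI[of _ "min \<delta> (s - s0)"]) (auto simp: T_def dist_real_def)
  qed
  moreover have "open T'"
    unfolding open_dist
  proof
    fix s assume "s \<in> T'"
    then have s: "s > s0" "\<not> gap_nonneg (?a s)" by (auto simp: T'_def)
    obtain \<delta> where "\<delta> > 0" "\<And>b. norm (b - ?a s) < \<delta> \<Longrightarrow> \<not> gap_nonneg b"
      using gap_negative_open[OF aa1[OF s(1)] s(2)] by blast
    then show "\<exists>\<epsilon>>0. \<forall>t. dist t s < \<epsilon> \<longrightarrow> t \<in> T'"
      using s(1) diff by (intro exI[of _ "min \<delta> (s - s0)"]) (auto simp: T'_def dist_real_def)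
  qed
  moreover have "T \<inter> T' \<inter> {s0<..} = {}" "{s0<..} \<subseteq> T \<union> T'" by (auto simp: T_def T'_def)
  ultimately have "T \<inter> {s0<..} = {} \<or> T' \<inter> {s0<..} = {}"
    using connectedD[OF connected_Ioi] by blast
  moreover have "T \<inter> {s0<..} \<noteq> {}"
  proof -
    have "?a s0 \<bullet> ?a s0 = 1" unfolding aa using s0sq(1) by simp
    then have "norm (?a s0) = 1" by (simp add: norm_eq_sqrt_inner)
    then obtain \<delta> where \<delta>: "\<delta> > 0" "\<And>a. norm (a - ?a s0) < \<delta> \<Longrightarrow> a \<bullet> a > 1 \<Longrightarrow> gap_nonneg a"
      using gap_nonneg_near_sphere[OF _ ae] by blast
    have "gap_nonneg (?a (s0 + \<delta> / 2))"
    proof (rule \<delta>(2))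
      show "norm (?a (s0 + \<delta> / 2) - ?a s0) < \<delta>" using diff[of "s0 + \<delta> / 2" s0] \<delta>(1) by simp
      show "?a (s0 + \<delta> / 2) \<bullet> ?a (s0 + \<delta> / 2) > 1" using aa1 \<delta>(1) by simp
    qed
    then have "s0 + \<delta> / 2 \<in> T \<inter> {s0<..}" using \<delta>(1) by (simp add: T_def)
    then show ?thesis by blast
  qed
  ultimately have "s \<notin> T'" using s by (auto simp: s0_def)
  then show ?thesis using s by (auto simp: T'_def s0_def)
qed

section \<open>The limit reflection and rotational symmetry\<close>

text \<open>
  With \<open>l\<close> the conformal factor, \<open>l - 1\<close> tends to zero as the apex goes to infinity, while
  \<open>(l - 1) s\<close> tends to \<open>2 (x \<bullet> u)\<close>; this is the coefficient of the hyperplane reflection.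
\<close>

lemma reflection_le:
  assumes u: "norm u = 1" "u \<bullet> e = 0" and x: "x \<in> P" "x \<bullet> u > 0"
  shows "v x \<le> v (x - (2 * (x \<bullet> u)) *\<^sub>R u)"
proof -
  define a where "a s = c *\<^sub>R e + s *\<^sub>R u" for s
  define w where "w = x \<bullet> u"
  define h where "h = x \<bullet> e"
  define x' where "x' = x - (2 * w) *\<^sub>R u"
  have uu: "u \<bullet> u = 1" using u by (simp add: dot_square_norm)
  have nx: "norm x = 1" using P_norm x by blast
  have xx: "x \<bullet> x = 1" using nx by (simp add: dot_square_norm)
  have aa: "a s \<bullet> a s = c\<^sup>2 + s\<^sup>2" for s
    by (simp add: a_def inner_add_left inner_add_right ee uu u inner_commute[of e u] power2_eq_square)
  have xa: "x \<bullet> a s = c * h + s * w" for s by (simp add: a_def inner_add_right h_def w_def)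
  have x'P: "x' \<in> P"
  proof -
    have "x' \<bullet> x' = 1"
      by (simp add: x'_def inner_diff_left inner_diff_right xx uu inner_commute[of u x] w_def[symmetric])
    then have n: "norm x' = 1" by (simp add: norm_eq_sqrt_inner)
    have "x' \<bullet> e = x \<bullet> e" by (simp add: x'_def inner_diff_left u)
    moreover have "x \<bullet> e \<noteq> 1" "x \<bullet> e \<noteq> -1" using x(1) height_1_iff[OF nx] height_minus_1_iff[OF nx] by (auto simp: P_def)
    ultimately show ?thesis using height_1_iff[OF n] height_minus_1_iff[OF n] n by (auto simp: P_def)
  qed
  define l where "l s = conf_factor (a s) x" for s
  define \<tau> where "\<tau> s = (l s - 1) * s" for s
  have large: "eventually (\<lambda>s. s > max 1 (sqrt (1 - c\<^sup>2))) at_top" by (rule eventually_gt_at_top)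
  have far: "a s \<bullet> a s > 1" if "s > max 1 (sqrt (1 - c\<^sup>2))" for s
    unfolding aa using that one_less_power[of s 2] zero_le_power2[of c] by (simp add: add_strict_increasing2)
  have ev: "eventually (\<lambda>s. (2 * (c * h - 1) * inverse s + 2 * w) /
      ((1 - 2 * (c * h) + c\<^sup>2) * (inverse s)\<^sup>2 - 2 * w * inverse s + 1) = \<tau> s) at_top"
    using large
  proof eventually_elim
    case (elim s)
    have s: "s > 0" using elim by simp
    define D where "D = (x - a s) \<bullet> (x - a s)"
    have Dpos: "D \<noteq> 0" using unit_neq_outside[OF nx far[OF elim]] by (simp add: D_def)
    have D: "D = 1 - 2 * (c * h + s * w) + (c\<^sup>2 + s\<^sup>2)" unfolding D_def dist_apex[OF nx] xa aa ..
    have "\<tau> s = (2 * (c * h + s * w) - 2) * s / D"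
    proof -
      have "l s = (c\<^sup>2 + s\<^sup>2 - 1) / D" by (simp add: l_def conf_factor_def D_def aa)
      then have "l s - 1 = (c\<^sup>2 + s\<^sup>2 - 1 - D) / D" using Dpos by (simp add: diff_divide_distrib)
      also have "c\<^sup>2 + s\<^sup>2 - 1 - D = 2 * (c * h + s * w) - 2" by (simp add: D)
      finally show ?thesis by (simp add: \<tau>_def)
    qed
    also have "\<dots> = ((2 * (c * h + s * w) - 2) * s / s\<^sup>2) / (D / s\<^sup>2)" using s by simp
    also have "(2 * (c * h + s * w) - 2) * s / s\<^sup>2 = 2 * (c * h - 1) * inverse s + 2 * w"
      using s by (simp add: field_simps power2_eq_square)
    also have "D / s\<^sup>2 = (1 - 2 * (c * h) + c\<^sup>2) * (inverse s)\<^sup>2 - 2 * w * inverse s + 1"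
      using s unfolding D by (simp add: field_simps power2_eq_square)
    finally show ?case by simp
  qed
  have inv: "(inverse \<longlongrightarrow> (0::real)) at_top" by (rule tendsto_inverse_0_at_top) (rule filterlim_ident)
  have "((\<lambda>s. (2 * (c * h - 1) * inverse s + 2 * w) /
      ((1 - 2 * (c * h) + c\<^sup>2) * (inverse s)\<^sup>2 - 2 * w * inverse s + 1)) \<longlongrightarrow>
      (2 * (c * h - 1) * 0 + 2 * w) / ((1 - 2 * (c * h) + c\<^sup>2) * 0\<^sup>2 - 2 * w * 0 + 1)) at_top"
    by (intro tendsto_intros inv) auto
  then have t\<tau>: "(\<tau> \<longlongrightarrow> 2 * w) at_top" using tendsto_cong[OF ev] by simp
  have "((\<lambda>s. 1 + \<tau> s * inverse s) \<longlongrightarrow> 1 + 2 * w * 0) at_top" by (intro tendsto_intros t\<tau> inv)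
  moreover have "eventually (\<lambda>s. 1 + \<tau> s * inverse s = l s) at_top"
    using large
  proof eventually_elim
    case (elim s)
    then have "s * inverse s = 1" by simp
    then show ?case by (simp only: \<tau>_def mult.assoc) simp
  qed
  ultimately have tl: "(l \<longlongrightarrow> 1) at_top" using tendsto_cong by force
  have refl: "sphere_refl (a s) x = x + (l s - 1) *\<^sub>R (x - c *\<^sub>R e) - \<tau> s *\<^sub>R u" for s
    
  proof -
    have "sphere_refl (a s) x = a s + l s *\<^sub>R (x - a s)" by (simp add: sphere_refl_def l_def)
    then show ?thesis unfolding \<tau>_def a_def by (simp add: algebra_simps)
  qed
  have "((\<lambda>s. sphere_refl (a s) x) \<longlongrightarrow> x + (1 - 1) *\<^sub>R (x - c *\<^sub>R e) - (2 * w) *\<^sub>R u) at_top"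
    unfolding refl by (intro tendsto_intros tl t\<tau>)
  then have tr: "((\<lambda>s. sphere_refl (a s) x) \<longlongrightarrow> x') at_top" by (simp add: x'_def)
  have "eventually (\<lambda>s. sphere_refl (a s) x \<in> - {e, - e}) at_top"
    using topological_tendstoD[OF tr P_open(1)] x'P by (simp add: P_open(2))
  then have rP: "eventually (\<lambda>s. sphere_refl (a s) x \<in> P) at_top"
    using large by eventually_elim (use norm_sphere_refl[OF nx far] in \<open>auto simp: P_open(2)\<close>)
  have "((\<lambda>s. l s powr m * v (sphere_refl (a s) x)) \<longlongrightarrow> 1 powr m * v x') at_top"
    by (intro tendsto_intros tl v_tendsto[OF tr x'P rP]) auto
  moreover have "eventually (\<lambda>s. v x \<le> l s powr m * v (sphere_refl (a s) x)) at_top"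
    using rP large eventually_gt_at_top[of "(1 - c * h) / w"]
  proof eventually_elim
    case (elim s)
    have "x \<bullet> a s > 1" using elim(3) x(2) by (simp add: xa w_def[symmetric] field_simps)
    moreover have "gap_nonneg (a s)" unfolding a_def using le_less_trans[OF max.cobounded2 elim(2)] by (intro gap_nonneg_on_ray u)
    ultimately show ?case using elim(1) x(1) by (auto simp: gap_nonneg_def gap_def l_def)
  qed
  ultimately have "v x \<le> 1 powr m * v x'"
    by (intro tendsto_lowerbound) auto
  then show ?thesis by (simp add: x'_def w_def)
qed

lemma reflection_invariant:
  assumes u: "norm u = 1" "u \<bullet> e = 0" and x: "x \<in> P" and x': "x - (2 * (x \<bullet> u)) *\<^sub>R u \<in> P"
  shows "v (x - (2 * (x \<bullet> u)) *\<^sub>R u) = v x"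
proof -
  have le: "v y \<le> v (y - (2 * (y \<bullet> u)) *\<^sub>R u)" if "y \<in> P" for y
  proof -
    consider "y \<bullet> u > 0" | "y \<bullet> u = 0" | "y \<bullet> (- u) > 0" by force
    then show ?thesis
    proof cases
      case 3
      then show ?thesis using reflection_le[of "- u" y] u that by simp
    qed (use reflection_le u that in auto)
  qed
  define y where "y = x - (2 * (x \<bullet> u)) *\<^sub>R u"
  have "u \<bullet> u = 1" using u by (simp add: dot_square_norm)
  then have "y \<bullet> u = - (x \<bullet> u)" by (simp add: y_def inner_diff_left)
  then have yx: "y - (2 * (y \<bullet> u)) *\<^sub>R u = x" by (simp only: y_def) simp
  have "v y \<le> v x" using le[OF x'] unfolding y_def[symmetric] yx .
  then show ?thesis using le[OF x] unfolding y_def[symmetric] by simp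
qed

end

text \<open>
  The gradient of the ambient extension is read off from its derivative in the standard basis.
\<close>

lemma C2_imp_sphere_jet:
  fixes f :: "'a::euclidean_space \<Rightarrow> real"
  assumes f: "C2_on_submanifold S f" and S: "S = sphere 0 1 \<inter> W" "open W" and p: "p \<in> S"
  shows "\<exists>g H. sphere_jet f p g H"
proof -
  obtain U F where U: "p \<in> U" "C2_on_open U F" "\<And>x. x \<in> U \<inter> S \<Longrightarrow> F x = f x"
  proof -
    from f p obtain U F where "p \<in> U \<and> C2_on_open U F \<and> (\<forall>x\<in>U \<inter> S. F x = f x)"
      unfolding C2_on_submanifold_def by meson
    then show thesis by (intro that[of U F]) auto
  qed
  obtain F' :: "'a \<Rightarrow> 'a \<Rightarrow>\<^sub>L real" and F'' :: "'a \<Rightarrow> 'a \<Rightarrow>\<^sub>L 'a \<Rightarrow>\<^sub>L real"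
    where F: "open U" "\<And>x. x \<in> U \<Longrightarrow> (F has_derivative blinfun_apply (F' x)) (at x)"
      "\<And>x. x \<in> U \<Longrightarrow> (F' has_derivative blinfun_apply (F'' x)) (at x)"
  proof -
    from U(2) obtain F' :: "'a \<Rightarrow> 'a \<Rightarrow>\<^sub>L real" and F'' :: "'a \<Rightarrow> 'a \<Rightarrow>\<^sub>L 'a \<Rightarrow>\<^sub>L real"
      where "open U \<and> (\<forall>x\<in>U. (F has_derivative blinfun_apply (F' x)) (at x)) \<and>
        (\<forall>x\<in>U. (F' has_derivative blinfun_apply (F'' x)) (at x)) \<and> continuous_on U F''"
      unfolding C2_on_open_def by metis
    then show thesis by (intro that[of F' F'']) auto
  qed
  define G where "G x = (\<Sum>b\<in>Basis. blinfun_apply (F' x) b *\<^sub>R b)" for x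
  define H where "H h = (\<Sum>b\<in>Basis. blinfun_apply (blinfun_apply (F'' p) h) b *\<^sub>R b)" for h
  have G: "blinfun_apply (F' x) = (\<lambda>h. G x \<bullet> h)" for x
  proof
    fix h
    have "blinfun_apply (F' x) h = blinfun_apply (F' x) (\<Sum>b\<in>Basis. (h \<bullet> b) *\<^sub>R b)"
      by (simp add: euclidean_representation)
    also have "\<dots> = (\<Sum>b\<in>Basis. blinfun_apply (F' x) b * (b \<bullet> h))"
      by (simp add: blinfun.sum_right blinfun.scaleR_right inner_commute mult.commute)
    finally show "blinfun_apply (F' x) h = G x \<bullet> h" by (simp add: G_def inner_sum_left)
  qed
  have "(G has_derivative H) (at p)"
    unfolding G_def H_def
    by (intro has_derivative_sum has_derivative_scaleR_left
        bounded_linear.has_derivative[OF blinfun.bounded_linear_left] F(3) U(1))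
  then have "sphere_jet f p (G p) H"
    unfolding sphere_jet_def using F U(1,3) S p
    by (intro exI[of _ "U \<inter> W"] exI[of _ F] exI[of _ G]) (auto simp: G)
  then show ?thesis by blast
qed

lemma Liminf_pos_lower_bound:
  fixes f :: "'a::topological_space \<Rightarrow> real"
  assumes "Liminf (at p within S) (\<lambda>x. ereal (f x)) > 0" "p \<notin> S"
  obtains \<delta> V where "\<delta> > 0" "open V" "p \<in> V" "\<And>x. x \<in> V \<Longrightarrow> x \<in> S \<Longrightarrow> \<delta> \<le> f x"
proof -
  obtain \<delta> where \<delta>: "0 < ereal \<delta>" "ereal \<delta> < Liminf (at p within S) (\<lambda>x. ereal (f x))"
    using ereal_dense2[OF assms(1)] by blast
  have "eventually (\<lambda>x. \<delta> < f x) (at p within S)"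
    using less_LiminfD[OF \<delta>(2)] by simp
  then obtain V where "open V" "p \<in> V" "\<And>x. x \<in> V \<Longrightarrow> x \<noteq> p \<Longrightarrow> x \<in> S \<Longrightarrow> \<delta> < f x"
    unfolding eventually_at_topological by blast
  then show thesis using \<delta>(1) assms(2) by (intro that[of \<delta> V]) (auto intro: less_imp_le)
qed

theorem corollary1p2:
  fixes K v :: "(real ^ 'n::finite) \<times> real \<Rightarrow> real"
  assumes "CARD('n) \<ge> 3"
    and "continuous_on punctured_sphere K"
    and "rotationally_symmetric punctured_sphere K"
    and "\<exists>c::real. -1 < c \<and> c < 1 \<and>
      (\<forall>\<theta>\<in>punctured_sphere. \<forall>\<theta>'\<in>punctured_sphere.
        snd \<theta> > snd \<theta>' \<and> snd \<theta>' \<ge> c \<longrightarrow> K \<theta> > K \<theta>') \<and>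
      (\<forall>\<theta>\<in>punctured_sphere. \<forall>\<theta>'\<in>punctured_sphere.
        snd \<theta> < snd \<theta>' \<and> snd \<theta>' \<le> c \<longrightarrow> K \<theta> > K \<theta>')"
    and "C2_on_submanifold punctured_sphere v"
    and "\<forall>\<theta>\<in>punctured_sphere. - conformal_laplacian v \<theta> =
      K \<theta> * v \<theta> powr ((real CARD('n) + 2) / (real CARD('n) - 2))"
    and "\<forall>\<theta>\<in>punctured_sphere. v \<theta> > 0"
    and "Liminf (at north_pole within punctured_sphere) (\<lambda>\<theta>. ereal (v \<theta>)) > 0"
    and "Liminf (at south_pole within punctured_sphere) (\<lambda>\<theta>. ereal (v \<theta>)) > 0"
  shows "rotationally_symmetric punctured_sphere v"
proof -
  let ?P = "punctured_sphere :: ((real ^ 'n) \<times> real) set"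
  let ?e = "north_pole :: (real ^ 'n) \<times> real"
  define n where "n = real CARD('n)"
  define m where "m = (n - 2) / 2"
  obtain c where c: "-1 < c" "c < 1"
    and up: "\<And>x y. x \<in> ?P \<Longrightarrow> y \<in> ?P \<Longrightarrow> snd y < snd x \<Longrightarrow> c \<le> snd y \<Longrightarrow> K y < K x"
    and down: "\<And>x y. x \<in> ?P \<Longrightarrow> y \<in> ?P \<Longrightarrow> snd x < snd y \<Longrightarrow> snd y \<le> c \<Longrightarrow> K y < K x"
    using assms(4) by blast
  have n3: "n \<ge> 3" using assms(1) by (simp add: n_def)
  have south: "south_pole = - ?e" by (simp add: north_pole_def south_pole_def)
  have height: "x \<bullet> ?e = snd x" for x :: "(real ^ 'n) \<times> real"
    by (simp add: north_pole_def inner_prod_def)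
  have P_sphere: "?P = sphere 0 1 - {?e, - ?e}" by (simp add: punctured_sphere_def south)
  interpret axial_curvature_equation ?e K v c m ?P
  proof
    show "?P = sphere 0 1 - {?e, - ?e}" by (fact P_sphere)
    show "norm ?e = 1" by (simp add: north_pole_def norm_prod_def)
    have "real DIM((real ^ 'n) \<times> real) = n + 1" by (simp add: n_def)
    also have "n + 1 = 2 * m + 3" by (simp add: m_def field_simps)
    finally show "real DIM((real ^ 'n) \<times> real) = 2 * m + 3" .
    show "4 \<le> DIM((real ^ 'n) \<times> real)" using assms(1) by simp
    show "-1 < c" "c < 1" by (fact c)+
    show "continuous_on ?P K" by (fact assms(2))
    show "K x = K y" if "x \<in> ?P" "y \<in> ?P" "x \<bullet> ?e = y \<bullet> ?e" for x y
    proof -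
      obtain p s where x: "x = (p, s)" by fastforce
      obtain q t where y: "y = (q, t)" by fastforce
      have st: "s = t" using that(3) by (simp add: height x y)
      have "norm x = norm y" using that(1,2) by (simp add: P_sphere)
      then have "norm p = norm q" by (simp add: x y st norm_prod_def)
      then obtain f where f: "orthogonal_transformation f" "det (matrix f) = 1" "f p = q"
        using rotation_exists[of p q] assms(1) by auto
      define A where "A = matrix f"
      have A: "rotation_matrix A" "A *v p = q"
        using f by (auto simp: A_def rotation_matrix_def orthogonal_transformation_matrix matrix_works)
      then have "K (A *v p, s) = K (p, s)"
        using assms(3) that(1) unfolding rotationally_symmetric_def x by auto
      then show ?thesis by (simp add: A(2) x y st)
    qed
    show "K y < K x" if "x \<in> ?P" "y \<in> ?P" "y \<bullet> ?e < x \<bullet> ?e" "c \<le> y \<bullet> ?e" for x y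
      using up that by (simp add: height)
    show "K y < K x" if "x \<in> ?P" "y \<in> ?P" "x \<bullet> ?e < y \<bullet> ?e" "y \<bullet> ?e \<le> c" for x y
      using down that by (simp add: height)
    have "?P = sphere 0 1 \<inter> - {?e, - ?e}" by (auto simp: P_sphere)
    from C2_imp_sphere_jet[OF assms(5) this] show "\<exists>g H. sphere_jet v x g H" if "x \<in> ?P" for x
      using that by (simp add: finite_imp_closed open_Compl)
    show "jet_laplacian x g H - m * (m + 1) * v x = - K x * v x powr ((m + 2) / m)"
      if x: "x \<in> ?P" and j: "sphere_jet v x g H" for x g H
    proof -
      have "norm x = 1" using x by (simp add: P_sphere)
      then have "sphere_laplacian v x = jet_laplacian x g H"
        using j by (rule sphere_laplacian_eq_jet_laplacian)
      moreover have "n * (n - 2) / 4 = m * (m + 1)" by (simp add: m_def field_simps)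
      moreover have "(m + 2) / m = (n + 2) / (n - 2)" using n3 by (simp add: m_def field_simps)
      moreover have "- conformal_laplacian v x = K x * v x powr ((n + 2) / (n - 2))"
        using assms(6) x by (simp add: n_def)
      ultimately show ?thesis
        unfolding conformal_laplacian_def n_def[symmetric] by simp
    qed
    show "v x > 0" if "x \<in> ?P" for x using assms(7) that by blast
    have "?e \<notin> ?P" "south_pole \<notin> ?P" by (auto simp: P_sphere south)
    obtain \<delta>1 V1 where 1: "\<delta>1 > 0" "open V1" "?e \<in> V1" "\<And>x. x \<in> V1 \<Longrightarrow> x \<in> ?P \<Longrightarrow> \<delta>1 \<le> v x"
      using Liminf_pos_lower_bound[OF assms(8) \<open>?e \<notin> ?P\<close>] by blast
    obtain \<delta>2 V2 where 2: "\<delta>2 > 0" "open V2" "- ?e \<in> V2" "\<And>x. x \<in> V2 \<Longrightarrow> x \<in> ?P \<Longrightarrow> \<delta>2 \<le> v x"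
      using Liminf_pos_lower_bound[OF assms(9) \<open>south_pole \<notin> ?P\<close>] unfolding south by blast
    show "\<exists>\<delta>>0. \<exists>V. open V \<and> ?e \<in> V \<and> - ?e \<in> V \<and> (\<forall>x\<in>V \<inter> ?P. \<delta> \<le> v x)"
    proof (intro exI conjI)
      show "min \<delta>1 \<delta>2 > 0" "open (V1 \<union> V2)" using 1 2 by auto
      show "\<forall>x\<in>(V1 \<union> V2) \<inter> ?P. min \<delta>1 \<delta>2 \<le> v x" using 1(4) 2(4) by fastforce
    qed (use 1 2 in auto)
  qed
  show ?thesis
    unfolding rotationally_symmetric_def
  proof (intro allI impI ballI, clarify)
    fix A :: "real ^ 'n ^ 'n" and p :: "real ^ 'n" and t :: real
    assume A: "rotation_matrix A" and x: "(p, t) \<in> ?P"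
    define q where "q = A *v p"
    have nq: "norm q = norm p"
      using A orthogonal_transformation_matrix[of "(*v) A"]
      by (simp add: q_def rotation_matrix_def orthogonal_transformation_norm)
    show "v (A *v p, t) = v (p, t)"
    proof (cases "q = p")
      case False
      \<comment> \<open>the reflection in the bisector of \<open>p\<close> and \<open>q\<close> exchanges the two points\<close>
      define d where "d = p - q"
      have "d \<noteq> 0" using False by (simp add: d_def)
      define u where "u = (d /\<^sub>R norm d, 0::real)"
      have "p \<bullet> p = q \<bullet> q" using nq by (simp add: dot_square_norm)
      then have "d \<bullet> d = 2 * (p \<bullet> d)" by (simp add: d_def inner_diff_left inner_diff_right inner_commute)
      moreover have "(p, t) \<bullet> u = (p \<bullet> d) / norm d" by (simp add: u_def inner_prod_def divide_inverse)
      ultimately have "2 * ((p, t) \<bullet> u) = (d \<bullet> d) / norm d" by simp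
      then have xu: "2 * ((p, t) \<bullet> u) = norm d"
        by (simp add: dot_square_norm power2_eq_square)
      have refl: "(p, t) - (2 * ((p, t) \<bullet> u)) *\<^sub>R u = (q, t)"
        unfolding xu using \<open>d \<noteq> 0\<close> by (simp add: u_def d_def)
      have "norm u = 1" "u \<bullet> ?e = 0"
        using \<open>d \<noteq> 0\<close> by (simp_all add: u_def norm_prod_def height)
      moreover have "(q, t) \<in> ?P"
      proof -
        have "norm (q, t) = norm (p, t)" by (simp add: norm_prod_def nq)
        moreover have "q = 0 \<longleftrightarrow> p = 0" using nq by (metis norm_eq_zero)
        ultimately show ?thesis
          using x by (auto simp: P_sphere north_pole_def)
      qed
      ultimately show ?thesis
        using reflection_invariant[of u "(p, t)"] x unfolding refl q_def by blast
    qed (simp add: q_def)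
  qed
qed

end
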